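(* Fix $\ell\ge 2$ and $\mathbf m$ with $\sigma:=\sum_{S\in\binom{[\ell]}{2}}\mathbf m_S>0$. As $n\to\infty$, $$s^*(n,\ell,\mathbf m)=\Bigl(1+O\bigl(\tfrac1n\bigr)\Bigr)\,2^n\prod_{S\in\binom{[\ell]}{2}}\frac{1}{\mathbf m_S!}\Bigl(\frac{\mathbf m_S\, n}{\sigma}\Bigr)^{\mathbf m_S}.$$ Moreover, for all sufficiently large $n$ and every extremal example $\mathcal F_1,\dots,\mathcal F_\ell$, there exist an oriented graph $T=([\ell],E)$ and sets $A_e\subseteq[n]$, $e\in E$, such that: (1) for distinct $k_1,k_2\in[\ell]$ there is an edge between $k_1$ and $k_2$ (in exactly one direction) if and only if $\mathbf m_{\{k_1,k_2\}}>0$; (2) the sets $A_e$, $e\in E$, form a partition of $[n]$, and $|A_{(k,k')}|=(1+O(n^{-1}))\,\mathbf m_{\{k,k'\}}\,n/\sigma$ for every $(k,k')\in E$; (3) for every $k\in[\ell]$, writing $In_k=\{k':(k',k)\in E\}$ and $Out_k=\{k':(k,k')\in E\}$, $$2^{\bigsqcup_{k'\in In_k}A_{(k',k)}}\vee\bigvee_{k'\in Out_k}\binom{A_{(k,k')}}{\le \mathbf m_{\{k,k'\}}}\subseteq\mathcal F_k .$$ The implied constants depend only on $\ell$ and $\mathbf m$.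
   Context: $[n]=\{1,\dots,n\}$; $2^X$ is the power set of $X$ and $\binom{X}{\le t}$ the family of subsets of $X$ with at most $t$ elements. For families $\mathcal A,\mathcal B$, $\mathcal A\vee\mathcal B=\{A\cup B: A\in\mathcal A,B\in\mathcal B\}$; an empty $\vee$-product is $\{\emptyset\}$ and $2^{\emptyset}=\{\emptyset\}$. Let $\mathbf m=(\mathbf m_S)_{S\in\binom{[\ell]}{2}}$ be non-negative integers indexed by unordered pairs, with $\mathbf m_{k,k'}=\mathbf m_{\{k,k'\}}$. Families $\mathcal F_1,\dots,\mathcal F_\ell\subseteq 2^{[n]}$ have the $\mathbf m$-overlapping property if $|F\cap F'|\le\mathbf m_{k,k'}$ whenever $k\neq k'$, $F\in\mathcal F_k$, $F'\in\mathcal F_{k'}$. $s^*(n,\ell,\mathbf m)$ denotes the maximum of $|\mathcal F_1|\cdots|\mathcal F_\ell|$ over all $\mathbf m$-overlapping families, and an extremal example is a tuple of $\mathbf m$-overlapping families attaining this maximum. Asymptotic notation refers to $\ell,\mathbf m$ fixed and $n\to\infty$. *)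

theory Defs
  imports Complex_Main
begin

definition pairs :: "nat \<Rightarrow> nat set set" where
  "pairs l = {S. S \<subseteq> {1..l} \<and> card S = 2}"

definition overlapping :: "nat \<Rightarrow> nat \<Rightarrow> (nat set \<Rightarrow> nat) \<Rightarrow> (nat \<Rightarrow> nat set set) \<Rightarrow> bool" where
  "overlapping n l m F \<longleftrightarrow>
     (\<forall>k\<in>{1..l}. F k \<subseteq> Pow {1..n}) \<and>
     (\<forall>k\<in>{1..l}. \<forall>k'\<in>{1..l}. k \<noteq> k' \<longrightarrow>
        (\<forall>A\<in>F k. \<forall>B\<in>F k'. card (A \<inter> B) \<le> m {k, k'}))"

definition s_star :: "nat \<Rightarrow> nat \<Rightarrow> (nat set \<Rightarrow> nat) \<Rightarrow> nat" where
  "s_star n l m = Max {\<Prod>k\<in>{1..l}. card (F k) | F. overlapping n l m F}"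

definition extremal :: "nat \<Rightarrow> nat \<Rightarrow> (nat set \<Rightarrow> nat) \<Rightarrow> (nat \<Rightarrow> nat set set) \<Rightarrow> bool" where
  "extremal n l m F \<longleftrightarrow> overlapping n l m F \<and> (\<Prod>k\<in>{1..l}. card (F k)) = s_star n l m"

text \<open>Join of two families, and the join over an index set (empty join = {{}}).\<close>
definition join :: "'a set set \<Rightarrow> 'a set set \<Rightarrow> 'a set set" where
  "join \<A> \<B> = {A \<union> B | A B. A \<in> \<A> \<and> B \<in> \<B>}"

definition Join :: "'i set \<Rightarrow> ('i \<Rightarrow> 'a set set) \<Rightarrow> 'a set set" where
  "Join I f = {\<Union> (g ` I) | g. \<forall>i\<in>I. g i \<in> f i}"

definition subsets_le :: "'a set \<Rightarrow> nat \<Rightarrow> 'a set set" where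
  "subsets_le X t = {B. B \<subseteq> X \<and> card B \<le> t}"

definition main_term :: "nat \<Rightarrow> nat \<Rightarrow> (nat set \<Rightarrow> nat) \<Rightarrow> real" where
  "main_term n l m =
     2 ^ n * (\<Prod>S\<in>pairs l. (1 / fact (m S)) *
        (real (m S) * real n / real (\<Sum>S'\<in>pairs l. m S')) ^ (m S))"

end

(*
  Proof idea. Let F_1, ..., F_l be extremal and let q_k(v) be the probability that a uniformly
  random member of F_k contains v. Deleting v from every family and comparing with the trivial
  bound s*(n) >= 2 s*(n-1) gives prod_k (1 - q_k(v)) <= 1/2, whereas counting intersections gives
  sum_v q_i(v) q_j(v) <= m_ij. Hence all but boundedly many v have exactly one owner k with q_k(v)
  close to 1/2, and almost every member of F_k can be enlarged by any bounded set of vertices owned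
  by k without leaving F_k. Consequently a member of F_j has at most m_jk vertices in the part B_k
  owned by k, and independent random members of F_j and F_k have tau_jk and tau_kj vertices there
  with tau_jk + tau_kj = m_jk; the last equality comes from comparison with an explicit example.

  If a set X off B_i is incompatible with linearly many disjoint bounded subsets of B_i, then an
  exponentially small fraction of the subsets of B_i can be added to X inside F_i. This kills all
  members of the wrong type, all exceptional vertices, and shows that at most one family other
  than the owner uses a given vertex with probability of order 1/n. That family exists because
  cloning a vertex gives s*(n+1) >= 2 (1 + c/n) s*(n). So each B_k splits into parts A_jk, and by
  Vandermonde's identity it is wasteful to have both tau_jk > 0 and tau_kj > 0, whence the
  orientation. Deleting and cloning an average vertex of A_jk determines s*(n+1)/s*(n) up to
  O(1/n^2), which forces the sizes of the A_jk up to O(1). Finally, adding all missing members of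
  the ideal families and removing the members that conflict with them would increase the product,
  since the relative loss is O(1/n) times the relative gain; so no ideal member is missing.
*)
theory Submission
  imports Defs "HOL-Library.FuncSet"
begin

section \<open>Uniform probability on a finite family\<close>

text \<open>The recurring obstacle: a non-owner uses a vertex only with probability of order 1/n, so
  an error of order 1/n, harmless for a random member of a family, is as large as the event itself
  once the member must contain a given vertex. The remedy is to count, among the members containing
  \<open>v\<close>, the failed extensions over all vertices of the owned part: their total is
  O(1/n), so all but boundedly many vertices are safe (\<open>sum_bd_le\<close>,
  \<open>Bad\<close>). The growth ratio of \<open>s_star\<close> is bootstrapped: doubling yields
  the vertex partition, a gain of at least 1/(8n) gives each vertex a second user, and only then is
  the gain identified as \<open>sg / n\<close> up to O(1/n^2). The gain at n is read off an extremal
  example on n - 1 points, which is why all constants are functions of one \<open>C\<close>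
  independent of n. In the final exchange, conflicts are grouped by their trace R off the owner's
  part: such a conflict has probability O(n^-(|R|+1)) but certifies a proportion of order n^-|R| of
  missing members, and this is where the factor 1/n comes from.\<close>

definition Pr :: "'a set \<Rightarrow> ('a \<Rightarrow> bool) \<Rightarrow> real" where
  "Pr \<F> P = real (card {G\<in>\<F>. P G}) / real (card \<F>)"

lemma Pr_nonneg [simp]: "0 \<le> Pr \<F> P"
  by (simp add: Pr_def)

lemma Pr_mono:
  assumes "finite \<F>" "\<And>G. G \<in> \<F> \<Longrightarrow> P G \<Longrightarrow> Q G"
  shows "Pr \<F> P \<le> Pr \<F> Q"
  unfolding Pr_def
  by (intro divide_right_mono of_nat_mono card_mono) (use assms in auto)

lemma Pr_cong:
  assumes "\<And>G. G \<in> \<F> \<Longrightarrow> P G \<longleftrightarrow> Q G"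
  shows "Pr \<F> P = Pr \<F> Q"
proof -
  have "{G\<in>\<F>. P G} = {G\<in>\<F>. Q G}" using assms by auto
  then show ?thesis by (simp add: Pr_def)
qed

lemma Pr_le_1: "finite \<F> \<Longrightarrow> Pr \<F> P \<le> 1"
  unfolding Pr_def by (cases "card \<F> = 0") (auto simp: divide_le_eq_1 card_gt_0_iff intro!: card_mono)

lemma Pr_disj:
  assumes "finite \<F>"
  shows "Pr \<F> (\<lambda>G. P G \<or> Q G) \<le> Pr \<F> P + Pr \<F> Q"
proof -
  have "{G\<in>\<F>. P G \<or> Q G} = {G\<in>\<F>. P G} \<union> {G\<in>\<F>. Q G}" by auto
  then have "card {G\<in>\<F>. P G \<or> Q G} \<le> card {G\<in>\<F>. P G} + card {G\<in>\<F>. Q G}"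
    by (simp only: card_Un_le)
  then show ?thesis unfolding Pr_def add_divide_distrib [symmetric]
    by (intro divide_right_mono) linarith+
qed

lemma Pr_compl:
  assumes "finite \<F>" "\<F> \<noteq> {}"
  shows "Pr \<F> (\<lambda>G. \<not> P G) = 1 - Pr \<F> P"
proof -
  have "card \<F> = card {G\<in>\<F>. \<not> P G} + card {G\<in>\<F>. P G}"
    by (subst card_Un_disjoint [symmetric]) (use assms in \<open>auto intro: arg_cong [where f = card]\<close>)
  moreover have "card \<F> > 0" using assms by (simp add: card_gt_0_iff)
  moreover have "real (card \<F>) = real (card {G\<in>\<F>. \<not> P G}) + real (card {G\<in>\<F>. P G})"
    using calculation(1) by simp
  ultimately show ?thesis unfolding Pr_def by (simp add: eq_diff_eq flip: add_divide_distrib)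
qed

lemma Pr_Bex:
  assumes "finite \<F>" "finite D"
  shows "Pr \<F> (\<lambda>G. \<exists>u\<in>D. P u G) \<le> (\<Sum>u\<in>D. Pr \<F> (P u))"
  using assms(2)
proof (induction D)
  case empty
  then show ?case by (simp add: Pr_def)
next
  case (insert x D)
  have "Pr \<F> (\<lambda>G. \<exists>u\<in>insert x D. P u G) = Pr \<F> (\<lambda>G. P x G \<or> (\<exists>u\<in>D. P u G))"
    by (rule Pr_cong) auto
  then show ?case using Pr_disj [OF assms(1), of "P x" "\<lambda>G. \<exists>u\<in>D. P u G"] insert by simp
qed

lemma Pr_diff_le:
  assumes "finite \<F>"
  shows "Pr \<F> P \<le> Pr \<F> (\<lambda>G. P G \<and> \<not> Q G) + Pr \<F> Q"
  by (rule order_trans [OF Pr_mono [OF assms] Pr_disj [OF assms]]) auto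

lemma card_eq_Pr:
  assumes "finite \<F>" "\<F> \<noteq> {}"
  shows "real (card {G\<in>\<F>. P G}) = Pr \<F> P * real (card \<F>)"
  using assms by (simp add: Pr_def)

section \<open>Double counting of incidences between members and vertices\<close>

lemma sum_card_Int_swap:
  assumes "finite \<G>" "finite A"
  shows "(\<Sum>v\<in>A. card {G\<in>\<G>. v \<in> G}) = (\<Sum>G\<in>\<G>. card (G \<inter> A))"
proof -
  have "(\<Sum>v\<in>A. card {G\<in>\<G>. v \<in> G}) = (\<Sum>v\<in>A. \<Sum>G\<in>\<G>. if v \<in> G then 1 else 0)"
    using assms by (intro sum.cong refl) (simp add: sum.If_cases Int_def)
  also have "\<dots> = (\<Sum>G\<in>\<G>. \<Sum>v\<in>A. if v \<in> G then 1 else 0)" by (rule sum.swap)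
  also have "\<dots> = (\<Sum>G\<in>\<G>. card (G \<inter> A))"
    using assms by (intro sum.cong refl) (simp add: sum.If_cases Int_commute)
  finally show ?thesis .
qed

lemma sum_Pr_mem:
  assumes "finite \<F>" "finite A"
  shows "(\<Sum>v\<in>A. Pr \<F> (\<lambda>G. P G \<and> v \<in> G)) = real (\<Sum>G\<in>{G\<in>\<F>. P G}. card (G \<inter> A)) / real (card \<F>)"
proof -
  have "(\<Sum>v\<in>A. Pr \<F> (\<lambda>G. P G \<and> v \<in> G)) = real (\<Sum>v\<in>A. card {G\<in>{G\<in>\<F>. P G}. v \<in> G}) / real (card \<F>)"
    unfolding Pr_def by (simp add: sum_divide_distrib)
  also have "(\<Sum>v\<in>A. card {G\<in>{G\<in>\<F>. P G}. v \<in> G}) = (\<Sum>G\<in>{G\<in>\<F>. P G}. card (G \<inter> A))"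
    using assms by (intro sum_card_Int_swap) auto
  finally show ?thesis .
qed

lemma sum_Pr_mem_le:
  assumes "finite \<F>" "finite A" "\<And>G. G \<in> \<F> \<Longrightarrow> P G \<Longrightarrow> card (G \<inter> A) \<le> c"
  shows "(\<Sum>v\<in>A. Pr \<F> (\<lambda>G. P G \<and> v \<in> G)) \<le> real c * Pr \<F> P"
proof -
  have "(\<Sum>G\<in>{G\<in>\<F>. P G}. card (G \<inter> A)) \<le> c * card {G\<in>\<F>. P G}"
    using sum_bounded_above [of "{G\<in>\<F>. P G}" "\<lambda>G. card (G \<inter> A)" c] assms by (simp add: mult.commute)
  then have "real (\<Sum>G\<in>{G\<in>\<F>. P G}. card (G \<inter> A)) \<le> real c * real (card {G\<in>\<F>. P G})"
    by - (drule of_nat_mono [where 'a = real], simp)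
  then show ?thesis unfolding sum_Pr_mem [OF assms(1,2)] unfolding Pr_def times_divide_eq_right
    by (rule divide_right_mono) simp
qed

lemma sum_Pr_mem_ge:
  assumes "finite \<F>" "finite A" "\<And>G. G \<in> \<F> \<Longrightarrow> P G \<Longrightarrow> card (G \<inter> A) \<ge> c"
  shows "(\<Sum>v\<in>A. Pr \<F> (\<lambda>G. P G \<and> v \<in> G)) \<ge> real c * Pr \<F> P"
proof -
  have "(\<Sum>G\<in>{G\<in>\<F>. P G}. card (G \<inter> A)) \<ge> c * card {G\<in>\<F>. P G}"
    using sum_bounded_below [of "{G\<in>\<F>. P G}" c "\<lambda>G. card (G \<inter> A)"] assms by (simp add: mult.commute)
  then have "real (\<Sum>G\<in>{G\<in>\<F>. P G}. card (G \<inter> A)) \<ge> real c * real (card {G\<in>\<F>. P G})"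
    by - (drule of_nat_mono [where 'a = real], simp)
  then show ?thesis unfolding sum_Pr_mem [OF assms(1,2)] unfolding Pr_def times_divide_eq_right
    by (rule divide_right_mono) simp
qed

text \<open>Adding the elements of \<open>D\<close> one at a time: \<open>G \<mapsto> G \<union> D'\<close> is at most \<open>2 ^ card D'\<close> to one.\<close>

lemma Pr_extension_le:
  fixes \<F> :: "'a set set"
  assumes "finite \<F>" "finite D"
    and P: "\<And>G u. P G \<Longrightarrow> u \<in> D \<Longrightarrow> P (insert u G)"
  shows "Pr \<F> (\<lambda>G. P G \<and> G \<union> D \<notin> \<F>) \<le>
         2 ^ card D * (\<Sum>u\<in>D. Pr \<F> (\<lambda>G. P G \<and> u \<notin> G \<and> insert u G \<notin> \<F>))"
  using assms(2) P
proof (induction D)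
  case empty
  have e: "{G\<in>\<F>. P G \<and> G \<union> {} \<notin> \<F>} = {}" by auto
  show ?case unfolding Pr_def e by simp
next
  case (insert x D)
  define S where "S = (\<Sum>u\<in>D. Pr \<F> (\<lambda>G. P G \<and> u \<notin> G \<and> insert u G \<notin> \<F>))"
  have PD: "P (G \<union> D)" if "P G" for G
    using \<open>finite D\<close> that insert.prems
  proof (induction D)
    case (insert y D')
    then have "P (insert y (G \<union> D'))" by blast
    then show ?case by simp
  qed simp
  define X where "X = {G\<in>\<F>. P G \<and> x \<notin> G \<and> insert x G \<notin> \<F>}"
  define Y where "Y = {G\<in>\<F>. P G \<and> G \<union> D \<in> X}"
  have "Y \<subseteq> (\<lambda>(U, T). (U - D) \<union> T) ` (X \<times> Pow D)"
  proof
    fix G assume "G \<in> Y"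
    then have "(G \<union> D, G \<inter> D) \<in> X \<times> Pow D" by (auto simp: Y_def)
    moreover have "G = (\<lambda>(U, T). (U - D) \<union> T) (G \<union> D, G \<inter> D)" by auto
    ultimately show "G \<in> (\<lambda>(U, T). (U - D) \<union> T) ` (X \<times> Pow D)" by (rule rev_image_eqI)
  qed
  then have "card Y \<le> card ((\<lambda>(U, T). (U - D) \<union> T) ` (X \<times> Pow D))"
    using insert.hyps \<open>finite \<F>\<close> by (intro card_mono) (auto simp: X_def)
  also have "\<dots> \<le> card (X \<times> Pow D)"
    by (rule card_image_le) (use insert.hyps \<open>finite \<F>\<close> in \<open>auto simp: X_def\<close>)
  also have "\<dots> = card X * 2 ^ card D"
    by (simp add: card_cartesian_product card_Pow insert.hyps)
  finally have "real (card Y) \<le> real (card X) * 2 ^ card D"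
    by - (drule of_nat_mono [where 'a = real], simp)
  then have 1: "Pr \<F> (\<lambda>G. P G \<and> G \<union> D \<in> X) \<le> 2 ^ card D * Pr \<F> (\<lambda>G. P G \<and> x \<notin> G \<and> insert x G \<notin> \<F>)"
    unfolding Pr_def X_def [symmetric] Y_def [symmetric] by (simp add: divide_right_mono mult.commute)
  have "Pr \<F> (\<lambda>G. P G \<and> G \<union> insert x D \<notin> \<F>) \<le>
      Pr \<F> (\<lambda>G. (P G \<and> G \<union> D \<notin> \<F>) \<or> (P G \<and> G \<union> D \<in> X))"
  proof (rule Pr_mono [OF \<open>finite \<F>\<close>])
    fix G assume "G \<in> \<F>" and h: "P G \<and> G \<union> insert x D \<notin> \<F>"
    show "(P G \<and> G \<union> D \<notin> \<F>) \<or> (P G \<and> G \<union> D \<in> X)"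
    \<comment> \<open>If \<open>G \<union> D\<close> is still a member, the failure is caused by the
      last vertex \<open>x\<close> alone.\<close>
    proof (cases "G \<union> D \<in> \<F>")
      case True
      then have "x \<notin> G \<union> D" using h by (metis Un_insert_right insert_absorb)
      then show ?thesis using h True PD by (auto simp: X_def)
    qed (use h in auto)
  qed
  also have "\<dots> \<le> Pr \<F> (\<lambda>G. P G \<and> G \<union> D \<notin> \<F>) + Pr \<F> (\<lambda>G. P G \<and> G \<union> D \<in> X)"
    by (rule Pr_disj) (rule assms)
  also have "\<dots> \<le> 2 ^ card D * S + 2 ^ card D * Pr \<F> (\<lambda>G. P G \<and> x \<notin> G \<and> insert x G \<notin> \<F>)"
    using 1 insert.IH insert.prems by (intro add_mono) (auto simp: S_def)
  also have "\<dots> \<le> 2 ^ card (insert x D) * (S + Pr \<F> (\<lambda>G. P G \<and> x \<notin> G \<and> insert x G \<notin> \<F>))"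
  proof -
    have "0 \<le> S" by (auto simp: S_def intro: sum_nonneg)
    then show ?thesis using insert.hyps by (simp add: distrib_left)
  qed
  finally show ?case using insert.hyps by (simp add: S_def add.commute)
qed

text \<open>Split according to the trace on one forbidden set: one of the \<open>2 ^ card D\<close> traces is excluded.\<close>

lemma card_avoiding_le:
  fixes B :: "'a set"
  assumes "finite B" "\<And>D. D \<in> \<D> \<Longrightarrow> D \<subseteq> B \<and> card D \<le> M"
    and "\<And>S. S \<subseteq> B \<Longrightarrow> card S \<le> M * R \<Longrightarrow> \<exists>D\<in>\<D>. D \<inter> S = {}"
    and "\<F> \<subseteq> Pow B" "\<And>G D. G \<in> \<F> \<Longrightarrow> D \<in> \<D> \<Longrightarrow> \<not> D \<subseteq> G"
  shows "real (card \<F>) \<le> (1 - 1 / 2 ^ M) ^ R * 2 ^ card B"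
  using assms
proof (induction R arbitrary: B \<D> \<F>)
  case 0
  then have "card \<F> \<le> card (Pow B)" by (intro card_mono) auto
  then show ?case using 0 of_nat_mono [where 'a = real, of "card \<F>" "2 ^ card B"] by (simp add: card_Pow)
next
  case (Suc R)
  obtain D0 where D0: "D0 \<in> \<D>" using Suc.prems(3) [of "{}"] by auto
  have D0B: "D0 \<subseteq> B" "card D0 \<le> M" using Suc.prems(2) D0 by auto
  have finD0: "finite D0" using D0B Suc.prems(1) finite_subset by blast
  define fib where "fib Y = {Z\<in>Pow (B - D0). Y \<union> Z \<in> \<F>}" for Y
  have fib_le: "real (card (fib Y)) \<le> (1 - 1 / 2 ^ M) ^ R * 2 ^ card (B - D0)" if "Y \<subseteq> D0" for Y
  proof (rule Suc.IH [where \<D> = "{D\<in>\<D>. D \<inter> D0 = {}}"])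
    show "\<exists>D\<in>{D \<in> \<D>. D \<inter> D0 = {}}. D \<inter> S = {}" if S: "S \<subseteq> B - D0" "card S \<le> M * R" for S
    proof -
      \<comment> \<open>Adding \<open>D0\<close> to the test set costs at most \<open>M\<close>
        elements, so the part of \<open>\<D>\<close> disjoint from \<open>D0\<close> still escapes
        every set of size \<open>M * R\<close>; no disjoint subfamily has to be chosen in
        advance.\<close>
      have "card (S \<union> D0) \<le> M * Suc R"
        using card_Un_le [of S D0] S D0B by simp
      then obtain D where "D \<in> \<D>" "D \<inter> (S \<union> D0) = {}"
        using Suc.prems(3) [of "S \<union> D0"] S D0B by blast
      then show ?thesis by blast
    qed
    show "\<not> D \<subseteq> G" if "G \<in> fib Y" "D \<in> {D \<in> \<D>. D \<inter> D0 = {}}" for G D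
      using that Suc.prems(5) [of "Y \<union> G" D] by (auto simp: fib_def)
    show "D \<subseteq> B - D0 \<and> card D \<le> M" if "D \<in> {D \<in> \<D>. D \<inter> D0 = {}}" for D
      using Suc.prems(2) that by blast
  qed (use Suc.prems in \<open>auto simp: fib_def\<close>)
  have "\<F> \<subseteq> (\<Union>Y\<in>Pow D0 - {D0}. (\<union>) Y ` fib Y)"
  proof
    fix G assume G: "G \<in> \<F>"
    have "G \<inter> D0 \<noteq> D0" using Suc.prems(5) [OF G D0] by auto
    moreover have "G - D0 \<in> fib (G \<inter> D0)"
    proof -
      have "(G \<inter> D0) \<union> (G - D0) = G" by auto
      then show ?thesis using G Suc.prems(4) by (auto simp: fib_def)
    qed
    moreover have "G = (G \<inter> D0) \<union> (G - D0)" by auto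
    ultimately show "G \<in> (\<Union>Y\<in>Pow D0 - {D0}. (\<union>) Y ` fib Y)" by blast
  qed
  moreover have finfib: "finite (fib Y)" for Y
    using Suc.prems(1) by (auto simp: fib_def)
  ultimately have "card \<F> \<le> card (\<Union>Y\<in>Pow D0 - {D0}. (\<union>) Y ` fib Y)"
    using finD0 by (intro card_mono) auto
  also have "\<dots> \<le> (\<Sum>Y\<in>Pow D0 - {D0}. card ((\<union>) Y ` fib Y))"
    using finD0 by (intro card_UN_le) auto
  also have "\<dots> \<le> (\<Sum>Y\<in>Pow D0 - {D0}. card (fib Y))"
    by (intro sum_mono card_image_le finfib)
  finally have "real (card \<F>) \<le> (\<Sum>Y\<in>Pow D0 - {D0}. real (card (fib Y)))"
    by - (drule of_nat_mono [where 'a = real], simp)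
  also have "\<dots> \<le> real (card (Pow D0 - {D0})) * ((1 - 1 / 2 ^ M) ^ R * 2 ^ card (B - D0))"
    by (intro sum_bounded_above fib_le) auto
  also have "real (card (Pow D0 - {D0})) = 2 ^ card D0 - 1"
    using finD0 by (simp add: card_Diff_subset card_Pow of_nat_diff)
  also have "card (B - D0) = card B - card D0"
    using finD0 D0B by (simp add: card_Diff_subset)
  also have "(2 ^ card D0 - 1) * ((1 - 1 / 2 ^ M) ^ R * 2 ^ (card B - card D0)) \<le>
      (1 - 1 / 2 ^ M) ^ Suc R * (2::real) ^ card B"
  proof -
    have cle: "card D0 \<le> card B" using D0B Suc.prems(1) card_mono by blast
    have "(2::real) ^ card B = 2 ^ card D0 * 2 ^ (card B - card D0)"
      using cle by (simp flip: power_add)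
    \<comment> \<open>One of the 2^|D0| traces is lost, and a smaller \<open>D0\<close> loses a
      larger proportion, so size \<open>M\<close> is the worst case.\<close>
    moreover have "(2::real) ^ card D0 - 1 \<le> (1 - 1 / 2 ^ M) * 2 ^ card D0"
    proof -
      have "(2::real) ^ card D0 \<le> 2 ^ M" using D0B by (intro power_increasing) auto
      then show ?thesis by (simp add: field_simps)
    qed
    ultimately have "(2 ^ card D0 - 1) * ((1 - 1 / 2 ^ M) ^ R * 2 ^ (card B - card D0)) \<le>
       ((1 - 1 / 2 ^ M) * 2 ^ card D0) * ((1 - 1 / 2 ^ M) ^ R * (2::real) ^ (card B - card D0))"
      by (intro mult_right_mono) auto
    also have "\<dots> = ((1 - 1 / 2 ^ M) * (1 - 1 / 2 ^ M) ^ R) * (2 ^ card D0 * (2::real) ^ (card B - card D0))"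
      by (simp only: ac_simps)
    finally show ?thesis using \<open>(2::real) ^ card B = _\<close> by (simp only: power_Suc)
  qed
  finally show ?case .
qed

text \<open>Deleting the prescribed part \<open>R\<close> is injective. Each prescribed vertex saves
  a factor \<open>card V\<close>, the source of all later bounds of the form n^-|R|.\<close>

lemma card_supersets_le:
  assumes "finite V"
  shows "card {X. X \<subseteq> V \<and> card X = s \<and> R \<subseteq> X} \<le> card V ^ (s - card R)"
proof -
  have "card {X. X \<subseteq> V \<and> card X = s \<and> R \<subseteq> X} \<le> card {Y. Y \<subseteq> V \<and> card Y = s - card R}"
  proof (rule card_inj_on_le [where f = "\<lambda>X. X - R"])
    show "inj_on (\<lambda>X. X - R) {X. X \<subseteq> V \<and> card X = s \<and> R \<subseteq> X}"
      by (rule inj_onI) blast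
    show "(\<lambda>X. X - R) ` {X. X \<subseteq> V \<and> card X = s \<and> R \<subseteq> X} \<subseteq> {Y. Y \<subseteq> V \<and> card Y = s - card R}"
      using assms by (auto intro!: card_Diff_subset elim: finite_subset)
  qed (use assms in auto)
  also have "\<dots> = card V choose (s - card R)" by (rule n_subsets [OF assms])
  also have "\<dots> \<le> card V ^ (s - card R)" by (cases "s - card R \<le> card V") (simp_all add: binomial_le_pow binomial_eq_0)
  finally show ?thesis .
qed

lemma card_small_subsets_le:
  assumes "finite V" "card V \<ge> 1"
  shows "card {X. X \<subseteq> V \<and> card X \<le> s} \<le> (s + 1) * card V ^ s"
proof -
  have "{X. X \<subseteq> V \<and> card X \<le> s} = (\<Union>i\<in>{..s}. {X. X \<subseteq> V \<and> card X = i \<and> {} \<subseteq> X})" by auto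
  then have "card {X. X \<subseteq> V \<and> card X \<le> s} \<le> (\<Sum>i\<in>{..s}. card {X. X \<subseteq> V \<and> card X = i \<and> {} \<subseteq> X})"
    by (simp only:) (rule card_UN_le, simp)
  also have "\<dots> \<le> (\<Sum>i\<in>{..s}. card V ^ s)"
  proof (intro sum_mono order_trans [OF card_supersets_le [OF assms(1)]])
    show "card V ^ (i - card {}) \<le> card V ^ s" if "i \<in> {..s}" for i
      using that assms by (intro power_increasing) auto
  qed
  finally show ?thesis by simp
qed

text \<open>A member is determined by its traces off \<open>B\<close> and on \<open>B\<close>; a
  uniform bound on the fibres over the traces off \<open>B\<close> therefore multiplies.\<close>

lemma card_le_fibres:
  assumes "finite \<O>" "\<And>G. G \<in> \<O> \<Longrightarrow> real (card {Z\<in>Pow B. (G - B) \<union> Z \<in> \<O>}) \<le> \<kappa>" "finite B"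
  shows "real (card \<O>) \<le> real (card ((\<lambda>G. G - B) ` \<O>)) * \<kappa>"
proof -
  have "\<O> \<subseteq> (\<Union>X\<in>(\<lambda>G. G - B) ` \<O>. (\<union>) X ` {Z\<in>Pow B. X \<union> Z \<in> \<O>})"
  proof
    fix G assume "G \<in> \<O>"
    moreover have "G = (G - B) \<union> (G \<inter> B)" by auto
    moreover from this have "G \<inter> B \<in> {Z\<in>Pow B. (G - B) \<union> Z \<in> \<O>}" using \<open>G \<in> \<O>\<close> by auto
    ultimately show "G \<in> (\<Union>X\<in>(\<lambda>G. G - B) ` \<O>. (\<union>) X ` {Z\<in>Pow B. X \<union> Z \<in> \<O>})" by blast
  qed
  then have "card \<O> \<le> card (\<Union>X\<in>(\<lambda>G. G - B) ` \<O>. (\<union>) X ` {Z\<in>Pow B. X \<union> Z \<in> \<O>})"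
    using assms by (intro card_mono) auto
  also have "\<dots> \<le> (\<Sum>X\<in>(\<lambda>G. G - B) ` \<O>. card ((\<union>) X ` {Z\<in>Pow B. X \<union> Z \<in> \<O>}))"
    using assms by (intro card_UN_le) auto
  also have "\<dots> \<le> (\<Sum>X\<in>(\<lambda>G. G - B) ` \<O>. card {Z\<in>Pow B. X \<union> Z \<in> \<O>})"
    by (intro sum_mono card_image_le) (use assms in auto)
  finally have "real (card \<O>) \<le> (\<Sum>X\<in>(\<lambda>G. G - B) ` \<O>. real (card {Z\<in>Pow B. X \<union> Z \<in> \<O>}))"
    by - (drule of_nat_mono [where 'a = real], simp)
  also have "\<dots> \<le> real (card ((\<lambda>G. G - B) ` \<O>)) * \<kappa>"
    by (rule sum_bounded_above) (use assms in auto)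
  finally show ?thesis .
qed

lemma card_le_pow_times_traces:
  assumes "finite \<O>" "finite B"
  shows "card \<O> \<le> 2 ^ card B * card ((\<lambda>G. G - B) ` \<O>)"
proof -
  have "real (card \<O>) \<le> real (card ((\<lambda>G. G - B) ` \<O>)) * (2 ^ card B)"
  proof (rule card_le_fibres [OF assms(1) _ assms(2)])
    fix G
    have "card {Z \<in> Pow B. G - B \<union> Z \<in> \<O>} \<le> card (Pow B)"
      using assms by (intro card_mono) auto
    then show "real (card {Z \<in> Pow B. G - B \<union> Z \<in> \<O>}) \<le> 2 ^ card B"
      using assms of_nat_mono [where 'a = real, of "card {Z \<in> Pow B. G - B \<union> Z \<in> \<O>}" "2 ^ card B"]
      by (simp add: card_Pow)
  qed
  also have "\<dots> = real (2 ^ card B * card ((\<lambda>G. G - B) ` \<O>))" by simp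
  finally show ?thesis by (simp only: of_nat_le_iff)
qed

section \<open>Limits that make the error terms small\<close>

lemma eventually_divide_le:
  assumes "(\<epsilon>::real) > 0"
  shows "\<forall>\<^sub>F n in sequentially. C / real n \<le> \<epsilon>"
proof -
  have "((\<lambda>n. C / real n) \<longlongrightarrow> 0) sequentially" by (rule lim_const_over_n)
  then have "\<forall>\<^sub>F n in sequentially. C / real n < \<epsilon>" using assms by (rule order_tendstoD(2))
  then show ?thesis by (rule eventually_mono) simp
qed

text \<open>The exponent \<open>n div D\<close> is at least n/D - 1, so rounding costs only the
  constant factor 1/\<rho> and the exponential still beats every power of n.\<close>

lemma eventually_geometric_le:
  assumes "0 < (\<rho>::real)" "\<rho> < 1" "D > 0"
  shows "\<forall>\<^sub>F n in sequentially. C * \<rho> ^ (n div D) * real n ^ p \<le> 1 / real n ^ r"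
proof -
  have lim: "((\<lambda>n. \<rho> powr (real n / real D - 1) * real n ^ (p + r)) \<longlongrightarrow> 0) sequentially"
  proof -
    define c where "c = real D"
    have c: "c > 0" using assms c_def by simp
    define a where "a = - ln \<rho> / c"
    have a: "a > 0" using assms c by (simp add: a_def divide_neg_pos)
    have "((\<lambda>x::real. x ^ (p + r) / exp (a * x)) \<longlongrightarrow> 0) at_top"
    proof -
      have "((\<lambda>x::real. (a * x) ^ (p + r) / exp (a * x)) \<longlongrightarrow> 0) at_top"
        by (rule filterlim_compose [OF tendsto_power_div_exp_0])
           (use a in \<open>simp add: filterlim_tendsto_pos_mult_at_top [OF tendsto_const _ filterlim_ident]\<close>)
      then have "((\<lambda>x::real. (1 / a ^ (p + r)) * ((a * x) ^ (p + r) / exp (a * x))) \<longlongrightarrow> (1 / a ^ (p + r)) * 0) at_top"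
        by (intro tendsto_mult tendsto_const)
      then show ?thesis using a by (simp add: power_mult_distrib field_simps)
    qed
    then have "((\<lambda>n. real n ^ (p + r) / exp (a * real n)) \<longlongrightarrow> 0) sequentially"
      by (rule filterlim_compose [OF _ filterlim_real_sequentially])
    then have "((\<lambda>n. (1 / \<rho>) * (real n ^ (p + r) / exp (a * real n))) \<longlongrightarrow> (1 / \<rho>) * 0) sequentially"
      by (intro tendsto_mult tendsto_const)
    moreover have "\<rho> powr (real n / real D - 1) * real n ^ (p + r) = (1 / \<rho>) * (real n ^ (p + r) / exp (a * real n))" for n
    proof -
      have "\<rho> powr (real n / real D - 1) = \<rho> powr (real n / real D) / \<rho>"
        using assms by (simp add: powr_diff)
      also have "\<rho> powr (real n / real D) = exp (- (a * real n))"
        using assms by (simp add: powr_def a_def c_def)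
      finally show ?thesis by (simp add: exp_minus field_simps)
    qed
    ultimately show ?thesis by simp
  qed
  have "((\<lambda>n. \<bar>C\<bar> * (\<rho> powr (real n / real D - 1) * real n ^ (p + r))) \<longlongrightarrow> \<bar>C\<bar> * 0) sequentially"
    by (intro tendsto_mult tendsto_const lim)
  then have "\<forall>\<^sub>F n in sequentially. \<bar>C\<bar> * (\<rho> powr (real n / real D - 1) * real n ^ (p + r)) < 1"
    by (intro order_tendstoD(2)) auto
  moreover have "\<forall>\<^sub>F n in sequentially. n > (0::nat)" by (rule eventually_gt_at_top)
  ultimately show ?thesis
  proof eventually_elim
    case (elim n)
    have "real n / real D - 1 \<le> real (n div D)"
    proof -
      have "real n = real (n div D * D + n mod D)" by simp
      also have "\<dots> = real (n div D) * real D + real (n mod D)"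
        by (simp only: of_nat_add of_nat_mult)
      also have "\<dots> < real (n div D) * real D + real D"
        using assms by simp
      finally show ?thesis using assms by (simp add: field_simps)
    qed
    then have "\<rho> powr real (n div D) \<le> \<rho> powr (real n / real D - 1)"
      using assms by (intro powr_mono') auto
    then have "\<rho> ^ (n div D) \<le> \<rho> powr (real n / real D - 1)" using assms by (simp add: powr_realpow)
    then have "C * \<rho> ^ (n div D) * real n ^ (p + r) \<le> \<bar>C\<bar> * (\<rho> powr (real n / real D - 1) * real n ^ (p + r))"
      using assms by (simp only: mult.assoc, intro mult_mono) (auto simp: mult_right_mono)
    also have "\<dots> < 1" by (rule elim(1))
    finally show ?case using elim(2) by (simp add: field_simps power_add)
  qed
qed

section \<open>Extremal families\<close>

text \<open>Deleting a vertex leaves a ground set that need not be an initial segment; the ground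
  set is therefore a parameter, and relabelling leads back to \<open>s_star\<close>.\<close>

definition overlapping_on :: "nat set \<Rightarrow> nat \<Rightarrow> (nat set \<Rightarrow> nat) \<Rightarrow> (nat \<Rightarrow> nat set set) \<Rightarrow> bool" where
  "overlapping_on V l m F \<longleftrightarrow>
     (\<forall>k\<in>{1..l}. F k \<subseteq> Pow V) \<and>
     (\<forall>k\<in>{1..l}. \<forall>k'\<in>{1..l}. k \<noteq> k' \<longrightarrow>
        (\<forall>A\<in>F k. \<forall>B\<in>F k'. card (A \<inter> B) \<le> m {k, k'}))"

lemma finite_products: "finite {\<Prod>k\<in>{1..l}. card (F k) | F. overlapping n l m F}"
proof (rule finite_subset)
  show "{\<Prod>k\<in>{1..l}. card (F k) | F. overlapping n l m F} \<subseteq> {..(2 ^ n) ^ l}"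
  proof
    fix x assume "x \<in> {\<Prod>k\<in>{1..l}. card (F k) | F. overlapping n l m F}"
    then obtain F where F: "x = (\<Prod>k\<in>{1..l}. card (F k))" "overlapping n l m F" by auto
    have "card (F k) \<le> 2 ^ n" if "k \<in> {1..l}" for k
    proof -
      have "card (F k) \<le> card (Pow {1..n})"
        using F that by (intro card_mono) (auto simp: overlapping_def)
      then show ?thesis by (simp add: card_Pow)
    qed
    then have "x \<le> (\<Prod>k\<in>{1..l}. 2 ^ n)" unfolding F by (intro prod_mono) auto
    then show "x \<in> {..(2 ^ n) ^ l}" by simp
  qed
qed simp

lemma prod_le_s_star:
  assumes "overlapping n l m F"
  shows "(\<Prod>k\<in>{1..l}. card (F k)) \<le> s_star n l m"
  unfolding s_star_def by (rule Max_ge [OF finite_products]) (use assms in auto)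

lemma ex_extremal: "\<exists>F. extremal n l m F"
proof -
  have "overlapping n l m (\<lambda>_. {})" by (simp add: overlapping_def)
  then have "{\<Prod>k\<in>{1..l}. card (F k) | F. overlapping n l m F} \<noteq> {}" by auto
  from Max_in [OF finite_products this] show ?thesis
    unfolding extremal_def s_star_def by auto
qed

lemma s_star_pos: "s_star n l m > 0"
proof -
  have "overlapping n l m (\<lambda>_. {{}})" by (simp add: overlapping_def)
  from prod_le_s_star [OF this] show ?thesis by simp
qed

lemma prod_le_s_star_on:
  assumes "finite V" "overlapping_on V l m F"
  shows "(\<Prod>k\<in>{1..l}. card (F k)) \<le> s_star (card V) l m"
proof -
  obtain h where h: "bij_betw h V {1..card V}"
    using finite_same_card_bij [OF assms(1), of "{1..card V}"] by auto
  have inj: "inj_on h V" and img: "h ` V = {1..card V}" using h by (auto simp: bij_betw_def)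
  have sub: "F k \<subseteq> Pow V" if "k \<in> {1..l}" for k using assms(2) that by (auto simp: overlapping_on_def)
  have "overlapping (card V) l m (\<lambda>k. image h ` F k)"
    unfolding overlapping_def
  proof (intro conjI ballI impI)
    fix k assume "k \<in> {1..l}"
    then show "image h ` F k \<subseteq> Pow {1..card V}" using sub img by blast
  next
    fix k k' A B assume k: "k \<in> {1..l}" "k' \<in> {1..l}" "k \<noteq> k'"
      and "A \<in> image h ` F k" "B \<in> image h ` F k'"
    then obtain A' B' where A': "A = h ` A'" "A' \<in> F k" "B = h ` B'" "B' \<in> F k'" by auto
    have "A \<inter> B = h ` (A' \<inter> B')"
      unfolding A' using inj_on_image_Int [OF inj, of A' B'] A' sub k by blast
    then have "card (A \<inter> B) \<le> card (A' \<inter> B')"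
      using A' sub k assms(1) by (metis (no_types, lifting) Pow_iff card_image_le finite_Int finite_subset in_mono)
    then show "card (A \<inter> B) \<le> m {k, k'}"
      using assms(2) k A' by (auto simp: overlapping_on_def intro: order_trans)
  qed
  then have "(\<Prod>k\<in>{1..l}. card (image h ` F k)) \<le> s_star (card V) l m" by (rule prod_le_s_star)
  moreover have "card (image h ` F k) = card (F k)" if "k \<in> {1..l}" for k
    by (rule card_image) (use inj_on_image_Pow [OF inj] sub [OF that] in \<open>auto intro: inj_on_subset\<close>)
  ultimately show ?thesis by simp
qed

locale extremal_families =
  fixes n l :: nat and m :: "nat set \<Rightarrow> nat" and F :: "nat \<Rightarrow> nat set set"
  assumes extremal: "extremal n l m F"
begin

lemma overlapping: "overlapping n l m F"
  using extremal by (simp add: extremal_def)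

lemma prod_card: "(\<Prod>k\<in>{1..l}. card (F k)) = s_star n l m"
  using extremal by (simp add: extremal_def)

lemma F_sub: "k \<in> {1..l} \<Longrightarrow> G \<in> F k \<Longrightarrow> G \<subseteq> {1..n}"
  using overlapping unfolding overlapping_def by blast

lemma finite_mem: "k \<in> {1..l} \<Longrightarrow> G \<in> F k \<Longrightarrow> finite G"
  using F_sub finite_subset by blast

lemma finite_F: "k \<in> {1..l} \<Longrightarrow> finite (F k)"
  using F_sub by (intro finite_subset [of "F k" "Pow {1..n}"]) auto

lemma card_Int_le:
  "\<lbrakk>k \<in> {1..l}; j \<in> {1..l}; k \<noteq> j; A \<in> F k; B \<in> F j\<rbrakk> \<Longrightarrow> card (A \<inter> B) \<le> m {k, j}"
  using overlapping by (auto simp: overlapping_def)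

lemma card_F_pos: "k \<in> {1..l} \<Longrightarrow> card (F k) > 0"
  using s_star_pos [of n l m] unfolding prod_card [symmetric] by (metis finite_atLeastAtMost gr0I less_irrefl prod_zero)

lemma F_nonempty: "k \<in> {1..l} \<Longrightarrow> F k \<noteq> {}"
  using card_F_pos by fastforce

text \<open>Inserting \<open>W\<close> would raise one factor of the product and keep the others,
  all positive. Read contrapositively: every non-member has a witness of conflict in another
  family.\<close>

lemma maximal:
  assumes k: "k \<in> {1..l}" and W: "W \<subseteq> {1..n}"
    and free: "\<And>j G. j \<in> {1..l} \<Longrightarrow> j \<noteq> k \<Longrightarrow> G \<in> F j \<Longrightarrow> card (W \<inter> G) \<le> m {k, j}"
  shows "W \<in> F k"
proof (rule ccontr)
  assume nW: "W \<notin> F k"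
  define F' where "F' = F(k := insert W (F k))"
  have "overlapping n l m F'"
    unfolding overlapping_def
  proof (intro conjI ballI impI)
    fix i assume "i \<in> {1..l}"
    then show "F' i \<subseteq> Pow {1..n}" using W F_sub by (auto simp: F'_def)
  next
    fix i j A B assume *: "i \<in> {1..l}" "j \<in> {1..l}" "i \<noteq> j" "A \<in> F' i" "B \<in> F' j"
    have sym: "card (B \<inter> W) \<le> m {j, k}" if "j \<in> {1..l}" "j \<noteq> k" "B \<in> F j" for j B
      using free [OF that] by (simp add: Int_commute insert_commute)
    show "card (A \<inter> B) \<le> m {i, j}"
      using * card_Int_le [of i j A B] free sym by (auto simp: F'_def split: if_splits)
  qed
  then have "(\<Prod>i\<in>{1..l}. card (F' i)) \<le> (\<Prod>i\<in>{1..l}. card (F i))"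
    unfolding prod_card by (rule prod_le_s_star)
  moreover have "(\<Prod>i\<in>{1..l}. card (F' i)) = (card (F k) + 1) * (\<Prod>i\<in>{1..l}-{k}. card (F i))"
    using k nW finite_F [OF k] by (subst prod.remove [of _ k]) (auto simp: F'_def)
  moreover have "(\<Prod>i\<in>{1..l}. card (F i)) = card (F k) * (\<Prod>i\<in>{1..l}-{k}. card (F i))"
    using k by (subst prod.remove [of _ k]) auto
  moreover have "(\<Prod>i\<in>{1..l}-{k}. card (F i)) > 0"
    using card_F_pos by (intro prod_pos) auto
  ultimately show False
    by (metis Suc_eq_plus1 Suc_n_not_le_n mult_le_cancel2)
qed

lemma downset:
  assumes k: "k \<in> {1..l}" and "G \<in> F k" "A \<subseteq> G"
  shows "A \<in> F k"
proof (rule maximal [OF k])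
  show "A \<subseteq> {1..n}" using F_sub assms by blast
  fix j B assume j: "j \<in> {1..l}" "j \<noteq> k" "B \<in> F j"
  have "card (A \<inter> B) \<le> card (G \<inter> B)"
    using assms finite_mem by (intro card_mono) auto
  also have "\<dots> \<le> m {k, j}" using card_Int_le j assms by auto
  finally show "card (A \<inter> B) \<le> m {k, j}" .
qed

definition q :: "nat \<Rightarrow> nat \<Rightarrow> real" where "q k v = Pr (F k) (\<lambda>G. v \<in> G)"

lemma q_nonneg [simp]: "0 \<le> q k v"
  by (simp add: q_def)

text \<open>Adding \<open>v\<close> is a bijection from the members avoiding \<open>v\<close> that
  survive the addition onto the members containing \<open>v\<close>. So \<open>1 - 2 * q k v\<close>
  is exactly the probability that adding \<open>v\<close> fails: the deficit of
  \<open>v\<close>.\<close>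

lemma deficit_eq:
  assumes k: "k \<in> {1..l}"
  shows "Pr (F k) (\<lambda>G. v \<notin> G \<and> insert v G \<notin> F k) = 1 - 2 * q k v"
proof -
  have "Pr (F k) (\<lambda>G. v \<notin> G) = 1 - q k v"
    unfolding q_def by (rule Pr_compl) (use finite_F F_nonempty k in auto)
  moreover have "card {G\<in>F k. v \<notin> G} = card {G\<in>F k. v \<notin> G \<and> insert v G \<notin> F k} + card {G\<in>F k. v \<in> G}"
  proof -
    have "bij_betw (insert v) {G\<in>F k. v \<notin> G \<and> insert v G \<in> F k} {G\<in>F k. v \<in> G}"
      by (rule bij_betw_byWitness [where f' = "\<lambda>G. G - {v}"])
         (use downset [OF k] in \<open>auto simp: insert_absorb\<close>)
    then have "card {G\<in>F k. v \<in> G} = card {G\<in>F k. v \<notin> G \<and> insert v G \<in> F k}"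
      by (simp add: bij_betw_same_card)
    moreover have "{G\<in>F k. v \<notin> G} = {G\<in>F k. v \<notin> G \<and> insert v G \<notin> F k} \<union> {G\<in>F k. v \<notin> G \<and> insert v G \<in> F k}"
      by auto
    then have "card {G\<in>F k. v \<notin> G} = card {G\<in>F k. v \<notin> G \<and> insert v G \<notin> F k} + card {G\<in>F k. v \<notin> G \<and> insert v G \<in> F k}"
      using finite_F [OF k] by (simp only:) (rule card_Un_disjoint, auto)
    ultimately show ?thesis by simp
  qed
  then have "Pr (F k) (\<lambda>G. v \<notin> G) = Pr (F k) (\<lambda>G. v \<notin> G \<and> insert v G \<notin> F k) + q k v"
    unfolding Pr_def q_def by (simp add: add_divide_distrib)
  ultimately show ?thesis by simp
qed

lemma q_le_half: "k \<in> {1..l} \<Longrightarrow> q k v \<le> 1 / 2"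
  using deficit_eq [of k v] Pr_nonneg [of "F k" "\<lambda>G. v \<notin> G \<and> insert v G \<notin> F k"] by linarith

lemma delete_vertex:
  assumes v: "v \<in> {1..n}"
  shows "(\<Prod>k\<in>{1..l}. 1 - q k v) * real (s_star n l m) \<le> real (s_star (n - 1) l m)"
proof -
  have "overlapping_on ({1..n} - {v}) l m (\<lambda>k. {G\<in>F k. v \<notin> G})"
    unfolding overlapping_on_def using F_sub card_Int_le by fast
  then have "(\<Prod>k\<in>{1..l}. card {G\<in>F k. v \<notin> G}) \<le> s_star (card ({1..n} - {v})) l m"
    by (intro prod_le_s_star_on) auto
  then have "(\<Prod>k\<in>{1..l}. card {G\<in>F k. v \<notin> G}) \<le> s_star (n - 1) l m" using v by simp
  then have "(\<Prod>k\<in>{1..l}. real (card {G\<in>F k. v \<notin> G})) \<le> real (s_star (n - 1) l m)"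
    by (simp flip: of_nat_prod)
  moreover have "real (card {G\<in>F k. v \<notin> G}) = (1 - q k v) * real (card (F k))" if "k \<in> {1..l}" for k
    using Pr_compl [of "F k" "\<lambda>G. v \<in> G"] card_eq_Pr [of "F k" "\<lambda>G. v \<notin> G"] finite_F F_nonempty that
    by (simp add: q_def)
  ultimately show ?thesis
    unfolding prod_card [symmetric] of_nat_prod prod.distrib [symmetric] by simp
qed

lemma double:
  assumes "l \<ge> 1"
  shows "2 * s_star n l m \<le> s_star (Suc n) l m"
proof -
  have 1: "1 \<in> {1..l}" using assms by simp
  have new: "Suc n \<notin> G" if "G \<in> F k" "k \<in> {1..l}" for G k using F_sub that by fastforce
  \<comment> \<open>Only family 1 receives the new point, so the point never enters an
    intersection.\<close>
  define F' where "F' = F(1 := F 1 \<union> insert (Suc n) ` F 1)"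
  have "overlapping (Suc n) l m F'"
    unfolding overlapping_def
  proof (intro conjI ballI impI)
    fix i assume i: "i \<in> {1..l}"
    show "F' i \<subseteq> Pow {1..Suc n}"
    proof
      fix G assume "G \<in> F' i"
      then have "G \<subseteq> insert (Suc n) {1..n}"
        using F_sub [OF i] F_sub [OF 1] unfolding F'_def by (cases "i = 1") (simp_all, blast+)
      then show "G \<in> Pow {1..Suc n}" by auto
    qed
  next
    fix i j A B assume *: "i \<in> {1..l}" "j \<in> {1..l}" "i \<noteq> j" "A \<in> F' i" "B \<in> F' j"
    have "\<exists>A'\<in>F i. A' \<subseteq> A \<and> A \<subseteq> insert (Suc n) A'" "\<exists>B'\<in>F j. B' \<subseteq> B \<and> B \<subseteq> insert (Suc n) B'"
      using * by (auto simp: F'_def split: if_splits)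
    then obtain A' B' where AB: "A' \<in> F i" "A \<subseteq> insert (Suc n) A'" "B' \<in> F j" "B \<subseteq> insert (Suc n) B'" by blast
    have "Suc n \<notin> A \<or> Suc n \<notin> B" using * new by (auto simp: F'_def split: if_splits)
    then have "A \<inter> B \<subseteq> A' \<inter> B'" using AB by auto
    then have "card (A \<inter> B) \<le> card (A' \<inter> B')" using AB finite_mem * by (intro card_mono) auto
    also have "\<dots> \<le> m {i, j}" using card_Int_le AB * by auto
    finally show "card (A \<inter> B) \<le> m {i, j}" .
  qed
  then have "(\<Prod>i\<in>{1..l}. card (F' i)) \<le> s_star (Suc n) l m" by (rule prod_le_s_star)
  moreover have "card (F' 1) = 2 * card (F 1)"
  proof -
    have "inj_on (insert (Suc n)) (F 1)" using new [OF _ 1]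
      by (intro inj_on_inverseI [where g = "\<lambda>G. G - {Suc n}"]) simp
    then show ?thesis using new [OF _ 1] finite_F [OF 1] unfolding F'_def
      by (simp, subst card_Un_disjoint) (auto simp: card_image)
  qed
  then have "(\<Prod>i\<in>{1..l}. card (F' i)) = 2 * (\<Prod>i\<in>{1..l}. card (F i))"
    using prod.remove [OF _ 1, of "\<lambda>i. card (F' i)"] prod.remove [OF _ 1, of "\<lambda>i. card (F i)"]
    by (simp add: F'_def)
  ultimately show ?thesis unfolding prod_card [symmetric] by linarith
qed

text \<open>Family \<open>k\<close> may use \<open>v\<close> and its copy \<open>Suc n\<close> simultaneously, the other families only one
  of the two. Mapping \<open>Suc n\<close> to \<open>v\<close> then does not shrink an intersection of two families.\<close>

lemma clone_vertex:
  assumes v: "v \<in> {1..n}" and k: "k \<in> {1..l}"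
  shows "real (s_star n l m) * ((1 + 2 * q k v) * (\<Prod>j\<in>{1..l} - {k}. 1 + q j v))
    \<le> real (s_star (Suc n) l m)"
proof -
  define w where "w = Suc n"
  have new: "w \<notin> G" if "G \<in> F j" "j \<in> {1..l}" for G j using F_sub that by (fastforce simp: w_def)
  have wv: "w \<noteq> v" using v by (auto simp: w_def)
  define One where "One j = F j \<union> (\<lambda>G. insert w (G - {v})) ` {G\<in>F j. v \<in> G}" for j
  define Both where "Both = One k \<union> insert w ` {G\<in>F k. v \<in> G}"
  define F' where "F' j = (if j = k then Both else One j)" for j
  define p where "p G = (if w \<in> G then insert v (G - {w}) else G)" for G
  have pOne: "p G \<in> F j \<and> \<not> (v \<in> G \<and> w \<in> G)" if "G \<in> One j" "j \<in> {1..l}" for G j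
    using that new wv by (auto simp: One_def p_def insert_absorb)
  have pBoth: "p G \<in> F k" if "G \<in> Both" for G
  proof (cases "G \<in> One k")
    case False
    then show ?thesis using that new [OF _ k] wv by (auto simp: Both_def p_def insert_absorb)
  qed (use pOne k in blast)
  have pF': "p G \<in> F j" if "G \<in> F' j" "j \<in> {1..l}" for G j
    using that pOne pBoth by (auto simp: F'_def split: if_splits)
  have injp: "card A \<le> card (p A)" if "finite A" "\<not> (v \<in> A \<and> w \<in> A)" for A
    using that by (auto simp: p_def card_insert_if)
  have finF': "finite G" if "G \<in> F' j" "j \<in> {1..l}" for G j
    using finite_mem [OF that(2) pF' [OF that]] by (auto simp: p_def split: if_splits)
  have "overlapping (Suc n) l m F'"
    unfolding overlapping_def
  proof (intro conjI ballI impI)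
    fix i assume i: "i \<in> {1..l}"
    show "F' i \<subseteq> Pow {1..Suc n}"
    proof
      fix G assume "G \<in> F' i"
      then have "p G \<subseteq> {1..n}" using pF' i F_sub by blast
      then show "G \<in> Pow {1..Suc n}" by (auto simp: p_def w_def split: if_splits)
    qed
  next
    fix i j A B assume *: "i \<in> {1..l}" "j \<in> {1..l}" "i \<noteq> j" "A \<in> F' i" "B \<in> F' j"
    have AB: "\<not> (v \<in> A \<inter> B \<and> w \<in> A \<inter> B)"
      using * pOne by (auto simp: F'_def split: if_splits)
    have "card (A \<inter> B) \<le> card (p (A \<inter> B))"
      using AB finF' * by (intro injp) auto
    also have "\<dots> \<le> card (p A \<inter> p B)"
      using finite_mem [OF _ pF'] * by (intro card_mono) (auto simp: p_def)
    also have "\<dots> \<le> m {i, j}" using pF' * card_Int_le by auto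
    finally show "card (A \<inter> B) \<le> m {i, j}" .
  qed
  then have le: "(\<Prod>i\<in>{1..l}. card (F' i)) \<le> s_star (Suc n) l m" by (rule prod_le_s_star)
  have cardOne: "real (card (One j)) = real (card (F j)) * (1 + q j v)" if j: "j \<in> {1..l}" for j
  proof -
    have "inj_on (\<lambda>G. insert w (G - {v})) {G\<in>F j. v \<in> G}"
      using new [OF _ j] wv by (intro inj_on_inverseI [where g = p]) (auto simp: p_def insert_absorb)
    then have "card (One j) = card (F j) + card {G\<in>F j. v \<in> G}"
      unfolding One_def using finite_F [OF j] new [OF _ j]
      by (subst card_Un_disjoint) (auto simp: card_image)
    then show ?thesis
      using card_eq_Pr [of "F j" "\<lambda>G. v \<in> G"] finite_F F_nonempty j by (simp add: q_def algebra_simps)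
  qed
  have cardBoth: "real (card Both) = real (card (F k)) * (1 + 2 * q k v)"
  proof -
    have "inj_on (insert w) {G\<in>F k. v \<in> G}"
      using new [OF _ k] wv by (intro inj_on_inverseI [where g = "\<lambda>G. G - {w}"]) auto
    then have "card Both = card (One k) + card {G\<in>F k. v \<in> G}"
      unfolding Both_def using finite_F [OF k] pOne [OF _ k]
      by (subst card_Un_disjoint) (auto simp: card_image One_def)
    then show ?thesis
      using card_eq_Pr [of "F k" "\<lambda>G. v \<in> G"] finite_F F_nonempty k cardOne [OF k]
      by (simp add: q_def algebra_simps)
  qed
  have "(\<Prod>i\<in>{1..l}. real (card (F' i))) =
     (real (card (F k)) * (1 + 2 * q k v)) * (\<Prod>j\<in>{1..l} - {k}. real (card (F j)) * (1 + q j v))"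
    using k by (subst prod.remove [of _ k]) (auto simp: F'_def cardBoth cardOne)
  also have "\<dots> = (real (card (F k)) * (\<Prod>j\<in>{1..l} - {k}. real (card (F j)))) *
      ((1 + 2 * q k v) * (\<Prod>j\<in>{1..l} - {k}. 1 + q j v))"
    by (simp add: prod.distrib)
  also have "real (card (F k)) * (\<Prod>j\<in>{1..l} - {k}. real (card (F j))) = real (s_star n l m)"
    using k unfolding prod_card [symmetric] by (simp add: prod.remove [of _ k])
  finally have "real (s_star n l m) * ((1 + 2 * q k v) * (\<Prod>j\<in>{1..l} - {k}. 1 + q j v)) =
     real (\<Prod>i\<in>{1..l}. card (F' i))" by simp
  also have "\<dots> \<le> real (s_star (Suc n) l m)" using le by (simp only: of_nat_le_iff)
  finally show ?thesis .
qed

text \<open>The left side is the expected number of common vertices in \<open>A\<close> of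
  independent random members of the two families.\<close>

lemma sum_q_q_le:
  assumes "i \<in> {1..l}" "j \<in> {1..l}" "i \<noteq> j" "A \<subseteq> {1..n}"
  shows "(\<Sum>v\<in>A. q i v * q j v) \<le> real (m {i, j})"
proof -
  have finA: "finite A" using assms finite_subset by blast
  have "(\<Sum>v\<in>A. card {G\<in>F i. v \<in> G} * card {G\<in>F j. v \<in> G}) \<le> m {i, j} * (card (F i) * card (F j))"
  proof -
    have "(\<Sum>v\<in>A. card {G\<in>F i. v \<in> G} * card {G\<in>F j. v \<in> G}) =
        (\<Sum>v\<in>A. \<Sum>G'\<in>F j. if v \<in> G' then card {G\<in>F i. v \<in> G} else 0)"
      using finite_F assms by (intro sum.cong refl) (simp add: sum.If_cases Int_def mult.commute)
    also have "\<dots> = (\<Sum>G'\<in>F j. \<Sum>v\<in>A. if v \<in> G' then card {G\<in>F i. v \<in> G} else 0)" by (rule sum.swap)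
    also have "\<dots> = (\<Sum>G'\<in>F j. \<Sum>v\<in>A \<inter> G'. card {G\<in>F i. v \<in> G})"
      by (simp only: sum.inter_restrict [OF finA])
    also have "\<dots> = (\<Sum>G'\<in>F j. \<Sum>G\<in>F i. card (G \<inter> (A \<inter> G')))"
      using finite_F assms finA by (intro sum.cong refl sum_card_Int_swap) auto
    also have "\<dots> \<le> (\<Sum>G'\<in>F j. \<Sum>G\<in>F i. m {i, j})"
    proof (intro sum_mono)
      fix G' G assume G: "G' \<in> F j" "G \<in> F i"
      have "card (G \<inter> (A \<inter> G')) \<le> card (G \<inter> G')" using G assms finite_mem by (intro card_mono) auto
      then show "card (G \<inter> (A \<inter> G')) \<le> m {i, j}" using card_Int_le [of i j G G'] G assms by simp
    qed
    finally show ?thesis by (simp add: ac_simps)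
  qed
  then have "real (\<Sum>v\<in>A. card {G\<in>F i. v \<in> G} * card {G\<in>F j. v \<in> G}) \<le> real (m {i, j} * (card (F i) * card (F j)))"
    by (simp only: of_nat_le_iff)
  moreover have "(\<Sum>v\<in>A. q i v * q j v) = real (\<Sum>v\<in>A. card {G\<in>F i. v \<in> G} * card {G\<in>F j. v \<in> G}) / (real (card (F i)) * real (card (F j)))"
    by (simp add: q_def Pr_def sum_divide_distrib)
  moreover have "real (card (F i)) * real (card (F j)) > 0" using card_F_pos assms by simp
  ultimately show ?thesis by (simp add: divide_le_eq)
qed

end

section \<open>Counting and ideal families\<close>

lemma card_exact_subsets:
  assumes "finite K" "\<And>k. k \<in> K \<Longrightarrow> finite (A k)"
    and "\<And>i j. i \<in> K \<Longrightarrow> j \<in> K \<Longrightarrow> i \<noteq> j \<Longrightarrow> A i \<inter> A j = {}"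
  shows "card {Y. Y \<subseteq> (\<Union>k\<in>K. A k) \<and> (\<forall>k\<in>K. card (Y \<inter> A k) = c k)} = (\<Prod>k\<in>K. card (A k) choose c k)"
  using assms
proof (induction K)
  case empty
  have "{Y. Y \<subseteq> (\<Union>k\<in>{}. A k) \<and> (\<forall>k\<in>{}. card (Y \<inter> A k) = c k)} = {{}}" by auto
  then show ?case by simp
next
  case (insert x K)
  define U where "U = (\<Union>k\<in>K. A k)"
  define S where "S = {Y. Y \<subseteq> U \<and> (\<forall>k\<in>K. card (Y \<inter> A k) = c k)}"
  define T where "T = {Y. Y \<subseteq> A x \<and> card Y = c x}"
  have disj: "A x \<inter> U = {}" using insert.prems(2) [of x] insert.hyps by (auto simp: U_def)
  have disjk: "A k \<inter> A x = {}" "A k \<subseteq> U" if "k \<in> K" for k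
    using insert.prems(2) [of k x] insert.hyps that by (auto simp: U_def)
  have "bij_betw (\<lambda>(Y, Z). Y \<union> Z) (S \<times> T)
      {Y. Y \<subseteq> (\<Union>k\<in>insert x K. A k) \<and> (\<forall>k\<in>insert x K. card (Y \<inter> A k) = c k)}"
  proof (rule bij_betw_byWitness [where f' = "\<lambda>Y. (Y \<inter> U, Y \<inter> A x)"])
    show "\<forall>a\<in>S \<times> T. (\<lambda>Y. (Y \<inter> U, Y \<inter> A x)) ((\<lambda>(Y, Z). Y \<union> Z) a) = a"
      using disj by (auto simp: S_def T_def)
    show "\<forall>Y\<in>{Y. Y \<subseteq> (\<Union>k\<in>insert x K. A k) \<and> (\<forall>k\<in>insert x K. card (Y \<inter> A k) = c k)}.
        (\<lambda>(Y, Z). Y \<union> Z) (Y \<inter> U, Y \<inter> A x) = Y"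
      by (auto simp: U_def)
    show "(\<lambda>(Y, Z). Y \<union> Z) ` (S \<times> T) \<subseteq>
        {Y. Y \<subseteq> (\<Union>k\<in>insert x K. A k) \<and> (\<forall>k\<in>insert x K. card (Y \<inter> A k) = c k)}"
    proof clarsimp
      fix Y Z assume YZ: "Y \<in> S" "Z \<in> T"
      have "(Y \<union> Z) \<inter> A x = Z" using YZ disj by (auto simp: S_def T_def)
      moreover have "(Y \<union> Z) \<inter> A k = Y \<inter> A k" if "k \<in> K" for k
        using YZ disjk [OF that] by (auto simp: S_def T_def)
      ultimately show "Y \<subseteq> A x \<union> \<Union> (A ` K) \<and> Z \<subseteq> A x \<union> \<Union> (A ` K) \<and>
          card ((Y \<union> Z) \<inter> A x) = c x \<and> (\<forall>k\<in>K. card ((Y \<union> Z) \<inter> A k) = c k)"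
        using YZ by (auto simp: S_def T_def U_def)
    qed
    show "(\<lambda>Y. (Y \<inter> U, Y \<inter> A x)) `
        {Y. Y \<subseteq> (\<Union>k\<in>insert x K. A k) \<and> (\<forall>k\<in>insert x K. card (Y \<inter> A k) = c k)} \<subseteq> S \<times> T"
    proof clarsimp
      fix Y assume Y: "\<forall>k\<in>K. card (Y \<inter> A k) = c k" "card (Y \<inter> A x) = c x"
      have "Y \<inter> U \<inter> A k = Y \<inter> A k" if "k \<in> K" for k using disjk [OF that] by auto
      then show "Y \<inter> U \<in> S \<and> Y \<inter> A x \<in> T" using Y by (auto simp: S_def T_def)
    qed
  qed
  then have "card {Y. Y \<subseteq> (\<Union>k\<in>insert x K. A k) \<and> (\<forall>k\<in>insert x K. card (Y \<inter> A k) = c k)} = card (S \<times> T)"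
    by (simp add: bij_betw_same_card)
  also have "\<dots> = card S * card T" by (rule card_cartesian_product)
  also have "card T = card (A x) choose c x"
    unfolding T_def by (rule n_subsets) (use insert in auto)
  also have "card S = (\<Prod>k\<in>K. card (A k) choose c k)"
    unfolding S_def U_def using insert by auto
  finally show ?case using insert.hyps by simp
qed

section \<open>Sums and products over pairs\<close>

definition ordpairs :: "nat \<Rightarrow> (nat \<times> nat) set" where
  "ordpairs l = {(j, k). j \<in> {1..l} \<and> k \<in> {1..l} \<and> j < k}"

lemma finite_ordpairs [simp]: "finite (ordpairs l)"
  by (rule finite_subset [of _ "{1..l} \<times> {1..l}"]) (auto simp: ordpairs_def)

lemma bij_ordpairs: "bij_betw (\<lambda>(j, k). {j, k}) (ordpairs l) (pairs l)"
proof (rule bij_betwI')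
  show "((case x of (j, k) \<Rightarrow> {j, k}) = (case y of (j, k) \<Rightarrow> {j, k})) = (x = y)"
    if "x \<in> ordpairs l" "y \<in> ordpairs l" for x y
    using that by (cases x; cases y) (simp add: ordpairs_def doubleton_eq_iff, linarith)
  show "(case x of (j, k) \<Rightarrow> {j, k}) \<in> pairs l" if "x \<in> ordpairs l" for x
    using that by (auto simp: ordpairs_def pairs_def)
  show "\<exists>x\<in>ordpairs l. y = (case x of (j, k) \<Rightarrow> {j, k})" if y: "y \<in> pairs l" for y
  proof -
    obtain a b where ab: "y = {a, b}" "a \<noteq> b" "a \<in> {1..l}" "b \<in> {1..l}"
      using y by (auto simp: pairs_def card_2_iff)
    show ?thesis
    proof (cases "a < b")
      case True
      then show ?thesis using ab by (intro bexI [of _ "(a, b)"]) (auto simp: ordpairs_def)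
    next
      case False
      then show ?thesis using ab by (intro bexI [of _ "(b, a)"]) (auto simp: ordpairs_def)
    qed
  qed
qed

lemma finite_pairs [simp]: "finite (pairs l)"
  using bij_betw_finite [OF bij_ordpairs] by simp

text \<open>Stated over an arbitrary commutative monoid so that the sum and the product version are
  both instances.\<close>

lemma (in comm_monoid_set) offdiag:
  "F (\<lambda>j. F (\<lambda>k. g j k) ({1..l} - {j})) {1..l} = F (\<lambda>(j, k). f (g j k) (g k j)) (ordpairs l)"
proof -
  have "F (\<lambda>j. F (\<lambda>k. g j k) ({1..l} - {j})) {1..l} = F (\<lambda>(j, k). g j k) (SIGMA j:{1..l}. {1..l} - {j})"
    by (rule Sigma) auto
  also have "(SIGMA j:{1..l}. {1..l} - {j}) = ordpairs l \<union> prod.swap ` ordpairs l"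
  proof (intro set_eqI iffI)
    fix x assume "x \<in> (SIGMA j:{1..l}. {1..l} - {j})"
    then obtain j k where x: "x = (j, k)" "j \<in> {1..l}" "k \<in> {1..l}" "j \<noteq> k" by blast
    show "x \<in> ordpairs l \<union> prod.swap ` ordpairs l"
    proof (cases "j < k")
      case False
      then have "(k, j) \<in> ordpairs l" using x by (auto simp: ordpairs_def)
      then show ?thesis unfolding x by (intro UnI2 rev_image_eqI [where x = "(k, j)"]) auto
    qed (use x in \<open>auto simp: ordpairs_def\<close>)
  qed (auto simp: ordpairs_def)
  also have "F (\<lambda>(j, k). g j k) (ordpairs l \<union> prod.swap ` ordpairs l) =
      f (F (\<lambda>(j, k). g j k) (ordpairs l)) (F (\<lambda>(j, k). g j k) (prod.swap ` ordpairs l))"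
  proof (rule union_disjoint)
    show "ordpairs l \<inter> prod.swap ` ordpairs l = {}" by (auto simp: ordpairs_def)
  qed simp_all
  also have "F (\<lambda>(j, k). g j k) (prod.swap ` ordpairs l) = F (\<lambda>(j, k). g k j) (ordpairs l)"
    by (subst reindex) (auto intro!: cong inj_onI)
  also have "f (F (\<lambda>(j, k). g j k) (ordpairs l)) (F (\<lambda>(j, k). g k j) (ordpairs l)) =
      F (\<lambda>(j, k). f (g j k) (g k j)) (ordpairs l)"
    by (subst distrib [symmetric]) (auto intro!: cong)
  finally show ?thesis .
qed

lemma sum_offdiag:
  "(\<Sum>j\<in>{1..l}. \<Sum>k\<in>{1..l} - {j}. g j k) = (\<Sum>(j, k)\<in>ordpairs l. g j k + g k j)"
  for g :: "nat \<Rightarrow> nat \<Rightarrow> 'a::comm_monoid_add"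
  by (rule sum.offdiag)

lemma prod_offdiag:
  "(\<Prod>j\<in>{1..l}. \<Prod>k\<in>{1..l} - {j}. g j k) = (\<Prod>(j, k)\<in>ordpairs l. g j k * g k j)"
  for g :: "nat \<Rightarrow> nat \<Rightarrow> 'a::comm_monoid_mult"
  by (rule prod.offdiag)

lemma sum_pairs: "(\<Sum>S\<in>pairs l. f S) = (\<Sum>(j, k)\<in>ordpairs l. f {j, k})"
  for f :: "nat set \<Rightarrow> 'a::comm_monoid_add"
  using sum.reindex_bij_betw [OF bij_ordpairs, of f l] by (simp add: case_prod_unfold)

lemma prod_pairs: "(\<Prod>S\<in>pairs l. f S) = (\<Prod>(j, k)\<in>ordpairs l. f {j, k})"
  for f :: "nat set \<Rightarrow> 'a::comm_monoid_mult"
  using prod.reindex_bij_betw [OF bij_ordpairs, of f l] by (simp add: case_prod_unfold)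

lemma m_le_sum:
  assumes "j \<in> {1..l}" "k \<in> {1..l}" "j \<noteq> k"
  shows "f {j, k} \<le> (\<Sum>S\<in>pairs l. f S :: nat)"
  by (rule member_le_sum) (use assms in \<open>auto simp: pairs_def\<close>)

lemma sum_m_le_sum:
  assumes "j \<in> {1..l}"
  shows "(\<Sum>k\<in>{1..l} - {j}. f {j, k}) \<le> (\<Sum>S\<in>pairs l. f S :: nat)"
proof -
  have inj: "inj_on (\<lambda>k. {j, k}) ({1..l} - {j})" by (auto intro!: inj_onI simp: doubleton_eq_iff)
  have "(\<Sum>k\<in>{1..l} - {j}. f {j, k}) = (\<Sum>S\<in>(\<lambda>k. {j, k}) ` ({1..l} - {j}). f S)"
    by (subst sum.reindex [OF inj]) simp
  also have "\<dots> \<le> (\<Sum>S\<in>pairs l. f S)"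
    by (rule sum_mono2) (use assms in \<open>auto simp: pairs_def\<close>)
  finally show ?thesis .
qed

section \<open>Ideal families\<close>

text \<open>A vertex \<open>v\<close> is unrestricted in family \<open>ow v\<close>, and family \<open>lm v\<close> contains boundedly many of the
  vertices with a given \<open>ow v\<close>; all other families avoid \<open>v\<close>.\<close>

definition Ideal :: "nat set \<Rightarrow> (nat \<Rightarrow> nat) \<Rightarrow> (nat \<Rightarrow> nat) \<Rightarrow> (nat \<Rightarrow> nat \<Rightarrow> nat) \<Rightarrow> nat \<Rightarrow> nat set set" where
  "Ideal V ow lm c j = {Y. Y \<subseteq> V \<and> (\<forall>v\<in>Y. ow v = j \<or> lm v = j) \<and>
     (\<forall>k. k \<noteq> j \<longrightarrow> card {v\<in>Y. ow v = k \<and> lm v = j} \<le> c j k)}"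

text \<open>A common vertex is owned by one of the two indices and limited by the other, so the two
  caps add up.\<close>

lemma Ideal_Int_le:
  assumes "finite V" "i \<noteq> j" "c i j + c j i \<le> m {i, j}" "A \<in> Ideal V ow lm c i" "B \<in> Ideal V ow lm c j"
  shows "card (A \<inter> B) \<le> m {i, j}"
proof -
  have fin: "finite A" "finite B" using assms by (auto simp: Ideal_def elim: finite_subset)
  have "A \<inter> B \<subseteq> {v\<in>A. ow v = j \<and> lm v = i} \<union> {v\<in>B. ow v = i \<and> lm v = j}"
    using assms by (auto simp: Ideal_def)
  then have "card (A \<inter> B) \<le> card ({v\<in>A. ow v = j \<and> lm v = i} \<union> {v\<in>B. ow v = i \<and> lm v = j})"
    using fin by (intro card_mono) auto
  also have "\<dots> \<le> card {v\<in>A. ow v = j \<and> lm v = i} + card {v\<in>B. ow v = i \<and> lm v = j}"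
    by (rule card_Un_le)
  also have "\<dots> \<le> c i j + c j i"
    using assms by (intro add_mono) (auto simp: Ideal_def)
  finally show ?thesis using assms by simp
qed

lemma overlapping_Ideal:
  assumes "\<And>i j. i \<in> {1..l} \<Longrightarrow> j \<in> {1..l} \<Longrightarrow> i \<noteq> j \<Longrightarrow> c i j + c j i \<le> m {i, j}"
  shows "overlapping n l m (Ideal {1..n} ow lm c)"
  unfolding overlapping_def
proof (intro conjI ballI impI)
  show "Ideal {1..n} ow lm c k \<subseteq> Pow {1..n}" for k by (auto simp: Ideal_def)
  show "card (A \<inter> B) \<le> m {i, j}"
    if "i \<in> {1..l}" "j \<in> {1..l}" "i \<noteq> j" "A \<in> Ideal {1..n} ow lm c i" "B \<in> Ideal {1..n} ow lm c j" for i j A B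
    using that assms by (intro Ideal_Int_le [of "{1..n}"]) auto
qed

text \<open>Only members attaining every cap \<open>c j k\<close> with equality are counted; the
  part owned by \<open>j\<close> is free and the limited parts are disjoint, so the counts
  multiply.\<close>

lemma card_Ideal_ge:
  assumes V: "finite V" "ow ` V \<subseteq> L" and L: "finite L" and j: "j \<in> L"
  shows "2 ^ card {v\<in>V. ow v = j} * (\<Prod>k\<in>L - {j}. card {v\<in>V. ow v = k \<and> lm v = j} choose c j k)
    \<le> card (Ideal V ow lm c j)"
proof -
  define A where "A k = {v\<in>V. ow v = k \<and> lm v = j}" for k
  define S where "S = {Y. Y \<subseteq> (\<Union>k\<in>L - {j}. A k) \<and> (\<forall>k\<in>L - {j}. card (Y \<inter> A k) = c j k)}"
  have "card (Pow {v\<in>V. ow v = j} \<times> S) \<le> card (Ideal V ow lm c j)"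
  proof (rule card_inj_on_le [where f = "\<lambda>(Z, Y). Z \<union> Y"])
    show "inj_on (\<lambda>(Z, Y). Z \<union> Y) (Pow {v\<in>V. ow v = j} \<times> S)"
      by (rule inj_on_inverseI [where g = "\<lambda>Y. (Y \<inter> {v. ow v = j}, Y - {v. ow v = j})"])
         (auto simp: S_def A_def)
    show "(\<lambda>(Z, Y). Z \<union> Y) ` (Pow {v\<in>V. ow v = j} \<times> S) \<subseteq> Ideal V ow lm c j"
    proof clarsimp
      fix Z Y assume Z: "Z \<subseteq> {v\<in>V. ow v = j}" and Y: "Y \<in> S"
      have "card {v \<in> Z \<union> Y. ow v = k \<and> lm v = j} \<le> c j k" if "k \<noteq> j" for k
      proof (cases "k \<in> L")
        case True
        have "{v \<in> Z \<union> Y. ow v = k \<and> lm v = j} = Y \<inter> A k"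
          using Z Y that by (auto simp: S_def A_def)
        then show ?thesis using Y True that by (auto simp: S_def)
      next
        case False
        then have "{v \<in> Z \<union> Y. ow v = k \<and> lm v = j} = {}"
          using Z Y that by (auto simp: S_def A_def)
        then show ?thesis by (simp only: card.empty)
      qed
      then show "Z \<union> Y \<in> Ideal V ow lm c j" using Z Y by (auto simp: Ideal_def S_def A_def)
    qed
    show "finite (Ideal V ow lm c j)"
      by (rule finite_subset [of _ "Pow V"]) (use V in \<open>auto simp: Ideal_def\<close>)
  qed
  also have "card (Pow {v\<in>V. ow v = j} \<times> S) = 2 ^ card {v\<in>V. ow v = j} * card S"
    using V by (simp add: card_cartesian_product card_Pow)
  also have "card S = (\<Prod>k\<in>L - {j}. card (A k) choose c j k)"
    unfolding S_def by (rule card_exact_subsets) (use V L in \<open>auto simp: A_def\<close>)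
  finally show ?thesis by (simp add: A_def)
qed

lemma s_star_ge_Ideal:
  assumes "\<And>i j. i \<in> {1..l} \<Longrightarrow> j \<in> {1..l} \<Longrightarrow> i \<noteq> j \<Longrightarrow> c i j + c j i \<le> m {i, j}"
    and ow: "ow ` {1..n} \<subseteq> {1..l}"
  shows "2 ^ n * (\<Prod>j\<in>{1..l}. \<Prod>k\<in>{1..l} - {j}. card {v\<in>{1..n}. ow v = k \<and> lm v = j} choose c j k)
    \<le> s_star n l m"
proof -
  have "(\<Sum>j\<in>{1..l}. card {v\<in>{1..n}. ow v = j}) = card (\<Union>j\<in>{1..l}. {v\<in>{1..n}. ow v = j})"
    by (rule card_UN_disjoint [symmetric]) auto
  also have "(\<Union>j\<in>{1..l}. {v\<in>{1..n}. ow v = j}) = {1..n}" using ow by blast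
  finally have sum: "(\<Sum>j\<in>{1..l}. card {v\<in>{1..n}. ow v = j}) = n" by simp
  have "2 ^ n * (\<Prod>j\<in>{1..l}. \<Prod>k\<in>{1..l} - {j}. card {v\<in>{1..n}. ow v = k \<and> lm v = j} choose c j k) =
    (\<Prod>j\<in>{1..l}. 2 ^ card {v\<in>{1..n}. ow v = j} * (\<Prod>k\<in>{1..l} - {j}. card {v\<in>{1..n}. ow v = k \<and> lm v = j} choose c j k))"
    by (simp only: prod.distrib power_sum [symmetric] sum)
  also have "\<dots> \<le> (\<Prod>j\<in>{1..l}. card (Ideal {1..n} ow lm c j))"
    by (intro prod_mono conjI card_Ideal_ge ow) auto
  also have "\<dots> \<le> s_star n l m"
    by (rule prod_le_s_star [OF overlapping_Ideal]) (rule assms)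
  finally show ?thesis .
qed

lemma card_residue_class_ge:
  assumes "r < (P::nat)"
  shows "n div P \<le> card {v\<in>{1..n}. (v - 1) mod P = r}"
proof -
  have "card {..<n div P} \<le> card {v\<in>{1..n}. (v - 1) mod P = r}"
  proof (rule card_inj_on_le [where f = "\<lambda>t. P * t + r + 1"])
    show "inj_on (\<lambda>t. P * t + r + 1) {..<n div P}" using assms by (auto intro!: inj_onI)
    show "(\<lambda>t. P * t + r + 1) ` {..<n div P} \<subseteq> {v \<in> {1..n}. (v - 1) mod P = r}"
    proof clarsimp
      fix t assume "t < n div P"
      then have "P * (t + 1) \<le> P * (n div P)" by (intro mult_le_mono2) simp
      also have "\<dots> \<le> n" by simp
      finally show "Suc (P * t + r) \<le> n \<and> r mod P = r" using assms by simp
    qed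
  qed simp
  then show ?thesis by simp
qed

text \<open>Only the order of magnitude is wanted at this stage, so parts of equal size do instead
  of the optimal proportions. The exponent shows the currency of the later comparisons: each limited
  vertex is worth a factor n.\<close>

lemma s_star_lower_bound:
  assumes sg: "(\<Sum>S\<in>pairs l. m S) > 0"
  obtains c :: real where "c > 0"
    "\<And>n. n \<ge> 2 * card (pairs l) * (\<Sum>S\<in>pairs l. m S) \<Longrightarrow>
       c * 2 ^ n * real n ^ (\<Sum>S\<in>pairs l. m S) \<le> real (s_star n l m)"
proof -
  define sg where "sg = (\<Sum>S\<in>pairs l. m S)"
  define P where "P = card (ordpairs l)"
  have Pp: "card (pairs l) = P" unfolding P_def using bij_betw_same_card [OF bij_ordpairs] by simp
  have "pairs l \<noteq> {}" using sg by auto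
  then have P: "P > 0" unfolding Pp [symmetric] by (simp add: card_gt_0_iff)
  have sg: "sg > 0" using sg by (simp add: sg_def)
  obtain e where e: "bij_betw e {0..<P} (ordpairs l)"
    unfolding P_def using ex_bij_betw_nat_finite [OF finite_ordpairs] by blast
  define c where "c = (1 / (2 * real P * real sg)) ^ sg"
  have "c * 2 ^ n * real n ^ sg \<le> real (s_star n l m)" if n: "n \<ge> 2 * P * sg" for n
  proof -
    \<comment> \<open>Points are dealt cyclically to the pairs \<open>(j, k)\<close> with j < k; the
      larger index owns the point and the smaller one is limited.\<close>
    define ow where "ow v = snd (e ((v - 1) mod P))" for v
    define lm where "lm v = fst (e ((v - 1) mod P))" for v
    define cc where "cc j k = (if j < k then m {j, k} else 0)" for j k
    define a where "a j k = card {v\<in>{1..n}. ow v = k \<and> lm v = j}" for j k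
    have eP: "e ((v - 1) mod P) \<in> ordpairs l" for v
      using e P by (auto simp: bij_betw_def)
    have "2 ^ n * (\<Prod>j\<in>{1..l}. \<Prod>k\<in>{1..l} - {j}. a j k choose cc j k) \<le> s_star n l m"
      unfolding a_def
    proof (rule s_star_ge_Ideal)
      show "ow ` {1..n} \<subseteq> {1..l}"
        using eP by (auto simp: ow_def ordpairs_def case_prod_unfold)
    qed (auto simp: cc_def insert_commute)
    also have "(\<Prod>j\<in>{1..l}. \<Prod>k\<in>{1..l} - {j}. a j k choose cc j k) = (\<Prod>(j, k)\<in>ordpairs l. a j k choose m {j, k})"
      unfolding prod_offdiag by (rule prod.cong) (auto simp: cc_def ordpairs_def)
    finally have 1: "real (2 ^ n * (\<Prod>(j, k)\<in>ordpairs l. a j k choose m {j, k})) \<le> real (s_star n l m)"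
      by (simp only: of_nat_le_iff)
    have 2: "(real n / (2 * real P * real sg)) ^ m {j, k} \<le> real (a j k choose m {j, k})"
      if jk: "(j, k) \<in> ordpairs l" for j k
    proof (cases "m {j, k} = 0")
      case False
      have "(j, k) \<in> e ` {0..<P}" using e jk by (simp only: bij_betw_def)
      then obtain r where r: "r < P" "e r = (j, k)" by auto
      have "n div P \<le> card {v\<in>{1..n}. (v - 1) mod P = r}" by (rule card_residue_class_ge [OF r(1)])
      also have "\<dots> \<le> a j k" unfolding a_def
        by (rule card_mono) (use r in \<open>auto simp: ow_def lm_def\<close>)
      finally have a: "n div P \<le> a j k" .
      have mle: "m {j, k} \<le> sg" using jk unfolding sg_def by (intro m_le_sum) (auto simp: ordpairs_def)
      \<comment> \<open>Now every part can hold its cap, and rounding n/P down costs at most the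
        factor 2 present in \<open>c\<close>.\<close>
      have "2 * sg \<le> n div P" using n P by (simp add: less_eq_div_iff_mult_less_eq ac_simps)
      then have "m {j, k} \<le> a j k" using a mle by linarith
      then have "(real (a j k) / real (m {j, k})) ^ m {j, k} \<le> real (a j k choose m {j, k})"
        by (rule binomial_ge_n_over_k_pow_k)
      moreover have "real n / (2 * real P * real sg) \<le> real (a j k) / real (m {j, k})"
      proof -
        have "n < P * (n div P + 1)" using P by (metis Suc_eq_plus1 dividend_less_times_div mult.commute mult_Suc_right add.commute)
        also have "\<dots> \<le> P * (2 * (n div P))"
          using \<open>2 * sg \<le> n div P\<close> sg by (intro mult_le_mono2) linarith
        also have "\<dots> \<le> P * (2 * a j k)" using a by (intro mult_le_mono2) simp
        finally have "real n \<le> 2 * real P * real (a j k)"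
          by (metis less_imp_le mult.assoc mult.commute of_nat_le_iff of_nat_mult of_nat_numeral)
        then have "real n / (2 * real P) \<le> real (a j k)" using P by (simp add: field_simps)
        then have "real n / (2 * real P) / real sg \<le> real (a j k) / real (m {j, k})"
          using mle False by (intro frac_le) auto
        then show ?thesis by simp
      qed
      then have "(real n / (2 * real P * real sg)) ^ m {j, k} \<le> (real (a j k) / real (m {j, k})) ^ m {j, k}"
        by (rule power_mono) simp
      ultimately show ?thesis by linarith
    qed simp
    have "c * 2 ^ n * real n ^ sg = 2 ^ n * (real n / (2 * real P * real sg)) ^ sg"
      by (simp add: c_def power_divide power_mult_distrib)
    also have "(real n / (2 * real P * real sg)) ^ sg = (\<Prod>(j, k)\<in>ordpairs l. (real n / (2 * real P * real sg)) ^ m {j, k})"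
      unfolding sg_def sum_pairs power_sum by (simp add: case_prod_unfold)
    also have "\<dots> \<le> (\<Prod>(j, k)\<in>ordpairs l. real (a j k choose m {j, k}))"
      by (rule prod_mono) (use 2 in auto)
    finally have "c * 2 ^ n * real n ^ sg \<le> 2 ^ n * (\<Prod>(j, k)\<in>ordpairs l. real (a j k choose m {j, k}))"
      by simp
    also have "\<dots> = real (2 ^ n * (\<Prod>(j, k)\<in>ordpairs l. a j k choose m {j, k}))"
      by (simp add: case_prod_unfold)
    finally show ?thesis using 1 by linarith
  qed
  moreover have "c > 0" using P sg by (simp add: c_def)
  ultimately show ?thesis using that unfolding Pp sg_def by blast
qed

declare atLeastAtMost_iff [simp del] One_nat_def [simp del]

section \<open>Weierstrass product inequalities and the fixed data of the problem\<close>

lemma one_minus_sum_le_prod: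
  assumes "finite A" "\<And>i. i \<in> A \<Longrightarrow> 0 \<le> x i \<and> x i \<le> (1::real)"
  shows "1 - (\<Sum>i\<in>A. x i) \<le> (\<Prod>i\<in>A. 1 - x i)"
  using assms
proof (induction A)
  case (insert a A)
  have p: "0 \<le> (\<Prod>i\<in>A. 1 - x i)" "(\<Prod>i\<in>A. 1 - x i) \<le> 1"
    using insert.prems by (auto intro!: prod_nonneg prod_le_1)
  have "(\<Prod>i\<in>insert a A. 1 - x i) = (\<Prod>i\<in>A. 1 - x i) - x a * (\<Prod>i\<in>A. 1 - x i)"
    using insert.hyps by (simp add: algebra_simps)
  also have "\<dots> \<ge> (\<Prod>i\<in>A. 1 - x i) - x a"
    using p insert.prems [of a] mult_left_mono [of "\<Prod>i\<in>A. 1 - x i" 1 "x a"] by simp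
  moreover have "1 - (\<Sum>i\<in>A. x i) \<le> (\<Prod>i\<in>A. 1 - x i)" using insert by auto
  ultimately show ?case using insert.hyps by simp
qed simp

lemma one_plus_sum_le_prod:
  assumes "finite A" "\<And>i. i \<in> A \<Longrightarrow> 0 \<le> (x i :: real)"
  shows "1 + (\<Sum>i\<in>A. x i) \<le> (\<Prod>i\<in>A. 1 + x i)"
  using assms
proof (induction A)
  case (insert a A)
  have "1 \<le> (\<Prod>i\<in>A. 1 + x i)" using insert.prems by (intro prod_ge_1) auto
  then have "x a * 1 \<le> x a * (\<Prod>i\<in>A. 1 + x i)" using insert.prems by (intro mult_left_mono) auto
  moreover have "1 + (\<Sum>i\<in>A. x i) \<le> (\<Prod>i\<in>A. 1 + x i)" using insert by auto
  ultimately show ?case using insert.hyps by (simp add: algebra_simps)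
qed simp

lemma double_le:
  assumes "l \<ge> 1" shows "2 * s_star n l m \<le> s_star (Suc n) l m"
proof -
  obtain F where "extremal n l m F" using ex_extremal by blast
  then interpret extremal_families n l m F by unfold_locales
  show ?thesis using assms by (rule double)
qed

locale overlap_problem =
  fixes l :: nat and m :: "nat set \<Rightarrow> nat"
  assumes l_ge: "l \<ge> 2" and weight_pos: "(\<Sum>S\<in>pairs l. m S) > 0"
begin

definition sg :: nat where "sg = (\<Sum>S\<in>pairs l. m S)"

lemma sg_pos: "sg \<ge> 1"
  using weight_pos by (simp add: sg_def)

lemma m_le_sg: "j \<in> {1..l} \<Longrightarrow> k \<in> {1..l} \<Longrightarrow> j \<noteq> k \<Longrightarrow> m {j, k} \<le> sg"
  unfolding sg_def by (rule m_le_sum)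

text \<open>Number of vertices that a typical member of family \<open>j\<close> has in the parts of
  the others, hence the exponent of n in the size of the family.\<close>

definition deg :: "(nat \<Rightarrow> nat \<Rightarrow> nat) \<Rightarrow> nat \<Rightarrow> nat" where
  "deg \<tau> j = (\<Sum>k\<in>{1..l} - {j}. \<tau> j k)"

lemma sum_deg:
  assumes "\<And>j k. j \<in> {1..l} \<Longrightarrow> k \<in> {1..l} \<Longrightarrow> j \<noteq> k \<Longrightarrow> \<tau> j k + \<tau> k j = m {j, k}"
  shows "(\<Sum>j\<in>{1..l}. deg \<tau> j) = sg"
  unfolding deg_def sum_offdiag sg_def sum_pairs
  by (rule sum.cong) (use assms in \<open>auto simp: ordpairs_def\<close>)

definition typical :: "(nat \<Rightarrow> nat set) \<Rightarrow> (nat \<Rightarrow> nat \<Rightarrow> nat) \<Rightarrow> nat \<Rightarrow> nat set \<Rightarrow> bool" where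
  "typical B \<tau> j G \<longleftrightarrow> (\<forall>k\<in>{1..l} - {j}. card (G \<inter> B k) = \<tau> j k)"

text \<open>Atypical members are split because they are rare for different reasons: a light one has
  fewer vertices off its part and loses a factor n by counting, a heavy one is ruled out by
  conflicts.\<close>

definition heavy :: "(nat \<Rightarrow> nat set) \<Rightarrow> (nat \<Rightarrow> nat \<Rightarrow> nat) \<Rightarrow> nat \<Rightarrow> nat set \<Rightarrow> bool" where
  "heavy B \<tau> j G \<longleftrightarrow> (\<exists>k\<in>{1..l} - {j}. card (G \<inter> B k) > \<tau> j k)"

end

locale extremal_problem = overlap_problem l m + extremal_families n l m F
  for n l :: nat and m :: "nat set \<Rightarrow> nat" and F :: "nat \<Rightarrow> nat set set"
begin

lemma q_le_one: "k \<in> {1..l} \<Longrightarrow> q k v \<le> 1"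
  using q_le_half [of k v] by linarith

lemma prod_one_minus_q_le:
  assumes v: "v \<in> {1..n}"
  shows "(\<Prod>k\<in>{1..l}. 1 - q k v) \<le> 1 / 2"
proof -
  have "n \<ge> 1" using v by (simp add: atLeastAtMost_iff)
  then have "2 * s_star (n - 1) l m \<le> s_star n l m"
    using double_le [of l "n - 1" m] l_ge by simp
  then have "2 * real (s_star (n - 1) l m) \<le> real (s_star n l m)"
    by (simp flip: of_nat_le_iff)
  then have "2 * ((\<Prod>k\<in>{1..l}. 1 - q k v) * real (s_star n l m)) \<le> real (s_star n l m)"
    using delete_vertex [OF v] by linarith
  then have "(2 * (\<Prod>k\<in>{1..l}. 1 - q k v)) * real (s_star n l m) \<le> 1 * real (s_star n l m)"
    by simp
  then have "2 * (\<Prod>k\<in>{1..l}. 1 - q k v) \<le> 1"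
    by (rule mult_right_le_imp_le) (simp add: s_star_pos)
  then show ?thesis by simp
qed

text \<open>If the other families rarely use \<open>v\<close>, the bound 1/2 on the product of the
  \<open>1 - q j v\<close> pushes \<open>q k v\<close> towards its maximum 1/2, with an error linear
  in the use by the others.\<close>

lemma deficit_le:
  assumes v: "v \<in> {1..n}" and k: "k \<in> {1..l}" and S: "(\<Sum>j\<in>{1..l} - {k}. q j v) \<le> 1 / 2"
  shows "1 - 2 * q k v \<le> 2 * (\<Sum>j\<in>{1..l} - {k}. q j v)"
proof -
  define s where "s = (\<Sum>j\<in>{1..l} - {k}. q j v)"
  define P where "P = (\<Prod>j\<in>{1..l} - {k}. 1 - q j v)"
  have s0: "s \<ge> 0" by (auto simp: s_def intro: sum_nonneg)
  have sP: "1 - s \<le> P" unfolding s_def P_def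
    by (rule one_minus_sum_le_prod) (use q_le_one in auto)
  have qk: "q k v \<le> 1 / 2" using q_le_half k by blast
  have "(1 - q k v) * P \<le> 1 / 2"
    using prod_one_minus_q_le [OF v] k by (simp add: prod.remove [of _ k] P_def)
  moreover have "(1 - q k v) * (1 - s) \<le> (1 - q k v) * P"
    using sP qk by (intro mult_left_mono) auto
  ultimately have "(1 - q k v) * (1 - s) \<le> 1 / 2" by linarith
  moreover have "s \<le> 1 / 2" using S by (simp add: s_def)
  ultimately have "(1 - s) * (1 - 2 * q k v) \<le> s" by (simp add: algebra_simps)
  moreover have "(1 / 2) * (1 - 2 * q k v) \<le> (1 - s) * (1 - 2 * q k v)"
    using \<open>s \<le> 1 / 2\<close> qk by (intro mult_right_mono) auto
  ultimately show ?thesis by (simp add: s_def)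
qed

lemma Pr_not_extend_le:
  assumes k: "k \<in> {1..l}" and D: "finite D" "card D \<le> d"
    and h: "\<And>u. u \<in> D \<Longrightarrow> 1 - 2 * q k u \<le> \<eta>" and eta: "0 \<le> \<eta>"
  shows "Pr (F k) (\<lambda>G. G \<union> D \<notin> F k) \<le> 2 ^ d * (real d * \<eta>)"
proof -
  have "Pr (F k) (\<lambda>G. True \<and> G \<union> D \<notin> F k) \<le>
      2 ^ card D * (\<Sum>u\<in>D. Pr (F k) (\<lambda>G. True \<and> u \<notin> G \<and> insert u G \<notin> F k))"
    by (rule Pr_extension_le) (use finite_F k D in auto)
  also have "\<dots> \<le> 2 ^ card D * (real (card D) * \<eta>)"
    using h k by (intro mult_left_mono sum_bounded_above) (auto simp: deficit_eq)
  also have "\<dots> \<le> 2 ^ d * (real d * \<eta>)"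
    using D eta by (intro mult_mono power_increasing) (auto intro: mult_right_mono)
  finally show ?thesis by simp
qed

end

text \<open>\<open>B k\<close> is the set of vertices used freely by family \<open>k\<close>, \<open>H\<close> a bounded exceptional set, and
  \<open>\<tau> j k\<close> the number of vertices that a typical member of \<open>F j\<close> has in \<open>B k\<close>. The point of
  \<open>C\<close> is that it does not depend on \<open>n\<close>.\<close>

locale structured = extremal_problem n l m F
  for n l :: nat and m :: "nat set \<Rightarrow> nat" and F :: "nat \<Rightarrow> nat set set" +
  fixes C :: nat and H :: "nat set" and B :: "nat \<Rightarrow> nat set" and \<tau> :: "nat \<Rightarrow> nat \<Rightarrow> nat"
  assumes n_pos: "n \<ge> 1"
    and H_sub: "H \<subseteq> {1..n}" and card_H: "card H \<le> C"
    and B_sub: "k \<in> {1..l} \<Longrightarrow> B k \<subseteq> {1..n} - H"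
    and B_disj: "\<lbrakk>j \<in> {1..l}; k \<in> {1..l}; j \<noteq> k\<rbrakk> \<Longrightarrow> B j \<inter> B k = {}"
    and B_cover: "{1..n} = H \<union> (\<Union>k\<in>{1..l}. B k)"
    and card_trace_le: "\<lbrakk>j \<in> {1..l}; k \<in> {1..l}; j \<noteq> k; G \<in> F j\<rbrakk> \<Longrightarrow> card (G \<inter> B k) \<le> m {j, k}"
    and type_sum: "\<lbrakk>j \<in> {1..l}; k \<in> {1..l}; j \<noteq> k\<rbrakk> \<Longrightarrow> \<tau> j k + \<tau> k j = m {j, k}"
    and card_F_ge: "j \<in> {1..l} \<Longrightarrow> 2 ^ card (B j) * n ^ deg \<tau> j \<le> C * card (F j)"
    and typical_ext: "\<lbrakk>k \<in> {1..l}; D \<subseteq> B k; card D \<le> sg\<rbrakk> \<Longrightarrow>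
          1 / real C \<le> Pr (F k) (\<lambda>G. typical B \<tau> k G \<and> G \<union> D \<in> F k)"
    and H_two: "v \<in> H \<Longrightarrow> \<exists>i\<in>{1..l}. \<exists>j\<in>{1..l}. i \<noteq> j \<and> 1 / real C \<le> q i v \<and> 1 / real C \<le> q j v"
begin

lemma finite_H: "finite H"
  using H_sub finite_subset by blast

lemma finite_B: "k \<in> {1..l} \<Longrightarrow> finite (B k)"
  using B_sub finite_subset by blast

lemma C_pos: "C \<ge> 1"
proof -
  have "1 \<in> {1..l}" using l_ge by (simp add: atLeastAtMost_iff)
  from card_F_ge [OF this] show ?thesis using n_pos by (cases C) auto
qed

lemma card_F_ge_real:
  assumes "j \<in> {1..l}"
  shows "2 ^ card (B j) * real n ^ deg \<tau> j \<le> real C * real (card (F j))"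
proof -
  have "real (2 ^ card (B j) * n ^ deg \<tau> j) \<le> real (C * card (F j))"
    using card_F_ge [OF assms] by (simp only: of_nat_le_iff)
  then show ?thesis by simp
qed

lemma not_owner_eq:
  assumes "j \<in> {1..l}"
  shows "{1..n} - (B j \<union> H) = (\<Union>k\<in>{1..l} - {j}. B k)"
proof
  show "{1..n} - (B j \<union> H) \<subseteq> (\<Union>k\<in>{1..l} - {j}. B k)" using B_cover by auto
  show "(\<Union>k\<in>{1..l} - {j}. B k) \<subseteq> {1..n} - (B j \<union> H)"
    using B_sub B_disj assms by fast
qed

lemma card_off_eq:
  assumes j: "j \<in> {1..l}" and G: "G \<in> F j"
  shows "card (G - (B j \<union> H)) = (\<Sum>k\<in>{1..l} - {j}. card (G \<inter> B k))"
proof -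
  have "G - (B j \<union> H) = G \<inter> ({1..n} - (B j \<union> H))" using F_sub [OF j G] by auto
  also have "\<dots> = (\<Union>k\<in>{1..l} - {j}. G \<inter> B k)" unfolding not_owner_eq [OF j] by auto
  finally have "card (G - (B j \<union> H)) = card (\<Union>k\<in>{1..l} - {j}. G \<inter> B k)" by simp
  also have "\<dots> = (\<Sum>k\<in>{1..l} - {j}. card (G \<inter> B k))"
  proof (rule card_UN_disjoint)
    show "\<forall>k\<in>{1..l} - {j}. finite (G \<inter> B k)" using finite_B by auto
    show "\<forall>k\<in>{1..l} - {j}. \<forall>i\<in>{1..l} - {j}. k \<noteq> i \<longrightarrow> G \<inter> B k \<inter> (G \<inter> B i) = {}"
      using B_disj by fast
  qed simp
  finally show ?thesis .
qed

lemma card_off_le_sg: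
  assumes j: "j \<in> {1..l}" and G: "G \<in> F j"
  shows "card (G - (B j \<union> H)) \<le> sg"
proof -
  have "card (G - (B j \<union> H)) \<le> (\<Sum>k\<in>{1..l} - {j}. m {j, k})"
    unfolding card_off_eq [OF assms] by (rule sum_mono) (use card_trace_le j G in auto)
  also have "\<dots> \<le> sg" unfolding sg_def by (rule sum_m_le_sum [OF j])
  finally show ?thesis .
qed

lemma card_off_typical:
  assumes j: "j \<in> {1..l}" and G: "G \<in> F j" "typical B \<tau> j G"
  shows "card (G - (B j \<union> H)) = deg \<tau> j"
  unfolding card_off_eq [OF assms(1,2)] deg_def by (rule sum.cong) (use G in \<open>auto simp: typical_def\<close>)

lemma card_off_light:
  assumes j: "j \<in> {1..l}" and G: "G \<in> F j" "\<not> heavy B \<tau> j G" "\<not> typical B \<tau> j G"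
  shows "card (G - (B j \<union> H)) < deg \<tau> j"
  unfolding card_off_eq [OF assms(1,2)] deg_def
proof (rule sum_strict_mono_ex1)
  show "\<forall>k\<in>{1..l} - {j}. card (G \<inter> B k) \<le> \<tau> j k"
    using G by (auto simp: heavy_def not_less)
  show "\<exists>k\<in>{1..l} - {j}. card (G \<inter> B k) < \<tau> j k"
    using G by (force simp: heavy_def typical_def not_less)
qed simp

text \<open>A trace off \<open>B j \<union> H\<close> with s vertices and containing
  \<open>R\<close> can be chosen in at most n^(s - |R|) ways and has at most 2^(|B j| + C)
  completions; the lower bound on \<open>card (F j)\<close> gives the ratio. Powers of n stay in the
  denominator so that no truncated subtraction enters the bound.\<close>

lemma Pr_off_le:
  assumes j: "j \<in> {1..l}" and R: "R \<inter> (B j \<union> H) = {}" "finite R"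
  shows "Pr (F j) (\<lambda>G. R \<subseteq> G \<and> card (G - (B j \<union> H)) = s)
    \<le> real C * 2 ^ C * real n ^ s / (real n ^ deg \<tau> j * real n ^ card R)"
proof -
  define \<O> where "\<O> = {G\<in>F j. R \<subseteq> G \<and> card (G - (B j \<union> H)) = s}"
  have fin: "finite \<O>" "finite (B j \<union> H)" using finite_F finite_B finite_H j by (auto simp: \<O>_def)
  have le: "real (card \<O>) * real n ^ card R \<le> 2 ^ C * 2 ^ card (B j) * real n ^ s"
  proof (cases "card R \<le> s")
    case True
    have "card ((\<lambda>G. G - (B j \<union> H)) ` \<O>) \<le> card {X. X \<subseteq> {1..n} \<and> card X = s \<and> R \<subseteq> X}"
      by (rule card_mono) (use R F_sub j in \<open>auto simp: \<O>_def\<close>)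
    also have "\<dots> \<le> n ^ (s - card R)" using card_supersets_le [of "{1..n}" s R] by simp
    finally have "card \<O> \<le> 2 ^ card (B j \<union> H) * n ^ (s - card R)"
      using card_le_pow_times_traces [OF fin] by (meson le_trans mult_le_mono2)
    also have "\<dots> \<le> 2 ^ (card (B j) + C) * n ^ (s - card R)"
      using card_H card_Un_le [of "B j" H] by (intro mult_right_mono power_increasing) auto
    finally have "card \<O> * n ^ card R \<le> (2 ^ (card (B j) + C) * n ^ (s - card R)) * n ^ card R"
      by (rule mult_le_mono1)
    also have "\<dots> = 2 ^ C * 2 ^ card (B j) * n ^ s"
      using True by (simp add: power_add mult.assoc flip: power_add)
    finally have "real (card \<O> * n ^ card R) \<le> real (2 ^ C * 2 ^ card (B j) * n ^ s)"
      by (simp only: of_nat_le_iff)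
    then show ?thesis by simp
  next
    case False
    \<comment> \<open>\<open>R\<close> lies off \<open>B j \<union> H\<close>, so a member with
      fewer than |R| vertices there cannot contain it.\<close>
    have "\<O> = {}"
    proof (rule ccontr)
      assume "\<O> \<noteq> {}"
      then obtain G where G: "G \<in> \<O>" by blast
      then have "R \<subseteq> G - (B j \<union> H)" using R by (auto simp: \<O>_def)
      then have "card R \<le> card (G - (B j \<union> H))"
        using G finite_mem j by (intro card_mono) (auto simp: \<O>_def)
      then show False using G False by (auto simp: \<O>_def)
    qed
    then show ?thesis by simp
  qed
  have F0: "real (card (F j)) > 0" using card_F_pos j by simp
  have Fge: "2 ^ card (B j) * real n ^ deg \<tau> j \<le> real C * real (card (F j))"
    by (rule card_F_ge_real [OF j])
  have "real (card \<O>) * (real n ^ deg \<tau> j * real n ^ card R) \<le>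
      (2 ^ C * 2 ^ card (B j) * real n ^ s) * real n ^ deg \<tau> j"
    using mult_right_mono [OF le, of "real n ^ deg \<tau> j"] by (simp add: ac_simps)
  also have "\<dots> = (2 ^ C * real n ^ s) * (2 ^ card (B j) * real n ^ deg \<tau> j)" by simp
  also have "\<dots> \<le> (2 ^ C * real n ^ s) * (real C * real (card (F j)))"
    using Fge by (intro mult_left_mono) auto
  finally have "real (card \<O>) * (real n ^ deg \<tau> j * real n ^ card R) \<le>
     (real C * 2 ^ C * real n ^ s) * real (card (F j))" by (simp add: ac_simps)
  then show ?thesis unfolding Pr_def \<O>_def [symmetric] using F0 n_pos
    by (simp add: divide_le_eq pos_le_divide_eq ac_simps)
qed

lemma Pr_typical_le:
  assumes "j \<in> {1..l}" "R \<inter> (B j \<union> H) = {}" "finite R"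
  shows "Pr (F j) (\<lambda>G. R \<subseteq> G \<and> typical B \<tau> j G) \<le> real C * 2 ^ C / real n ^ card R"
proof -
  have "Pr (F j) (\<lambda>G. R \<subseteq> G \<and> typical B \<tau> j G) \<le> Pr (F j) (\<lambda>G. R \<subseteq> G \<and> card (G - (B j \<union> H)) = deg \<tau> j)"
    by (rule Pr_mono) (use finite_F card_off_typical assms in auto)
  also have "\<dots> \<le> real C * 2 ^ C * real n ^ deg \<tau> j / (real n ^ deg \<tau> j * real n ^ card R)"
    by (rule Pr_off_le) (use assms in auto)
  also have "\<dots> = real C * 2 ^ C / real n ^ card R" using n_pos by simp
  finally show ?thesis .
qed

text \<open>A light atypical member has strictly fewer than \<open>deg \<tau> j\<close> vertices off
  its part, which costs one more factor n; the factor \<open>sg\<close> bounds how many smaller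
  numbers are possible.\<close>

lemma Pr_light_le:
  assumes "j \<in> {1..l}" "R \<inter> (B j \<union> H) = {}" "finite R"
  shows "Pr (F j) (\<lambda>G. R \<subseteq> G \<and> \<not> heavy B \<tau> j G \<and> \<not> typical B \<tau> j G)
    \<le> real sg * (real C * 2 ^ C) / real n ^ (card R + 1)"
proof -
  have "deg \<tau> j \<le> sg"
  proof -
    have "deg \<tau> j \<le> (\<Sum>k\<in>{1..l} - {j}. m {j, k})"
      unfolding deg_def using type_sum [of j] assms(1) by (intro sum_mono) (metis DiffD1 DiffD2 insertI1 le_add1)
    also have "\<dots> \<le> sg" unfolding sg_def by (rule sum_m_le_sum [OF assms(1)])
    finally show ?thesis .
  qed
  have "Pr (F j) (\<lambda>G. R \<subseteq> G \<and> \<not> heavy B \<tau> j G \<and> \<not> typical B \<tau> j G) \<le>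
      Pr (F j) (\<lambda>G. \<exists>s\<in>{..<deg \<tau> j}. R \<subseteq> G \<and> card (G - (B j \<union> H)) = s)"
    by (rule Pr_mono) (use finite_F card_off_light assms in auto)
  also have "\<dots> \<le> (\<Sum>s\<in>{..<deg \<tau> j}. Pr (F j) (\<lambda>G. R \<subseteq> G \<and> card (G - (B j \<union> H)) = s))"
    by (rule Pr_Bex) (use finite_F assms in auto)
  also have "\<dots> \<le> real (card {..<deg \<tau> j}) * (real C * 2 ^ C / real n ^ (card R + 1))"
  proof (rule sum_bounded_above)
    fix s assume s: "s \<in> {..<deg \<tau> j}"
    have "Pr (F j) (\<lambda>G. R \<subseteq> G \<and> card (G - (B j \<union> H)) = s) \<le>
       real C * 2 ^ C * real n ^ s / (real n ^ deg \<tau> j * real n ^ card R)"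
      by (rule Pr_off_le) (use assms in auto)
    also have "\<dots> \<le> real C * 2 ^ C * (real n ^ deg \<tau> j / real n) / (real n ^ deg \<tau> j * real n ^ card R)"
    proof -
      have "real n ^ Suc s \<le> real n ^ deg \<tau> j" using s n_pos by (intro power_increasing) auto
      then have "real n ^ s \<le> real n ^ deg \<tau> j / real n" using n_pos by (simp add: field_simps)
      then show ?thesis by (intro divide_right_mono mult_left_mono) auto
    qed
    also have "\<dots> = real C * 2 ^ C / real n ^ (card R + 1)"
      using n_pos by (simp add: field_simps power_add)
    finally show "Pr (F j) (\<lambda>G. R \<subseteq> G \<and> card (G - (B j \<union> H)) = s) \<le> real C * 2 ^ C / real n ^ (card R + 1)" .
  qed
  also have "\<dots> = real (deg \<tau> j) * (real C * 2 ^ C) / real n ^ (card R + 1)" by simp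
  also have "\<dots> \<le> real sg * (real C * 2 ^ C) / real n ^ (card R + 1)"
    using \<open>deg \<tau> j \<le> sg\<close> by (intro divide_right_mono mult_right_mono) auto
  finally show ?thesis .
qed

text \<open>The proportion is what survives \<open>R\<close> independent exclusions of sets of size
  at most \<open>sg\<close>. With \<open>R\<close> linear in n it is exponentially small.\<close>

definition killed :: "nat \<Rightarrow> nat \<Rightarrow> nat set \<Rightarrow> bool" where
  "killed R i X \<longleftrightarrow> real (card {Z\<in>Pow (B i). X \<union> Z \<in> F i}) \<le> (1 - 1 / 2 ^ sg) ^ R * 2 ^ card (B i)"

text \<open>Every \<open>G \<inter> B i\<close> with \<open>G \<in> \<G>\<close> is excluded from the link of \<open>X\<close> in \<open>F i\<close>, and since no vertex lies
  in many members of \<open>\<G>\<close>, there are many disjoint excluded sets.\<close>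

lemma killedI:
  assumes ij: "i \<in> {1..l}" "j \<in> {1..l}" "i \<noteq> j" and X: "X \<inter> B i = {}" "finite X"
    and \<G>: "\<G> \<subseteq> F j" "\<G> \<noteq> {}" "\<And>G. G \<in> \<G> \<Longrightarrow> G \<union> (X \<inter> B j) \<in> F j"
    and big: "\<And>G. G \<in> \<G> \<Longrightarrow> m {i, j} < card (G \<inter> B i) + card (X \<inter> (G \<union> (X \<inter> B j)))"
    and spread: "\<And>u. u \<in> B i \<Longrightarrow> card {G\<in>\<G>. u \<in> G} * (sg * R) < card \<G>"
  shows "killed R i X"
  unfolding killed_def
proof (rule card_avoiding_le [where \<D> = "(\<lambda>G. G \<inter> B i) ` \<G>"])
  show "finite (B i)" using finite_B ij by blast
  show "D \<subseteq> B i \<and> card D \<le> sg" if D: "D \<in> (\<lambda>G. G \<inter> B i) ` \<G>" for D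
  proof -
    obtain G where G: "G \<in> \<G>" "D = G \<inter> B i" using D by auto
    then have "card D \<le> m {j, i}" using card_trace_le [of j i G] ij \<G> by auto
    also have "\<dots> \<le> sg" using m_le_sg ij by auto
    finally show ?thesis using G by auto
  qed
  show "{Z \<in> Pow (B i). X \<union> Z \<in> F i} \<subseteq> Pow (B i)" by auto
  show "\<not> D \<subseteq> Z" if Z: "Z \<in> {Z \<in> Pow (B i). X \<union> Z \<in> F i}" and D: "D \<in> (\<lambda>G. G \<inter> B i) ` \<G>" for Z D
  proof
    assume DZ: "D \<subseteq> Z"
    obtain G where G: "G \<in> \<G>" "D = G \<inter> B i" using D by auto
    let ?G = "G \<union> (X \<inter> B j)"
    have finG: "finite G" using G \<G> finite_mem ij by blast
    \<comment> \<open>If \<open>Z\<close> contained the excluded trace, this trace and the overlap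
      already present in \<open>X\<close>, disjoint because \<open>X\<close> avoids
      \<open>B i\<close>, would together exceed \<open>m {i, j}\<close>.\<close>
    have "(G \<inter> B i) \<union> (X \<inter> ?G) \<subseteq> (X \<union> Z) \<inter> ?G" using G DZ by auto
    then have "card ((G \<inter> B i) \<union> (X \<inter> ?G)) \<le> card ((X \<union> Z) \<inter> ?G)"
      using finG X by (intro card_mono) auto
    also have "\<dots> \<le> m {i, j}" using card_Int_le [of i j "X \<union> Z" ?G] Z \<G>(3) G ij by auto
    also have "\<dots> < card (G \<inter> B i) + card (X \<inter> ?G)" using big G by blast
    also have "\<dots> = card ((G \<inter> B i) \<union> (X \<inter> ?G))"
      using X finG by (intro card_Un_disjoint [symmetric]) auto
    finally show False by simp
  qed
  show "\<exists>D\<in>(\<lambda>G. G \<inter> B i) ` \<G>. D \<inter> S = {}" if S: "S \<subseteq> B i" "card S \<le> sg * R" for S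
  proof (rule ccontr)
    assume no: "\<not> (\<exists>D\<in>(\<lambda>G. G \<inter> B i) ` \<G>. D \<inter> S = {})"
    have finS: "finite S" using S finite_B ij finite_subset by blast
    have fin\<G>: "finite \<G>" using \<G> finite_F ij finite_subset by blast
    \<comment> \<open>A set \<open>S\<close> hitting all traces would cover \<open>\<G>\<close> by
      the members through its vertices, which are too few by \<open>spread\<close>.\<close>
    have "\<G> \<subseteq> (\<Union>u\<in>S. {G\<in>\<G>. u \<in> G})" using no by auto
    then have "card \<G> \<le> card (\<Union>u\<in>S. {G\<in>\<G>. u \<in> G})" using finS fin\<G> by (intro card_mono) auto
    also have "\<dots> \<le> (\<Sum>u\<in>S. card {G\<in>\<G>. u \<in> G})" by (rule card_UN_le [OF finS])
    finally have 1: "card \<G> \<le> (\<Sum>u\<in>S. card {G\<in>\<G>. u \<in> G})" .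
    have "card \<G> > 0" using \<G> fin\<G> by (simp add: card_gt_0_iff)
    then have "S \<noteq> {}" using 1 by auto
    then have Spos: "card S > 0" using finS by (simp add: card_gt_0_iff)
    have "card \<G> * (sg * R) \<le> (\<Sum>u\<in>S. card {G\<in>\<G>. u \<in> G} * (sg * R))"
      using mult_le_mono1 [OF 1] by (simp add: sum_distrib_right)
    also have "\<dots> < (\<Sum>u\<in>S. card \<G>)"
      using finS \<open>S \<noteq> {}\<close> spread S by (intro sum_strict_mono) auto
    also have "\<dots> = card S * card \<G>" by simp
    also have "\<dots> \<le> (sg * R) * card \<G>" using S by (intro mult_le_mono1)
    finally show False by (simp add: mult.commute)
  qed
qed

text \<open>Traces off \<open>B i\<close> are only polynomially many: at most \<open>sg\<close>
  vertices lie off \<open>B i \<union> H\<close>, and \<open>H\<close> contributes a factor at most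
  2^C. Each killed trace keeps a proportion (1 - 2^-sg)^R of the subsets of \<open>B i\<close>,
  while \<open>F i\<close> has at least 2^|B i| / C members.\<close>

lemma Pr_killed_le:
  assumes i: "i \<in> {1..l}" and P: "\<And>G. G \<in> F i \<Longrightarrow> P G \<Longrightarrow> killed R i (G - B i)"
  shows "Pr (F i) P \<le> (real C * 2 ^ C * real (sg + 1)) * (1 - 1 / 2 ^ sg) ^ R * real n ^ sg"
proof -
  define \<O> where "\<O> = {G\<in>F i. P G}"
  define \<kappa> where "\<kappa> = (1 - 1 / (2::real) ^ sg) ^ R"
  have \<kappa>0: "\<kappa> \<ge> 0" by (simp add: \<kappa>_def)
  have fin: "finite \<O>" "finite (B i)" using finite_F finite_B i by (auto simp: \<O>_def)
  have "real (card \<O>) \<le> real (card ((\<lambda>G. G - B i) ` \<O>)) * (\<kappa> * 2 ^ card (B i))"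
  proof (rule card_le_fibres [OF fin(1) _ fin(2)])
    fix G assume G: "G \<in> \<O>"
    have "card {Z \<in> Pow (B i). G - B i \<union> Z \<in> \<O>} \<le> card {Z \<in> Pow (B i). G - B i \<union> Z \<in> F i}"
      using fin by (intro card_mono) (auto simp: \<O>_def)
    then show "real (card {Z \<in> Pow (B i). G - B i \<union> Z \<in> \<O>}) \<le> \<kappa> * 2 ^ card (B i)"
      using P [of G] G unfolding killed_def \<O>_def \<kappa>_def by simp
  qed
  also have "card ((\<lambda>G. G - B i) ` \<O>) \<le> 2 ^ C * ((sg + 1) * n ^ sg)"
  proof -
    have "card ((\<lambda>G. G - B i) ` \<O>) \<le> 2 ^ card H * card ((\<lambda>G. G - H) ` (\<lambda>G. G - B i) ` \<O>)"
      by (rule card_le_pow_times_traces) (use fin finite_H in auto)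
    also have "card ((\<lambda>G. G - H) ` (\<lambda>G. G - B i) ` \<O>) \<le> card {X. X \<subseteq> {1..n} \<and> card X \<le> sg}"
    proof (rule card_mono)
      show "(\<lambda>G. G - H) ` (\<lambda>G. G - B i) ` \<O> \<subseteq> {X. X \<subseteq> {1..n} \<and> card X \<le> sg}"
      proof clarsimp
        fix G assume "G \<in> \<O>"
        then have G: "G \<in> F i" by (simp add: \<O>_def)
        have "G - B i - H = G - (B i \<union> H)" by auto
        then show "G - B i - H \<subseteq> {1..n} \<and> card (G - B i - H) \<le> sg"
          using card_off_le_sg [OF i G] F_sub [OF i G] by auto
      qed
    qed simp
    also have "\<dots> \<le> (sg + 1) * n ^ sg"
      using card_small_subsets_le [of "{1..n}" sg] n_pos by simp
    also have "2 ^ card H * ((sg + 1) * n ^ sg) \<le> 2 ^ C * ((sg + 1) * n ^ sg)"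
      using card_H by (intro mult_right_mono power_increasing) auto
    finally show ?thesis by simp
  qed
  then have "real (card ((\<lambda>G. G - B i) ` \<O>)) * (\<kappa> * 2 ^ card (B i)) \<le>
     real (2 ^ C * ((sg + 1) * n ^ sg)) * (\<kappa> * 2 ^ card (B i))"
    using \<kappa>0 by (intro mult_right_mono of_nat_mono) auto
  also have "\<dots> = (2 ^ C * real (sg + 1) * real n ^ sg * \<kappa>) * 2 ^ card (B i)" by simp
  also have "\<dots> \<le> (2 ^ C * real (sg + 1) * real n ^ sg * \<kappa>) * (real C * real (card (F i)))"
  proof (rule mult_left_mono)
    have "(2::real) ^ card (B i) \<le> 2 ^ card (B i) * real n ^ deg \<tau> i"
      using n_pos by simp
    also have "\<dots> \<le> real C * real (card (F i))"
      by (rule card_F_ge_real [OF i])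
    finally show "(2::real) ^ card (B i) \<le> real C * real (card (F i))" .
  qed (use \<kappa>0 in auto)
  finally have "real (card \<O>) \<le> ((real C * 2 ^ C * real (sg + 1)) * \<kappa> * real n ^ sg) * real (card (F i))"
    by (simp add: ac_simps)
  then show ?thesis unfolding Pr_def \<O>_def [symmetric] \<kappa>_def [symmetric]
    using card_F_pos [OF i] by (simp add: divide_le_eq)
qed

end

section \<open>The vertex partition\<close>

context extremal_problem
begin

definition Hset :: "real \<Rightarrow> nat set" where
  "Hset \<epsilon> = {v\<in>{1..n}. \<exists>i\<in>{1..l}. \<exists>j\<in>{1..l}. i \<noteq> j \<and> \<epsilon> \<le> q i v \<and> \<epsilon> \<le> q j v}"

definition Bset :: "real \<Rightarrow> nat \<Rightarrow> nat set" where
  "Bset \<epsilon> k = {v\<in>{1..n} - Hset \<epsilon>. \<epsilon> \<le> q k v}"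

text \<open>Every vertex counted for a pair of families spends \<epsilon>^2 of their expected
  overlap, which is at most \<open>sg\<close>.\<close>

lemma card_Hset_le:
  assumes "\<epsilon> > 0"
  shows "real (card (Hset \<epsilon>)) \<le> real l * (real l * (real sg / \<epsilon>\<^sup>2))"
proof -
  define W where "W i j = {v\<in>{1..n}. i \<noteq> j \<and> \<epsilon> \<le> q i v \<and> \<epsilon> \<le> q j v}" for i j
  have W: "real (card (W i j)) \<le> real sg / \<epsilon>\<^sup>2" if ij: "i \<in> {1..l}" "j \<in> {1..l}" for i j
  proof (cases "i = j")
    case False
    have "real (card (W i j)) * \<epsilon>\<^sup>2 \<le> (\<Sum>v\<in>W i j. q i v * q j v)"
      using assms unfolding power2_eq_square
      by (intro sum_bounded_below mult_mono) (auto simp: W_def)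
    also have "\<dots> \<le> real (m {i, j})" by (rule sum_q_q_le) (use ij False in \<open>auto simp: W_def\<close>)
    also have "\<dots> \<le> real sg" using m_le_sg ij False by simp
    finally show ?thesis using assms by (simp add: pos_le_divide_eq)
  qed (simp add: W_def)
  have "Hset \<epsilon> = (\<Union>i\<in>{1..l}. \<Union>j\<in>{1..l}. W i j)" by (auto simp: Hset_def W_def)
  then have "card (Hset \<epsilon>) \<le> (\<Sum>i\<in>{1..l}. card (\<Union>j\<in>{1..l}. W i j))"
    by (simp only:) (rule card_UN_le, simp)
  also have "\<dots> \<le> (\<Sum>i\<in>{1..l}. \<Sum>j\<in>{1..l}. card (W i j))"
    by (intro sum_mono card_UN_le) simp
  finally have "real (card (Hset \<epsilon>)) \<le> (\<Sum>i\<in>{1..l}. \<Sum>j\<in>{1..l}. real (card (W i j)))"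
    by (drule_tac of_nat_mono [where 'a = real]) simp
  also have "\<dots> \<le> (\<Sum>i\<in>{1..l}. \<Sum>j\<in>{1..l}. real sg / \<epsilon>\<^sup>2)" by (intro sum_mono W)
  finally show ?thesis by simp
qed

lemma Bset_disjoint:
  "\<lbrakk>j \<in> {1..l}; k \<in> {1..l}; j \<noteq> k\<rbrakk> \<Longrightarrow> Bset \<epsilon> j \<inter> Bset \<epsilon> k = {}"
  by (auto simp: Bset_def Hset_def)

text \<open>If no family reached \<epsilon> at \<open>v\<close>, the product of the
  \<open>1 - q k v\<close> would be at least 3/4, above the 1/2 forced by deletion.\<close>

lemma Bset_cover:
  assumes "real l * \<epsilon> \<le> 1 / 4"
  shows "{1..n} = Hset \<epsilon> \<union> (\<Union>k\<in>{1..l}. Bset \<epsilon> k)"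
proof -
  have "\<exists>k\<in>{1..l}. \<epsilon> \<le> q k v" if v: "v \<in> {1..n}" for v
  proof (rule ccontr)
    assume "\<not> (\<exists>k\<in>{1..l}. \<epsilon> \<le> q k v)"
    then have "(\<Sum>k\<in>{1..l}. q k v) \<le> (\<Sum>k\<in>{1..l}. \<epsilon>)" by (intro sum_mono) force
    also have "\<dots> \<le> 1 / 4" using assms by simp
    finally have "1 - 1 / 4 \<le> 1 - (\<Sum>k\<in>{1..l}. q k v)" by simp
    also have "\<dots> \<le> (\<Prod>k\<in>{1..l}. 1 - q k v)"
      by (rule one_minus_sum_le_prod) (use q_le_one in auto)
    also have "\<dots> \<le> 1 / 2" by (rule prod_one_minus_q_le [OF v])
    finally show False by simp
  qed
  moreover have "Hset \<epsilon> \<subseteq> {1..n}" by (auto simp: Hset_def)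
  ultimately show ?thesis by (auto simp: Bset_def)
qed

lemma deficit_Bset:
  assumes "real l * \<epsilon> \<le> 1 / 4" "\<epsilon> > 0" "k \<in> {1..l}" "v \<in> Bset \<epsilon> k"
  shows "1 - 2 * q k v \<le> 2 * (real l * \<epsilon>)"
proof -
  have "(\<Sum>j\<in>{1..l} - {k}. q j v) \<le> (\<Sum>j\<in>{1..l} - {k}. \<epsilon>)"
    by (intro sum_mono) (use assms in \<open>force simp: Bset_def Hset_def\<close>)
  also have "\<dots> = real (card ({1..l} - {k})) * \<epsilon>" by simp
  also have "\<dots> \<le> real l * \<epsilon>"
    using assms card_mono [of "{1..l}" "{1..l} - {k}"] by (intro mult_right_mono of_nat_mono) auto
  finally have S: "(\<Sum>j\<in>{1..l} - {k}. q j v) \<le> real l * \<epsilon>" .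
  have "1 - 2 * q k v \<le> 2 * (\<Sum>j\<in>{1..l} - {k}. q j v)"
    using S assms by (intro deficit_le) (auto simp: Bset_def)
  then show ?thesis using S by linarith
qed

lemma Pr_not_extend_Bset:
  assumes "real l * \<epsilon> \<le> 1 / 4" "\<epsilon> > 0" "k \<in> {1..l}" "D \<subseteq> Bset \<epsilon> k" "card D \<le> sg + 1"
  shows "Pr (F k) (\<lambda>G. G \<union> D \<notin> F k) \<le> 2 ^ (sg + 1) * real (sg + 1) * 2 * real l * \<epsilon>"
proof -
  have "finite D" using assms(4) by (rule finite_subset) (auto simp: Bset_def)
  then have "Pr (F k) (\<lambda>G. G \<union> D \<notin> F k) \<le> 2 ^ (sg + 1) * (real (sg + 1) * (2 * (real l * \<epsilon>)))"
    by (intro Pr_not_extend_le) (use assms deficit_Bset in auto)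
  then show ?thesis by (simp only: mult.assoc)
qed

text \<open>Pigeonhole over at most (sg + 1)^l vectors of trace sizes. At this stage a type is only
  known to have probability bounded below; that it is almost certain comes out later.\<close>

lemma popular_type:
  assumes trace: "\<And>j k G. \<lbrakk>j \<in> {1..l}; k \<in> {1..l}; j \<noteq> k; G \<in> F j\<rbrakk> \<Longrightarrow> card (G \<inter> B k) \<le> sg"
  obtains \<tau> where "\<And>j. j \<in> {1..l} \<Longrightarrow> 1 / real ((sg + 1) ^ l) \<le> Pr (F j) (typical B \<tau> j)"
proof -
  have "\<exists>t. 1 / real ((sg + 1) ^ l) \<le> Pr (F j) (\<lambda>G. \<forall>k\<in>{1..l} - {j}. card (G \<inter> B k) = t k)"
    if j: "j \<in> {1..l}" for j
  proof (rule ccontr)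
    assume no: "\<not> ?thesis"
    define T where "T = ({1..l} - {j}) \<rightarrow>\<^sub>E {..sg}"
    define ty where "ty G = restrict (\<lambda>k. card (G \<inter> B k)) ({1..l} - {j})" for G
    have T: "finite T" "T \<noteq> {}" by (auto simp: T_def finite_PiE PiE_eq_empty_iff)
    have tyT: "ty G \<in> T" if "G \<in> F j" for G
      using trace [OF j _ _ that] by (auto simp: ty_def T_def)
    have small: "real (card {G\<in>F j. ty G = t}) < real (card (F j)) / real ((sg + 1) ^ l)" if "t \<in> T" for t
    proof -
      have "{G\<in>F j. ty G = t} \<subseteq> {G\<in>F j. \<forall>k\<in>{1..l} - {j}. card (G \<inter> B k) = t k}"
        unfolding ty_def by (auto simp: restrict_def split: if_splits)
      then have "real (card {G\<in>F j. ty G = t}) \<le> real (card {G\<in>F j. \<forall>k\<in>{1..l} - {j}. card (G \<inter> B k) = t k})"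
        using finite_F [OF j] by (intro of_nat_mono card_mono) auto
      also have "\<dots> < real (card (F j)) / real ((sg + 1) ^ l)"
        using no card_F_pos [OF j] by (simp add: Pr_def not_le field_simps)
      finally show ?thesis .
    qed
    have "F j = (\<Union>t\<in>T. {G\<in>F j. ty G = t})" using tyT by auto
    then have "card (F j) \<le> (\<Sum>t\<in>T. card {G\<in>F j. ty G = t})"
      using card_UN_le [OF T(1), of "\<lambda>t. {G\<in>F j. ty G = t}"] by simp
    then have "real (card (F j)) \<le> (\<Sum>t\<in>T. real (card {G\<in>F j. ty G = t}))"
      by (drule_tac of_nat_mono [where 'a = real]) simp
    also have "\<dots> < (\<Sum>t\<in>T. real (card (F j)) / real ((sg + 1) ^ l))"
      by (rule sum_strict_mono) (use T small in auto)
    also have "\<dots> = real (card T) * (real (card (F j)) / real ((sg + 1) ^ l))" by simp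
    also have "\<dots> \<le> real ((sg + 1) ^ l) * (real (card (F j)) / real ((sg + 1) ^ l))"
    proof -
      have "card T = (sg + 1) ^ card ({1..l} - {j})" unfolding T_def by (subst card_PiE) (simp_all add: One_nat_def)
      also have "\<dots> \<le> (sg + 1) ^ l"
        using card_mono [of "{1..l}" "{1..l} - {j}"] by (intro power_increasing) auto
      finally show ?thesis by (intro mult_right_mono of_nat_mono) auto
    qed
    also have "\<dots> = real (card (F j))" by simp
    finally show False by simp
  qed
  then obtain \<tau> where "\<forall>j\<in>{1..l}. 1 / real ((sg + 1) ^ l) \<le>
      Pr (F j) (\<lambda>G. \<forall>k\<in>{1..l} - {j}. card (G \<inter> B k) = \<tau> j k)"
    using bchoice [of "{1..l}" "\<lambda>j t. 1 / real ((sg + 1) ^ l) \<le>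
      Pr (F j) (\<lambda>G. \<forall>k\<in>{1..l} - {j}. card (G \<inter> B k) = t k)"] by blast
  then show ?thesis by (intro that [of \<tau>]) (simp add: typical_def [abs_def])
qed

text \<open>Two independent members both have the chosen types with probability at least 1/K^2, and
  each of the two extensions by the other's trace fails with probability at most 1/(4 K^2). Some
  pair therefore extends in both directions, and its enlarged members share both traces.\<close>

lemma type_sum_le:
  assumes ij: "i \<in> {1..l}" "j \<in> {1..l}" "i \<noteq> j" and K: "K > 0"
    and B: "B i \<inter> B j = {}"
    and trace: "\<And>G. G \<in> F j \<Longrightarrow> card (G \<inter> B i) \<le> sg" "\<And>G. G \<in> F i \<Longrightarrow> card (G \<inter> B j) \<le> sg"
    and pop: "1 / K \<le> Pr (F i) (typical B \<tau> i)" "1 / K \<le> Pr (F j) (typical B \<tau> j)"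
    and ext: "\<And>k D. k \<in> {1..l} \<Longrightarrow> D \<subseteq> B k \<Longrightarrow> card D \<le> sg \<Longrightarrow>
                Pr (F k) (\<lambda>G. G \<union> D \<notin> F k) \<le> 1 / (4 * K\<^sup>2)"
  shows "\<tau> i j + \<tau> j i \<le> m {i, j}"
proof -
  define Ai where "Ai = {G\<in>F i. typical B \<tau> i G}"
  define Aj where "Aj = {G\<in>F j. typical B \<tau> j G}"
  define \<delta> where "\<delta> = 1 / (4 * K\<^sup>2)"
  have fin: "finite Ai" "finite Aj" using finite_F ij by (auto simp: Ai_def Aj_def)
  have pos: "real (card (F i)) > 0" "real (card (F j)) > 0" using card_F_pos ij by auto
  have A: "real (card (F i)) / K \<le> real (card Ai)" "real (card (F j)) / K \<le> real (card Aj)"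
    using pop pos unfolding Pr_def Ai_def Aj_def by (simp_all add: pos_le_divide_eq)
  have "\<exists>G\<in>Ai. \<exists>G'\<in>Aj. G \<union> (G' \<inter> B i) \<in> F i \<and> G' \<union> (G \<inter> B j) \<in> F j"
  proof (rule ccontr)
    assume no: "\<not> ?thesis"
    define S1 where "S1 = (SIGMA G':Aj. {G\<in>F i. G \<union> (G' \<inter> B i) \<notin> F i})"
    define S2 where "S2 = (SIGMA G:Ai. {G'\<in>F j. G' \<union> (G \<inter> B j) \<notin> F j})"
    have finS: "finite S1" "finite S2" using fin finite_F ij by (auto simp: S1_def S2_def)
    have "Ai \<times> Aj \<subseteq> prod.swap ` S1 \<union> S2"
    proof
      fix x assume "x \<in> Ai \<times> Aj"
      then obtain G G' where x: "x = (G, G')" "G \<in> Ai" "G' \<in> Aj" by auto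
      then have "(G', G) \<in> S1 \<or> (G, G') \<in> S2" using no by (auto simp: S1_def S2_def Ai_def Aj_def)
      then show "x \<in> prod.swap ` S1 \<union> S2" unfolding x by force
    qed
    then have "card (Ai \<times> Aj) \<le> card (prod.swap ` S1 \<union> S2)" using finS by (intro card_mono) auto
    also have "\<dots> \<le> card (prod.swap ` S1) + card S2" by (rule card_Un_le)
    also have "\<dots> \<le> card S1 + card S2" using card_image_le [OF finS(1), of prod.swap] by simp
    finally have "real (card (Ai \<times> Aj)) \<le> real (card S1 + card S2)" by (simp only: of_nat_le_iff)
    then have "real (card Ai * card Aj) \<le> real (card S1) + real (card S2)"
      by (simp only: card_cartesian_product of_nat_add)
    moreover have "real (card S1) \<le> real (card (F j)) * (\<delta> * real (card (F i)))"
    proof -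
      have "real (card S1) = (\<Sum>G'\<in>Aj. real (card {G\<in>F i. G \<union> (G' \<inter> B i) \<notin> F i}))"
        unfolding S1_def using fin finite_F ij by (subst card_SigmaI) auto
      also have "\<dots> \<le> real (card Aj) * (\<delta> * real (card (F i)))"
      proof (rule sum_bounded_above)
        fix G' assume "G' \<in> Aj"
        then have "Pr (F i) (\<lambda>G. G \<union> (G' \<inter> B i) \<notin> F i) \<le> \<delta>"
          unfolding \<delta>_def by (intro ext) (use ij trace in \<open>auto simp: Aj_def\<close>)
        then show "real (card {G\<in>F i. G \<union> (G' \<inter> B i) \<notin> F i}) \<le> \<delta> * real (card (F i))"
          using pos by (simp add: Pr_def divide_le_eq)
      qed
      also have "\<dots> \<le> real (card (F j)) * (\<delta> * real (card (F i)))"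
        using finite_F [OF ij(2)] K by (intro mult_right_mono of_nat_mono card_mono) (auto simp: Aj_def \<delta>_def)
      finally show ?thesis .
    qed
    moreover have "real (card S2) \<le> real (card (F i)) * (\<delta> * real (card (F j)))"
    proof -
      have "real (card S2) = (\<Sum>G\<in>Ai. real (card {G'\<in>F j. G' \<union> (G \<inter> B j) \<notin> F j}))"
        unfolding S2_def using fin finite_F ij by (subst card_SigmaI) auto
      also have "\<dots> \<le> real (card Ai) * (\<delta> * real (card (F j)))"
      proof (rule sum_bounded_above)
        fix G assume "G \<in> Ai"
        then have "Pr (F j) (\<lambda>G'. G' \<union> (G \<inter> B j) \<notin> F j) \<le> \<delta>"
          unfolding \<delta>_def by (intro ext) (use ij trace in \<open>auto simp: Ai_def\<close>)
        then show "real (card {G'\<in>F j. G' \<union> (G \<inter> B j) \<notin> F j}) \<le> \<delta> * real (card (F j))"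
          using pos by (simp add: Pr_def divide_le_eq)
      qed
      also have "\<dots> \<le> real (card (F i)) * (\<delta> * real (card (F j)))"
        using finite_F [OF ij(1)] K by (intro mult_right_mono of_nat_mono card_mono) (auto simp: Ai_def \<delta>_def)
      finally show ?thesis .
    qed
    moreover have "(real (card (F i)) / K) * (real (card (F j)) / K) \<le> real (card Ai * card Aj)"
      using A K by (simp only: of_nat_mult) (intro mult_mono, auto)
    moreover have "(real (card (F i)) / K) * (real (card (F j)) / K) = 4 * (\<delta> * (real (card (F i)) * real (card (F j))))"
      using K by (simp add: \<delta>_def power2_eq_square)
    moreover have "\<delta> * (real (card (F i)) * real (card (F j))) > 0" using pos K by (simp add: \<delta>_def)
    ultimately show False by (simp add: ac_simps)
  qed
  then obtain G G' where G: "G \<in> Ai" "G' \<in> Aj" "G \<union> (G' \<inter> B i) \<in> F i" "G' \<union> (G \<inter> B j) \<in> F j" by blast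
  have fG: "finite G" "finite G'" using G finite_mem ij by (auto simp: Ai_def Aj_def)
  have "\<tau> i j + \<tau> j i = card (G \<inter> B j) + card (G' \<inter> B i)"
    using G ij by (auto simp: Ai_def Aj_def typical_def)
  also have "\<dots> = card ((G \<inter> B j) \<union> (G' \<inter> B i))"
    by (rule card_Un_disjoint [symmetric]) (use fG B in auto)
  also have "\<dots> \<le> card ((G \<union> (G' \<inter> B i)) \<inter> (G' \<union> (G \<inter> B j)))"
    by (rule card_mono) (use fG in auto)
  also have "\<dots> \<le> m {i, j}" using card_Int_le ij G by blast
  finally show ?thesis .
qed

text \<open>Members of the chosen type form at least a proportion 1/K, so counting them by their
  traces bounds the whole family.\<close>

lemma card_F_le_popular:
  assumes j: "j \<in> {1..l}" and K: "K > 0" and pop: "1 / K \<le> Pr (F j) (typical B \<tau> j)"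
    and cover: "{1..n} - (B j \<union> H) = (\<Union>k\<in>{1..l} - {j}. B k)"
    and disj: "\<And>i k. i \<in> {1..l} \<Longrightarrow> k \<in> {1..l} \<Longrightarrow> i \<noteq> k \<Longrightarrow> B i \<inter> B k = {}"
    and fin: "finite H" "finite (B j)"
  shows "real (card (F j)) \<le> K * 2 ^ card H * (2 ^ card (B j) * real n ^ deg \<tau> j)"
proof -
  define \<O> where "\<O> = {G\<in>F j. typical B \<tau> j G}"
  have fin\<O>: "finite \<O>" using finite_F j by (auto simp: \<O>_def)
  have "card (G - (B j \<union> H)) = deg \<tau> j" if "G \<in> \<O>" for G
  proof -
    have "G \<subseteq> {1..n}" using that F_sub j by (auto simp: \<O>_def)
    then have "G - (B j \<union> H) = G \<inter> ({1..n} - (B j \<union> H))" by auto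
    also have "\<dots> = (\<Union>k\<in>{1..l} - {j}. G \<inter> B k)" unfolding cover by auto
    finally have "card (G - (B j \<union> H)) = card (\<Union>k\<in>{1..l} - {j}. G \<inter> B k)" by simp
    also have "\<dots> = (\<Sum>k\<in>{1..l} - {j}. card (G \<inter> B k))"
    proof (rule card_UN_disjoint)
      show "\<forall>k\<in>{1..l} - {j}. finite (G \<inter> B k)" using \<open>G \<subseteq> {1..n}\<close> finite_subset by blast
      show "\<forall>k\<in>{1..l} - {j}. \<forall>i\<in>{1..l} - {j}. k \<noteq> i \<longrightarrow> G \<inter> B k \<inter> (G \<inter> B i) = {}"
        using disj by fast
    qed simp
    also have "\<dots> = deg \<tau> j"
      unfolding deg_def by (rule sum.cong) (use that in \<open>auto simp: typical_def \<O>_def\<close>)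
    finally show ?thesis .
  qed
  then have "card ((\<lambda>G. G - (B j \<union> H)) ` \<O>) \<le> card {X. X \<subseteq> {1..n} \<and> card X = deg \<tau> j \<and> {} \<subseteq> X}"
    using F_sub j by (intro card_mono) (auto simp: \<O>_def)
  also have "\<dots> \<le> n ^ deg \<tau> j" using card_supersets_le [of "{1..n}" "deg \<tau> j" "{}"] by simp
  finally have "card \<O> \<le> 2 ^ card (B j \<union> H) * n ^ deg \<tau> j"
    using card_le_pow_times_traces [OF fin\<O>, of "B j \<union> H"] fin by (meson finite_UnI le_trans mult_le_mono2)
  also have "\<dots> \<le> 2 ^ (card (B j) + card H) * n ^ deg \<tau> j"
    using card_Un_le [of "B j" H] by (intro mult_right_mono power_increasing) auto
  finally have "real (card \<O>) \<le> real (2 ^ (card (B j) + card H) * n ^ deg \<tau> j)" by (simp only: of_nat_le_iff)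
  moreover have "real (card (F j)) \<le> K * real (card \<O>)"
    using pop card_F_pos [OF j] K unfolding Pr_def \<O>_def [symmetric]
    by (simp add: divide_le_eq pos_le_divide_eq mult.commute)
  ultimately have "real (card (F j)) \<le> K * real (2 ^ (card (B j) + card H) * n ^ deg \<tau> j)"
    using K by (meson mult_left_mono less_imp_le order_trans)
  then show ?thesis by (simp add: power_add ac_simps)
qed

end

lemma (in overlap_problem) structured_exists:
  obtains C :: nat where "C \<ge> 1"
    "\<forall>\<^sub>F n in sequentially. \<forall>F. extremal n l m F \<longrightarrow> (\<exists>H B \<tau>. structured n l m F C H B \<tau>)"
proof -
  define K :: real where "K = real ((sg + 1) ^ l)"
  have K1: "K \<ge> 1" by (simp add: K_def)
  \<comment> \<open>\<open>M * \<epsilon>\<close> will bound the probability that adding up to sg +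
    1 owned vertices fails; sg + 1 because a set of \<open>m {j, k} + 1\<close> vertices has to be
    excluded below.\<close>
  define M :: real where "M = 2 ^ (sg + 1) * real (sg + 1) * 2 * real l"
  have lM: "real l \<le> M"
  proof -
    have "1 * 1 * 1 * real l \<le> M" unfolding M_def by (intro mult_mono) auto
    then show ?thesis by simp
  qed
  then have M1: "M \<ge> 1" using l_ge by linarith
  \<comment> \<open>Makes \<open>M * \<epsilon>\<close> equal to 1/(4 K^2), the failure rate
    tolerated by \<open>type_sum_le\<close>; it is also at most a quarter of the probability 1/K of
    the chosen type.\<close>
  define \<epsilon> :: real where "\<epsilon> = 1 / (4 * K\<^sup>2 * M)"
  have eps: "\<epsilon> > 0" using K1 M1 by (simp add: \<epsilon>_def)
  have Meps: "M * \<epsilon> = 1 / (4 * K\<^sup>2)" using M1 by (simp add: \<epsilon>_def)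
  have K2: "K\<^sup>2 \<ge> K" using K1 by (simp add: power2_eq_square)
  have Meps_le: "M * \<epsilon> \<le> 1 / (4 * K)" unfolding Meps using K1 K2 by (intro divide_left_mono) auto
  have K4: "1 / (4 * K) \<le> 1 / 4" using K1 by (simp add: divide_simps)
  have leps: "real l * \<epsilon> \<le> 1 / 4"
  proof -
    have "real l * \<epsilon> \<le> M * \<epsilon>" using lM eps by (intro mult_right_mono) auto
    then show ?thesis using Meps_le K4 by linarith
  qed
  obtain c :: real where c: "c > 0" and
    lower: "\<And>n. n \<ge> 2 * card (pairs l) * sg \<Longrightarrow> c * 2 ^ n * real n ^ sg \<le> real (s_star n l m)"
    using s_star_lower_bound [OF weight_pos] unfolding sg_def by metis
  define h where "h = nat \<lceil>real l * (real l * (real sg / \<epsilon>\<^sup>2))\<rceil>"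
  define Q :: real where "Q = (K * 2 ^ h) ^ l"
  have Kh: "K * 2 ^ h \<ge> 1"
  proof -
    have "1 * 1 \<le> K * 2 ^ h" using K1 by (intro mult_mono) auto
    then show ?thesis by simp
  qed
  then have Q1: "Q \<ge> 1" unfolding Q_def by (rule one_le_power)
  define C where "C = nat \<lceil>Q / c + real h + 1 / \<epsilon> + 2 * K\<rceil>"
  have "Q / c \<ge> 0" "1 / \<epsilon> \<ge> 0" using Q1 c eps by auto
  moreover have CC: "real C \<ge> Q / c + real h + 1 / \<epsilon> + 2 * K" unfolding C_def by (rule real_nat_ceiling_ge)
  ultimately have C: "real C \<ge> Q / c" "C \<ge> h" "real C \<ge> 1 / \<epsilon>" "real C \<ge> 2 * K" using K1 by linarith+
  have Cinv: "1 / real C \<le> \<epsilon>"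
    using C(3,4) eps K1 by (simp add: divide_le_eq mult.commute)
  have Cinv2: "1 / real C \<le> 1 / (2 * K)" using C(4) K1 by (intro divide_left_mono) auto
  have main: "\<exists>H B \<tau>. structured n l m F C H B \<tau>"
    if n: "n \<ge> 2 * card (pairs l) * sg" "n \<ge> 1" "real n > Q / c" and ex: "extremal n l m F" for n F
  proof -
    interpret extremal_problem n l m F by unfold_locales (rule ex)
    define H where "H = Hset \<epsilon>"
    define B where "B = Bset \<epsilon>"
    have card_H: "card H \<le> h"
    proof -
      have "real (card H) \<le> real h"
        unfolding H_def h_def using card_Hset_le [OF eps] real_nat_ceiling_ge order_trans by blast
      then show ?thesis by simp
    qed
    have B_sub: "B k \<subseteq> {1..n} - H" for k by (auto simp: B_def H_def Bset_def)
    have H_sub: "H \<subseteq> {1..n}" by (auto simp: H_def Hset_def)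
    have fin: "finite H" "finite (B k)" for k using B_sub H_sub finite_subset by blast+
    have disj: "B j \<inter> B k = {}" if "j \<in> {1..l}" "k \<in> {1..l}" "j \<noteq> k" for j k
      unfolding B_def by (rule Bset_disjoint [OF that])
    have cover: "{1..n} = H \<union> (\<Union>k\<in>{1..l}. B k)" unfolding H_def B_def by (rule Bset_cover [OF leps])
    have ext: "Pr (F k) (\<lambda>G. G \<union> D \<notin> F k) \<le> M * \<epsilon>"
      if "k \<in> {1..l}" "D \<subseteq> B k" "card D \<le> sg + 1" for k D
      using Pr_not_extend_Bset [OF leps eps, of k D] that unfolding M_def B_def by simp
    have small_mem: "D \<in> F k" if k: "k \<in> {1..l}" and D: "D \<subseteq> B k" "card D \<le> sg + 1" for k D
    proof -
      have "Pr (F k) (\<lambda>G. \<not> G \<union> D \<notin> F k) = 1 - Pr (F k) (\<lambda>G. G \<union> D \<notin> F k)"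
        by (rule Pr_compl) (use finite_F F_nonempty k in auto)
      then have "Pr (F k) (\<lambda>G. \<not> G \<union> D \<notin> F k) > 0" using ext [OF k D] Meps_le K4 by linarith
      then have "card {G\<in>F k. \<not> G \<union> D \<notin> F k} \<noteq> 0" unfolding Pr_def by (intro notI) simp
      then have "{G\<in>F k. \<not> G \<union> D \<notin> F k} \<noteq> {}" by (metis card.empty)
      then obtain G where "G \<union> D \<in> F k" by auto
      then show ?thesis using downset [OF k] by blast
    qed
    \<comment> \<open>Up to sg + 1 vertices of \<open>B k\<close> always form a member of
      \<open>F k\<close>, so \<open>m {j, k} + 1\<close> vertices of \<open>G\<close> in
      \<open>B k\<close> would themselves be a conflicting member.\<close>
    have trace: "card (G \<inter> B k) \<le> m {j, k}" if jk: "j \<in> {1..l}" "k \<in> {1..l}" "j \<noteq> k" "G \<in> F j" for j k G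
    proof (rule ccontr)
      assume "\<not> ?thesis"
      then have "m {j, k} + 1 \<le> card (G \<inter> B k)" by simp
      then obtain D where D: "D \<subseteq> G \<inter> B k" "card D = m {j, k} + 1"
        by (rule obtain_subset_with_card_n)
      have "D \<subseteq> B k" "card D \<le> sg + 1" using D m_le_sg [OF jk(1-3)] by auto
      then have "D \<in> F k" by (rule small_mem [OF jk(2)])
      then have "card (G \<inter> D) \<le> m {j, k}" using card_Int_le jk by blast
      moreover have "G \<inter> D = D" using D by auto
      ultimately show False using D by simp
    qed
    have trace_sg: "card (G \<inter> B k) \<le> sg" if "j \<in> {1..l}" "k \<in> {1..l}" "j \<noteq> k" "G \<in> F j" for j k G
      using trace [OF that] m_le_sg [OF that(1-3)] by linarith
    obtain \<tau> where pop: "\<And>j. j \<in> {1..l} \<Longrightarrow> 1 / K \<le> Pr (F j) (typical B \<tau> j)"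
      unfolding K_def using popular_type [of B] trace_sg by blast
    have tsum_le: "\<tau> i j + \<tau> j i \<le> m {i, j}" if "i \<in> {1..l}" "j \<in> {1..l}" "i \<noteq> j" for i j
      by (rule type_sum_le [of i j K B]) (use that K1 disj trace_sg pop ext Meps in auto)
    define b where "b j = card (B j)" for j
    have sum_b: "(\<Sum>j\<in>{1..l}. b j) \<le> n"
    proof -
      have "(\<Sum>j\<in>{1..l}. b j) = card (\<Union>j\<in>{1..l}. B j)"
        unfolding b_def by (rule card_UN_disjoint [symmetric]) (use fin disj in auto)
      also have "\<dots> \<le> card {1..n}" using B_sub by (intro card_mono) auto
      finally show ?thesis by simp
    qed
    have cov: "{1..n} - (B j \<union> H) = (\<Union>k\<in>{1..l} - {j}. B k)" if "j \<in> {1..l}" for j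
    proof
      show "{1..n} - (B j \<union> H) \<subseteq> (\<Union>k\<in>{1..l} - {j}. B k)" using cover by auto
      show "(\<Union>k\<in>{1..l} - {j}. B k) \<subseteq> {1..n} - (B j \<union> H)"
        using B_sub disj [OF that] by fast
    qed
    have Fle: "real (card (F j)) \<le> (K * 2 ^ h) * (2 ^ b j * real n ^ deg \<tau> j)" if "j \<in> {1..l}" for j
    proof -
      have "real (card (F j)) \<le> K * 2 ^ card H * (2 ^ b j * real n ^ deg \<tau> j)"
        unfolding b_def by (rule card_F_le_popular) (use that K1 pop cov disj fin in auto)
      also have "\<dots> \<le> K * 2 ^ h * (2 ^ b j * real n ^ deg \<tau> j)"
        using card_H K1 by (intro mult_right_mono mult_left_mono power_increasing) auto
      finally show ?thesis .
    qed
    have prodF: "(\<Prod>j\<in>A. real (card (F j))) \<le> Q * (2 ^ (\<Sum>j\<in>A. b j) * real n ^ (\<Sum>j\<in>A. deg \<tau> j))"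
      if "A \<subseteq> {1..l}" for A
    proof -
      have "(\<Prod>j\<in>A. real (card (F j))) \<le> (\<Prod>j\<in>A. (K * 2 ^ h) * (2 ^ b j * real n ^ deg \<tau> j))"
        by (intro prod_mono) (use Fle that in auto)
      also have "\<dots> = (K * 2 ^ h) ^ card A * (2 ^ (\<Sum>j\<in>A. b j) * real n ^ (\<Sum>j\<in>A. deg \<tau> j))"
        by (simp add: prod.distrib power_sum)
      also have "\<dots> \<le> Q * (2 ^ (\<Sum>j\<in>A. b j) * real n ^ (\<Sum>j\<in>A. deg \<tau> j))"
        unfolding Q_def using Kh card_mono [OF _ that] by (intro mult_right_mono power_increasing) auto
      finally show ?thesis .
    qed
    have low: "c * 2 ^ n * real n ^ sg \<le> (\<Prod>j\<in>{1..l}. real (card (F j)))"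
      using lower [OF n(1)] unfolding prod_card [symmetric] by simp
    \<comment> \<open>Strict inequality for one pair lowers the total degree below
      \<open>sg\<close>, and the upper bound on the product then falls behind the explicit example
      by a factor n.\<close>
    have tsum: "\<tau> i j + \<tau> j i = m {i, j}" if ij: "i \<in> {1..l}" "j \<in> {1..l}" "i \<noteq> j" for i j
    proof (rule ccontr)
      assume "\<tau> i j + \<tau> j i \<noteq> m {i, j}"
      then have lt: "\<tau> i j + \<tau> j i < m {i, j}" using tsum_le [OF ij] by simp
      have "(\<Sum>j\<in>{1..l}. deg \<tau> j) < sg"
        unfolding deg_def sum_offdiag sg_def sum_pairs
      proof (rule sum_strict_mono_ex1)
        show "\<forall>x\<in>ordpairs l. (case x of (j, k) \<Rightarrow> \<tau> j k + \<tau> k j) \<le> (case x of (j, k) \<Rightarrow> m {j, k})"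
          using tsum_le by (auto simp: ordpairs_def)
        have "(i, j) \<in> ordpairs l \<or> (j, i) \<in> ordpairs l" using ij by (auto simp: ordpairs_def)
        then show "\<exists>x\<in>ordpairs l. (case x of (j, k) \<Rightarrow> \<tau> j k + \<tau> k j) < (case x of (j, k) \<Rightarrow> m {j, k})"
          using lt by (auto simp: insert_commute add.commute intro: bexI [of _ "(i, j)"] bexI [of _ "(j, i)"])
      qed simp
      then have lt: "(\<Sum>j\<in>{1..l}. deg \<tau> j) + 1 \<le> sg" by simp
      have "c * 2 ^ n * real n ^ sg \<le> Q * (2 ^ (\<Sum>j\<in>{1..l}. b j) * real n ^ (\<Sum>j\<in>{1..l}. deg \<tau> j))"
        by (rule order_trans [OF low prodF]) simp
      also have "\<dots> \<le> Q * (2 ^ n * real n ^ (sg - 1))"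
        using Q1 sum_b lt n(2) by (intro mult_left_mono mult_mono power_increasing) auto
      finally have "c * 2 ^ n * (real n ^ (sg - 1) * real n) \<le> Q * (2 ^ n * real n ^ (sg - 1))"
        using power_minus_mult [of sg "real n"] sg_pos by simp
      then have "(c * real n) * (2 ^ n * real n ^ (sg - 1)) \<le> Q * (2 ^ n * real n ^ (sg - 1))"
        by (simp only: ac_simps)
      then have "c * real n \<le> Q" using n(2) by (subst (asm) mult_le_cancel_right) auto
      then show False using n(3) c by (simp add: divide_less_eq mult.commute)
    qed
    have sumdeg: "(\<Sum>j\<in>{1..l}. deg \<tau> j) = sg" by (rule sum_deg) (rule tsum)
    have "structured n l m F C H B \<tau>"
    proof unfold_locales
      fix j assume j: "j \<in> {1..l}"
      define s where "s = (\<Sum>i\<in>{1..l} - {j}. b i)"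
      define t where "t = (\<Sum>i\<in>{1..l} - {j}. deg \<tau> i)"
      have st: "s + b j \<le> n" "t + deg \<tau> j = sg"
        using sum_b sumdeg j by (simp_all add: s_def t_def sum.remove [of "{1..l}" j])
      \<comment> \<open>Dividing the lower bound on the whole product by the upper bounds on the
        other families leaves a lower bound of the right order for the single family
        \<open>F j\<close>.\<close>
      have "(c * 2 ^ b j * real n ^ deg \<tau> j) * (2 ^ s * real n ^ t) = c * 2 ^ (s + b j) * real n ^ sg"
        unfolding st(2) [symmetric] by (simp add: power_add)
      also have "\<dots> \<le> c * 2 ^ n * real n ^ sg"
        using st(1) c by (intro mult_right_mono mult_left_mono power_increasing) auto
      also have "\<dots> \<le> real (card (F j)) * (\<Prod>i\<in>{1..l} - {j}. real (card (F i)))"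
        using low j by (simp add: prod.remove [of "{1..l}" j])
      also have "\<dots> \<le> real (card (F j)) * (Q * (2 ^ s * real n ^ t))"
        using prodF [of "{1..l} - {j}"] by (intro mult_left_mono) (auto simp: s_def t_def)
      finally have "(c * 2 ^ b j * real n ^ deg \<tau> j) * (2 ^ s * real n ^ t) \<le>
          (Q * real (card (F j))) * (2 ^ s * real n ^ t)" by (simp add: ac_simps)
      then have "c * 2 ^ b j * real n ^ deg \<tau> j \<le> Q * real (card (F j))"
        using n(2) by (subst (asm) mult_le_cancel_right) auto
      then have "2 ^ b j * real n ^ deg \<tau> j \<le> (Q / c) * real (card (F j))"
        using c by (simp add: pos_le_divide_eq ac_simps)
      also have "\<dots> \<le> real C * real (card (F j))" using C(1) by (intro mult_right_mono) auto
      finally have "real (2 ^ card (B j) * n ^ deg \<tau> j) \<le> real (C * card (F j))" by (simp add: b_def)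
      then show "2 ^ card (B j) * n ^ deg \<tau> j \<le> C * card (F j)" by (simp only: of_nat_le_iff)
    next
      fix k D assume k: "k \<in> {1..l}" and D: "D \<subseteq> B k" "card D \<le> sg"
      have "1 / K \<le> Pr (F k) (\<lambda>G. typical B \<tau> k G \<and> \<not> G \<union> D \<notin> F k) + Pr (F k) (\<lambda>G. G \<union> D \<notin> F k)"
        using pop [OF k] Pr_diff_le [OF finite_F [OF k], of "typical B \<tau> k" "\<lambda>G. G \<union> D \<notin> F k"] by linarith
      then have "1 / K - 1 / (4 * K) \<le> Pr (F k) (\<lambda>G. typical B \<tau> k G \<and> G \<union> D \<in> F k)"
        using ext [OF k D(1)] D(2) Meps_le by simp
      moreover have "1 / (2 * K) \<le> 1 / K - 1 / (4 * K)" using K1 by (simp add: field_simps)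
      ultimately show "1 / real C \<le> Pr (F k) (\<lambda>G. typical B \<tau> k G \<and> G \<union> D \<in> F k)"
        using Cinv2 by linarith
    next
      fix v assume "v \<in> H"
      then show "\<exists>i\<in>{1..l}. \<exists>j\<in>{1..l}. i \<noteq> j \<and> 1 / real C \<le> q i v \<and> 1 / real C \<le> q j v"
        using Cinv unfolding H_def Hset_def by (force intro: order_trans)
    qed (use n card_H C B_sub H_sub disj cover trace tsum in auto)
    then show ?thesis by blast
  qed
  obtain N :: nat where N: "real N > Q / c" using reals_Archimedean2 by blast
  have "\<forall>\<^sub>F n in sequentially. n \<ge> 2 * card (pairs l) * sg + 1 + N" by (rule eventually_ge_at_top)
  then have "\<forall>\<^sub>F n in sequentially. \<forall>F. extremal n l m F \<longrightarrow> (\<exists>H B \<tau>. structured n l m F C H B \<tau>)"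
  proof eventually_elim
    case (elim n)
    then have "real n \<ge> real N" by simp
    then have "real n > Q / c" using N by linarith
    then show ?case using main [of n] elim by auto
  qed
  moreover have "C \<ge> 1" using C(4) K1 by linarith
  ultimately show ?thesis by (rule that [rotated])
qed

lemma real_div_le: "real (n div D) \<le> real n / real D"
proof (cases "D = 0")
  case False
  have "real (n div D * D) \<le> real n" by (simp only: of_nat_le_iff div_times_less_eq_dividend)
  then show ?thesis using False by (simp add: pos_le_divide_eq)
qed simp

section \<open>Rare members and the disappearance of the exceptional set\<close>

context overlap_problem
begin

text \<open>The left side is the bound of \<open>Pr_killed_le\<close> with R = n div D. The exponent
  sg + 3 leaves one power of n to spare when up to sg + 2 vertices are prescribed.\<close>

definition decays :: "nat \<Rightarrow> nat \<Rightarrow> nat \<Rightarrow> bool" where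
  "decays C n D \<longleftrightarrow>
     (real C * 2 ^ C * real (sg + 1)) * (1 - 1 / 2 ^ sg) ^ (n div D) * real n ^ sg \<le> 1 / real n ^ (sg + 3)"

text \<open>Has to exceed \<open>sg\<close> times the concentration constant c of
  \<open>killed_of_Pr\<close>, which is C^2 2^C for heavy members and twice that for members through
  \<open>H\<close>.\<close>

definition D0 :: "nat \<Rightarrow> nat" where "D0 C = 2 * sg * C * C * 2 ^ C + 1"

text \<open>Sum of the typical, light and heavy contributions to the probability of containing a
  prescribed set.\<close>

definition C1 :: "nat \<Rightarrow> real" where "C1 C = (real sg + 1) * (real C * 2 ^ C) + 1"

definition C2 :: "nat \<Rightarrow> real" where "C2 C = 2 * real l * C1 C"

definition C3 :: "nat \<Rightarrow> real" where "C3 C = 2 ^ sg * real sg * C2 C"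

lemma eventually_decays:
  assumes "D > 0"
  shows "\<forall>\<^sub>F n in sequentially. decays C n D"
proof -
  have "(2::real) ^ sg > 1" using sg_pos by (simp add: one_less_power)
  then show ?thesis unfolding decays_def
    by (intro eventually_geometric_le assms) (simp_all add: divide_less_eq)
qed

lemma C1_pos: "C1 C \<ge> 1"
  by (simp add: C1_def)

end

context structured
begin

lemma Pr_killed_small:
  assumes "i \<in> {1..l}" "decays C n D" "\<And>G. G \<in> F i \<Longrightarrow> P G \<Longrightarrow> killed (n div D) i (G - B i)"
  shows "Pr (F i) P \<le> 1 / real n ^ (sg + 3)"
proof -
  have "Pr (F i) P \<le> (real C * 2 ^ C * real (sg + 1)) * (1 - 1 / 2 ^ sg) ^ (n div D) * real n ^ sg"
    by (rule Pr_killed_le [OF assms(1)]) (rule assms(3))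
  then show ?thesis using assms(2) unfolding decays_def by linarith
qed

text \<open>Probabilistic form of \<open>killedI\<close>: given \<open>P\<close>, a vertex of
  \<open>B i\<close> is contained with probability at most about c/n, so a set hitting all traces
  needs about n/c vertices. The condition \<open>D > sg * c\<close> keeps
  \<open>sg * (n div D)\<close> below that number.\<close>

lemma killed_of_Pr:
  assumes ij: "i \<in> {1..l}" "j \<in> {1..l}" "i \<noteq> j" and X: "X \<inter> B i = {}" "finite X"
    and \<theta>: "\<theta> > 0" "\<theta> \<le> Pr (F j) P"
    and P: "\<And>G. G \<in> F j \<Longrightarrow> P G \<Longrightarrow> G \<union> (X \<inter> B j) \<in> F j \<and>
        m {i, j} < card (G \<inter> B i) + card (X \<inter> (G \<union> (X \<inter> B j)))"
    and spread: "\<And>u. u \<in> B i \<Longrightarrow> Pr (F j) (\<lambda>G. P G \<and> u \<in> G) \<le> c * \<theta> / real n"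
    and D: "real sg * c < real D" and c: "c \<ge> 0"
  shows "killed (n div D) i X"
proof (rule killedI [OF ij X, where \<G> = "{G\<in>F j. P G}"])
  have Fj: "real (card (F j)) > 0" using card_F_pos ij by simp
  have D0: "real D > 0" using D c by (meson le_less_trans mult_nonneg_nonneg of_nat_0_le_iff)
  have big: "\<theta> * real (card (F j)) \<le> real (card {G\<in>F j. P G})"
    using \<theta>(2) Fj by (simp add: Pr_def pos_le_divide_eq)
  moreover have "\<theta> * real (card (F j)) > 0" using \<theta>(1) Fj by simp
  ultimately have "card {G\<in>F j. P G} > 0" by linarith
  then show "{G\<in>F j. P G} \<noteq> {}" by (metis card.empty less_irrefl)
  show "card {G \<in> {G \<in> F j. P G}. u \<in> G} * (sg * (n div D)) < card {G \<in> F j. P G}" if u: "u \<in> B i" for u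
  proof -
    have "real (card {G \<in> F j. P G \<and> u \<in> G}) \<le> c * \<theta> / real n * real (card (F j))"
      using spread [OF u] Fj by (simp add: Pr_def pos_divide_le_eq)
    then have "real (card {G \<in> F j. P G \<and> u \<in> G}) * (real sg * real (n div D)) \<le>
        (c * \<theta> / real n * real (card (F j))) * (real sg * (real n / real D))"
      using real_div_le [of n D] c \<theta> by (intro mult_mono mult_left_mono) auto
    also have "\<dots> = (real sg * c / real D) * (\<theta> * real (card (F j)))"
      using n_pos by simp
    also have "\<dots> < 1 * (\<theta> * real (card (F j)))"
      using D D0 \<open>\<theta> * real (card (F j)) > 0\<close> by (intro mult_strict_right_mono) (auto simp: divide_less_eq)
    also have "\<dots> \<le> real (card {G\<in>F j. P G})" using big by simp
    finally have "real (card {G \<in> F j. P G \<and> u \<in> G} * (sg * (n div D))) < real (card {G \<in> F j. P G})" by simp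
    then show ?thesis by (simp only: of_nat_less_iff) simp
  qed
qed (use P in auto)

text \<open>A typical member of \<open>F k\<close> has \<open>\<tau> k j\<close> vertices in
  \<open>B j\<close>; if it also absorbs the more than \<open>\<tau> j k\<close> vertices of
  \<open>X \<inter> B k\<close>, its trace on \<open>B j\<close> is excluded from the link of
  \<open>X\<close>. Such members are frequent and spread out, so \<open>X\<close> is killed.\<close>

lemma Pr_heavy_le:
  assumes j: "j \<in> {1..l}" and dec: "decays C n (D0 C)"
  shows "Pr (F j) (heavy B \<tau> j) \<le> 1 / real n ^ (sg + 3)"
proof (rule Pr_killed_small [OF j dec])
  fix G assume G: "G \<in> F j" and "heavy B \<tau> j G"
  then obtain k where k: "k \<in> {1..l}" "k \<noteq> j" "\<tau> j k < card (G \<inter> B k)" by (auto simp: heavy_def)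
  define X where "X = G - B j"
  have Xk: "X \<inter> B k = G \<inter> B k" using B_disj [OF j k(1)] k(2) by (auto simp: X_def)
  have finX: "finite X" using G finite_mem j by (auto simp: X_def)
  have small: "card (X \<inter> B k) \<le> sg"
    unfolding Xk using card_trace_le [OF j k(1) _ G] m_le_sg [OF j k(1)] k(2) by linarith
  show "killed (n div D0 C) j (G - B j)" unfolding X_def [symmetric]
  proof (rule killed_of_Pr [where j = k and \<theta> = "1 / real C" and c = "real C * real C * 2 ^ C" and
        P = "\<lambda>G'. typical B \<tau> k G' \<and> G' \<union> (X \<inter> B k) \<in> F k"])
    show "1 / real C \<le> Pr (F k) (\<lambda>G'. typical B \<tau> k G' \<and> G' \<union> X \<inter> B k \<in> F k)"
      by (rule typical_ext) (use k small in auto)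
    show "G' \<union> X \<inter> B k \<in> F k \<and> m {j, k} < card (G' \<inter> B j) + card (X \<inter> (G' \<union> X \<inter> B k))"
      if G': "G' \<in> F k" "typical B \<tau> k G' \<and> G' \<union> X \<inter> B k \<in> F k" for G'
    proof -
      have "card (G' \<inter> B j) = \<tau> k j" using G' j k by (auto simp: typical_def)
      moreover have "card (X \<inter> B k) \<le> card (X \<inter> (G' \<union> X \<inter> B k))" using finX by (intro card_mono) auto
      ultimately show ?thesis using G' type_sum [OF j k(1)] k(2,3) Xk by auto
    qed
    show "Pr (F k) (\<lambda>G'. (typical B \<tau> k G' \<and> G' \<union> X \<inter> B k \<in> F k) \<and> u \<in> G') \<le>
        real C * real C * 2 ^ C * (1 / real C) / real n" if u: "u \<in> B j" for u
    proof -
      have "Pr (F k) (\<lambda>G'. (typical B \<tau> k G' \<and> G' \<union> X \<inter> B k \<in> F k) \<and> u \<in> G') \<le>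
         Pr (F k) (\<lambda>G'. {u} \<subseteq> G' \<and> typical B \<tau> k G')"
        by (rule Pr_mono) (use finite_F k in auto)
      also have "\<dots> \<le> real C * 2 ^ C / real n ^ card {u}"
        by (rule Pr_typical_le) (use k u B_sub [OF j] B_disj [OF j k(1)] in auto)
      finally show ?thesis using C_pos by simp
    qed
    have "real sg * (real C * real C * 2 ^ C) < real (2 * sg * C * C * 2 ^ C + 1)"
    proof -
      have "sg * (C * C * 2 ^ C) < 2 * sg * C * C * 2 ^ C + 1" by (simp add: ac_simps)
      then have "real (sg * (C * C * 2 ^ C)) < real (2 * sg * C * C * 2 ^ C + 1)" by (simp only: of_nat_less_iff)
      then show ?thesis by simp
    qed
    then show "real sg * (real C * real C * 2 ^ C) < real (D0 C)" by (simp only: D0_def)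
  qed (use j k finX C_pos in \<open>auto simp: X_def\<close>)
qed

lemma Pr_atypical_le:
  assumes j: "j \<in> {1..l}" and R: "R \<inter> (B j \<union> H) = {}" "finite R" "card R \<le> sg + 2" and dec: "decays C n (D0 C)"
  shows "Pr (F j) (\<lambda>G. R \<subseteq> G \<and> \<not> typical B \<tau> j G) \<le> C1 C / real n ^ (card R + 1)"
proof -
  have "Pr (F j) (\<lambda>G. R \<subseteq> G \<and> \<not> typical B \<tau> j G) \<le>
     Pr (F j) (\<lambda>G. (R \<subseteq> G \<and> \<not> heavy B \<tau> j G \<and> \<not> typical B \<tau> j G) \<or> heavy B \<tau> j G)"
    by (rule Pr_mono) (use finite_F j in auto)
  also have "\<dots> \<le> Pr (F j) (\<lambda>G. R \<subseteq> G \<and> \<not> heavy B \<tau> j G \<and> \<not> typical B \<tau> j G) + Pr (F j) (heavy B \<tau> j)"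
    by (rule Pr_disj) (use finite_F j in auto)
  also have "\<dots> \<le> real sg * (real C * 2 ^ C) / real n ^ (card R + 1) + 1 / real n ^ (sg + 3)"
    by (intro add_mono Pr_light_le Pr_heavy_le j R dec)
  also have "1 / real n ^ (sg + 3) \<le> 1 / real n ^ (card R + 1)"
    using R n_pos by (intro divide_left_mono power_increasing) auto
  also have "real sg * (real C * 2 ^ C) / real n ^ (card R + 1) + 1 / real n ^ (card R + 1) =
      (real sg * (real C * 2 ^ C) + 1) / real n ^ (card R + 1)" by (simp add: add_divide_distrib)
  also have "\<dots> \<le> C1 C / real n ^ (card R + 1)"
    by (intro divide_right_mono) (auto simp: C1_def algebra_simps)
  finally show ?thesis by simp
qed

lemma Pr_contains_le:
  assumes j: "j \<in> {1..l}" and R: "R \<inter> (B j \<union> H) = {}" "finite R" "card R \<le> sg + 2" and dec: "decays C n (D0 C)"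
  shows "Pr (F j) (\<lambda>G. R \<subseteq> G) \<le> C1 C / real n ^ card R"
proof -
  have "Pr (F j) (\<lambda>G. R \<subseteq> G) \<le>
     Pr (F j) (\<lambda>G. (R \<subseteq> G \<and> typical B \<tau> j G) \<or> (R \<subseteq> G \<and> \<not> heavy B \<tau> j G \<and> \<not> typical B \<tau> j G) \<or> heavy B \<tau> j G)"
    by (rule Pr_mono) (use finite_F j in auto)
  also have "\<dots> \<le> Pr (F j) (\<lambda>G. R \<subseteq> G \<and> typical B \<tau> j G) +
      (Pr (F j) (\<lambda>G. R \<subseteq> G \<and> \<not> heavy B \<tau> j G \<and> \<not> typical B \<tau> j G) + Pr (F j) (heavy B \<tau> j))"
    using Pr_disj [OF finite_F [OF j]] by (intro order_trans [OF Pr_disj [OF finite_F [OF j]]] add_mono) auto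
  also have "\<dots> \<le> real C * 2 ^ C / real n ^ card R +
      (real sg * (real C * 2 ^ C) / real n ^ (card R + 1) + 1 / real n ^ (sg + 3))"
    by (intro add_mono Pr_light_le Pr_heavy_le Pr_typical_le j R dec)
  also have "\<dots> \<le> real C * 2 ^ C / real n ^ card R +
      (real sg * (real C * 2 ^ C) / real n ^ card R + 1 / real n ^ card R)"
    using R n_pos by (intro add_mono divide_left_mono power_increasing order_refl) auto
  also have "\<dots> = C1 C / real n ^ card R" by (simp add: C1_def add_divide_distrib distrib_right)
  finally show ?thesis .
qed

lemma q_le:
  assumes "j \<in> {1..l}" "v \<notin> B j \<union> H" "decays C n (D0 C)"
  shows "q j v \<le> C1 C / real n"
  using Pr_contains_le [of j "{v}"] assms by (simp add: q_def)

lemma deficit_B_le: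
  assumes k: "k \<in> {1..l}" and v: "v \<in> B k" and dec: "decays C n (D0 C)" and n: "real l * C1 C / real n \<le> 1 / 2"
  shows "1 - 2 * q k v \<le> C2 C / real n"
proof -
  have "(\<Sum>j\<in>{1..l} - {k}. q j v) \<le> (\<Sum>j\<in>{1..l} - {k}. C1 C / real n)"
    by (intro sum_mono q_le dec) (use k v B_disj B_sub in blast)+
  also have "\<dots> \<le> (\<Sum>j\<in>{1..l}. C1 C / real n)"
    using C1_pos [of C] by (intro sum_mono2) auto
  also have "\<dots> = real l * C1 C / real n" by simp
  finally have S: "(\<Sum>j\<in>{1..l} - {k}. q j v) \<le> real l * C1 C / real n" .
  have "1 - 2 * q k v \<le> 2 * (\<Sum>j\<in>{1..l} - {k}. q j v)"
  proof (rule deficit_le [OF _ k])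
    show "v \<in> {1..n}" using k v B_sub by blast
    show "(\<Sum>j\<in>{1..l} - {k}. q j v) \<le> 1 / 2" using S n by linarith
  qed
  then show ?thesis using S by (simp add: C2_def)
qed

lemma Pr_not_extend_B:
  assumes k: "k \<in> {1..l}" and D: "D \<subseteq> B k" "card D \<le> sg" and dec: "decays C n (D0 C)"
    and n: "real l * C1 C / real n \<le> 1 / 2"
  shows "Pr (F k) (\<lambda>G. G \<union> D \<notin> F k) \<le> C3 C / real n"
proof -
  have "Pr (F k) (\<lambda>G. G \<union> D \<notin> F k) \<le> 2 ^ sg * (real sg * (C2 C / real n))"
  proof (rule Pr_not_extend_le [OF k])
    show "finite D" using D finite_B k finite_subset by blast
    show "1 - 2 * q k u \<le> C2 C / real n" if "u \<in> D" for u
      using deficit_B_le [OF k _ dec n] that D by blast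
    show "0 \<le> C2 C / real n" using C1_pos [of C] by (simp add: C2_def)
  qed (rule D)
  then show ?thesis by (simp add: C3_def)
qed

text \<open>A vertex with two substantial users adds one to the overlap
  \<open>\<tau> j i + \<tau> i j = m {i, j}\<close> that typical members already exhaust. So typical
  members of \<open>F j\<close> through \<open>v\<close> are killed and atypical ones are rare,
  against \<open>1 / C \<le> q j v\<close>.\<close>

lemma H_empty:
  assumes dec: "decays C n (D0 C)" and n: "real l * C1 C / real n \<le> 1 / 2"
    and n2: "(C1 C + C3 C) / real n \<le> 1 / (2 * real C)" and n3: "(C1 C + 1) / real n \<le> 1 / (2 * real C)"
  shows "H = {}"
proof (rule ccontr)
  assume "H \<noteq> {}"
  then obtain v where v: "v \<in> H" by auto
  then obtain i j where ij: "i \<in> {1..l}" "j \<in> {1..l}" "i \<noteq> j" and qi: "1 / real C \<le> q i v" and qj: "1 / real C \<le> q j v"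
    using H_two by blast
  have "Pr (F j) (\<lambda>G. v \<in> G \<and> typical B \<tau> j G) \<le> 1 / real n ^ (sg + 3)"
  proof (rule Pr_killed_small [OF ij(2) dec])
    fix G assume G: "G \<in> F j" and vG: "v \<in> G \<and> typical B \<tau> j G"
    define X where "X = G - B j"
    have Xi: "X \<inter> B i = G \<inter> B i" using B_disj [OF ij] by (auto simp: X_def)
    have finX: "finite X" using G finite_mem ij by (auto simp: X_def)
    have cXi: "card (X \<inter> B i) = \<tau> j i" unfolding Xi using vG ij by (auto simp: typical_def)
    have vB: "v \<notin> B k" if "k \<in> {1..l}" for k using v B_sub [OF that] by auto
    have small: "card (X \<inter> B i) \<le> sg"
      unfolding cXi using type_sum [OF ij(1,2)] m_le_sg [OF ij] ij by linarith
    show "killed (n div D0 C) j (G - B j)" unfolding X_def [symmetric]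
    proof (rule killed_of_Pr [where j = i and \<theta> = "1 / (2 * real C)" and c = "2 * real C * (real C * 2 ^ C)" and
          P = "\<lambda>G'. (v \<in> G' \<and> typical B \<tau> i G') \<and> G' \<union> (X \<inter> B i) \<in> F i"])
      have "q i v \<le> Pr (F i) (\<lambda>G'. (v \<in> G' \<and> \<not> (\<not> typical B \<tau> i G' \<or> G' \<union> (X \<inter> B i) \<notin> F i)))
          + Pr (F i) (\<lambda>G'. \<not> typical B \<tau> i G' \<or> G' \<union> (X \<inter> B i) \<notin> F i)"
        unfolding q_def by (rule Pr_diff_le) (use finite_F ij in auto)
      also have "Pr (F i) (\<lambda>G'. \<not> typical B \<tau> i G' \<or> G' \<union> (X \<inter> B i) \<notin> F i) \<le>
          Pr (F i) (\<lambda>G'. {} \<subseteq> G' \<and> \<not> typical B \<tau> i G') + Pr (F i) (\<lambda>G'. G' \<union> (X \<inter> B i) \<notin> F i)"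
        using Pr_disj [OF finite_F [OF ij(1)], of "\<lambda>G'. \<not> typical B \<tau> i G'" "\<lambda>G'. G' \<union> (X \<inter> B i) \<notin> F i"]
        by (simp only: empty_subsetI simp_thms)
      also have "\<dots> \<le> C1 C / real n ^ (card ({}::nat set) + 1) + C3 C / real n"
        by (intro add_mono Pr_atypical_le Pr_not_extend_B dec n ij(1)) (use small in auto)
      also have "\<dots> = (C1 C + C3 C) / real n" by (simp add: add_divide_distrib)
      finally have "1 / real C \<le> Pr (F i) (\<lambda>G'. v \<in> G' \<and> \<not> (\<not> typical B \<tau> i G' \<or> G' \<union> (X \<inter> B i) \<notin> F i)) + 1 / (2 * real C)"
        using n2 qi by linarith
      moreover have "1 / real C = 1 / (2 * real C) + 1 / (2 * real C)" by simp
      ultimately have "1 / (2 * real C) \<le> Pr (F i) (\<lambda>G'. v \<in> G' \<and> \<not> (\<not> typical B \<tau> i G' \<or> G' \<union> (X \<inter> B i) \<notin> F i))"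
        by linarith
      then show "1 / (2 * real C) \<le> Pr (F i) (\<lambda>G'. (v \<in> G' \<and> typical B \<tau> i G') \<and> G' \<union> X \<inter> B i \<in> F i)"
        by simp
      show "G' \<union> X \<inter> B i \<in> F i \<and> m {j, i} < card (G' \<inter> B j) + card (X \<inter> (G' \<union> X \<inter> B i))"
        if G': "G' \<in> F i" "(v \<in> G' \<and> typical B \<tau> i G') \<and> G' \<union> X \<inter> B i \<in> F i" for G'
      proof -
        have "card (G' \<inter> B j) = \<tau> i j" using G' ij by (auto simp: typical_def)
        \<comment> \<open>\<open>v\<close> lies in no part, so it survives in \<open>X\<close> and
          is not among the vertices of \<open>X \<inter> B i\<close>: this is the extra one.\<close>
        moreover have "insert v (X \<inter> B i) \<subseteq> X \<inter> (G' \<union> X \<inter> B i)"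
          using vG G' vB [OF ij(2)] by (auto simp: X_def)
        then have "card (insert v (X \<inter> B i)) \<le> card (X \<inter> (G' \<union> X \<inter> B i))" using finX by (intro card_mono) auto
        then have "\<tau> j i + 1 \<le> card (X \<inter> (G' \<union> X \<inter> B i))" using finX vB [OF ij(1)] cXi by simp
        ultimately show ?thesis using G' type_sum [OF ij(2,1)] ij by auto
      qed
      show "Pr (F i) (\<lambda>G'. ((v \<in> G' \<and> typical B \<tau> i G') \<and> G' \<union> X \<inter> B i \<in> F i) \<and> u \<in> G') \<le>
          2 * real C * (real C * 2 ^ C) * (1 / (2 * real C)) / real n" if u: "u \<in> B j" for u
      proof -
        have "Pr (F i) (\<lambda>G'. ((v \<in> G' \<and> typical B \<tau> i G') \<and> G' \<union> X \<inter> B i \<in> F i) \<and> u \<in> G') \<le>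
           Pr (F i) (\<lambda>G'. {u} \<subseteq> G' \<and> typical B \<tau> i G')"
          by (rule Pr_mono) (use finite_F ij in auto)
        also have "\<dots> \<le> real C * 2 ^ C / real n ^ card {u}"
          by (rule Pr_typical_le) (use ij u B_sub [OF ij(2)] B_disj [OF ij] in auto)
        finally show ?thesis using C_pos by simp
      qed
      have "real (sg * (2 * C * (C * 2 ^ C))) < real (2 * sg * C * C * 2 ^ C + 1)"
        unfolding of_nat_less_iff by (simp add: ac_simps)
      then show "real sg * (2 * real C * (real C * 2 ^ C)) < real (D0 C)" by (simp add: D0_def)
    qed (use ij finX C_pos in \<open>auto simp: X_def\<close>)
  qed
  also have "\<dots> \<le> 1 / real n ^ 1" using n_pos by (intro divide_left_mono power_increasing) auto
  finally have 1: "Pr (F j) (\<lambda>G. v \<in> G \<and> typical B \<tau> j G) \<le> 1 / real n" by simp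
  have "q j v \<le> Pr (F j) (\<lambda>G. v \<in> G \<and> \<not> (\<not> typical B \<tau> j G)) + Pr (F j) (\<lambda>G. \<not> typical B \<tau> j G)"
    unfolding q_def by (rule Pr_diff_le) (use finite_F ij in auto)
  also have "Pr (F j) (\<lambda>G. \<not> typical B \<tau> j G) \<le> C1 C / real n"
    using Pr_atypical_le [OF ij(2), of "{}"] dec by simp
  finally have "q j v \<le> 1 / real n + C1 C / real n" using 1 by simp
  then have "1 / real C \<le> 1 / (2 * real C)" using n3 qj by (simp add: add_divide_distrib)
  then show False using C_pos by (simp add: field_simps)
qed

end

section \<open>The growth ratio and its first lower bound\<close>

context overlap_problem
begin

text \<open>\<open>s_star n l m = 2 * (1 + gr n) * s_star (n - 1) l m\<close>; the asymptotics amount to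
  \<open>gr n = sg / n + O(1 / n\<^sup>2)\<close>.\<close>

definition gr :: "nat \<Rightarrow> real" where
  "gr n = real (s_star n l m) / (2 * real (s_star (n - 1) l m)) - 1"

lemma gr_nonneg:
  assumes "n \<ge> 1"
  shows "gr n \<ge> 0"
proof -
  have "2 * s_star (n - 1) l m \<le> s_star n l m"
    using double_le [of l "n - 1" m] l_ge assms by simp
  then have "real (2 * s_star (n - 1) l m) \<le> real (s_star n l m)" by (simp only: of_nat_le_iff)
  then show ?thesis using s_star_pos [of "n - 1" l m] by (simp add: gr_def pos_le_divide_eq)
qed

text \<open>Threshold for a genuine second user: l families below c0/n contribute at most 1/(16 n),
  too little to explain a growth of 1/(8 n).\<close>

definition c0 :: real where "c0 = 1 / (16 * real l)"

definition C4 :: "nat \<Rightarrow> real" where "C4 C = (real sg + 1) * (real sg + 1) * real C + 1"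

text \<open>Makes the failures of absorbing up to \<open>sg\<close> safe vertices total at most
  c0/(4 n), a quarter of the threshold c0/n.\<close>

definition eps1 :: real where "eps1 = c0 / (4 * 2 ^ sg * real sg)"

definition C5 :: "nat \<Rightarrow> real" where "C5 C = C1 C + (C4 C / eps1) * C1 C + 1"

definition C6 :: "nat \<Rightarrow> real" where "C6 C = C1 C + C5 C"

text \<open>Counterpart of \<open>D0\<close> when the conditioning event has probability only of
  order 1/n; the concentration constant is then 2 C1 / c0.\<close>

definition D1 :: "nat \<Rightarrow> nat" where "D1 C = nat \<lceil>real sg * (2 * C1 C / c0)\<rceil> + 1"

text \<open>Relative gain from merging two oppositely directed parts: a constant, while the errors
  it must beat are O(1/n).\<close>

definition c7 :: "nat \<Rightarrow> real" where "c7 C = 1 / (4 * C1 C * (real sg + 1))"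

definition large :: "nat \<Rightarrow> nat \<Rightarrow> bool" where
  "large C n \<longleftrightarrow> decays C n (D0 C) \<and> decays C n (D1 C) \<and> real l * C1 C / real n \<le> 1 / 8 \<and>
     C1 C / real n \<le> c0 / 4 \<and> C5 C / real n \<le> c0 / 2 \<and> 1 / real n \<le> c0 / 2 \<and>
     C6 C / real n \<le> 1 / 2 \<and> (4 * C1 C * (real sg + 1)) / real n \<le> 1 \<and>
     (real l * C6 C) / real n \<le> c7 C / 4"

lemma c0_pos: "c0 > 0"
  using l_ge by (simp add: c0_def)

lemma eps1_pos: "eps1 > 0"
  using c0_pos sg_pos by (simp add: eps1_def)

lemma C4_pos: "C4 C \<ge> 1"
  by (simp add: C4_def)

lemma C5_ge: "C5 C \<ge> C1 C" "C5 C \<ge> 1"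
proof -
  have "(C4 C / eps1) * C1 C \<ge> 0" using C4_pos [of C] eps1_pos C1_pos [of C] by simp
  then show "C5 C \<ge> C1 C" "C5 C \<ge> 1" using C1_pos [of C] by (simp_all add: C5_def)
qed

lemma C6_pos: "C6 C > 0"
  using C5_ge [of C] C1_pos [of C] by (simp add: C6_def)

lemma c7_pos: "c7 C > 0" "c7 C \<le> 1"
proof -
  have "1 * 1 \<le> C1 C * (real sg + 1)" using C1_pos [of C] by (intro mult_mono) auto
  then show "c7 C > 0" "c7 C \<le> 1" by (simp_all add: c7_def divide_le_eq)
qed

lemma eventually_large: "\<forall>\<^sub>F n in sequentially. large C n"
  unfolding large_def
  by (intro eventually_conj eventually_decays eventually_divide_le)
     (use c0_pos c7_pos [of C] in \<open>auto simp: D0_def D1_def\<close>)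

end

context extremal_problem
begin

definition others :: "nat \<Rightarrow> nat \<Rightarrow> real" where
  "others k v = (\<Sum>j\<in>{1..l} - {k}. q j v)"

lemma others_nonneg: "others k v \<ge> 0"
  by (auto simp: others_def intro: sum_nonneg)

text \<open>Normalised deletion: the doubling cancels against the owner's factor 1/2, and only the
  deficit, the use by the others and the growth remain to be compared.\<close>

lemma delete_gr:
  assumes v: "v \<in> {1..n}" and k: "k \<in> {1..l}"
  shows "(1 + (1 - 2 * q k v)) * (1 - others k v) * (1 + gr n) \<le> 1"
proof -
  have n: "n \<ge> 1" using v by (simp add: atLeastAtMost_iff)
  have s: "real (s_star (n - 1) l m) > 0" using s_star_pos by simp
  have "(\<Prod>k\<in>{1..l}. 1 - q k v) * (2 * real (s_star (n - 1) l m) * (1 + gr n)) \<le> real (s_star (n - 1) l m)"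
    using delete_vertex [OF v] s by (simp add: gr_def)
  then have "((\<Prod>k\<in>{1..l}. 1 - q k v) * 2 * (1 + gr n)) * real (s_star (n - 1) l m) \<le> 1 * real (s_star (n - 1) l m)"
    by (simp add: ac_simps)
  then have 1: "(\<Prod>k\<in>{1..l}. 1 - q k v) * 2 * (1 + gr n) \<le> 1"
    using s by (rule mult_right_le_imp_le)
  have 2: "1 - others k v \<le> (\<Prod>j\<in>{1..l} - {k}. 1 - q j v)"
    unfolding others_def by (rule one_minus_sum_le_prod) (use q_le_one in auto)
  have qk: "0 \<le> 1 - q k v" using q_le_one [OF k, of v] by simp
  have "(2 * (1 - q k v)) * (1 - others k v) * (1 + gr n) \<le>
      (2 * (1 - q k v)) * (\<Prod>j\<in>{1..l} - {k}. 1 - q j v) * (1 + gr n)"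
    using 2 qk gr_nonneg [OF n] by (intro mult_right_mono mult_left_mono) auto
  also have "\<dots> = (\<Prod>k\<in>{1..l}. 1 - q k v) * 2 * (1 + gr n)"
    using k by (simp add: prod.remove [of "{1..l}" k])
  finally show ?thesis using 1 by simp
qed

lemma clone_gr:
  assumes v: "v \<in> {1..n}" and k: "k \<in> {1..l}"
  shows "(1 - (1 - 2 * q k v) / 2) * (1 + others k v) \<le> 1 + gr (Suc n)"
proof -
  have s: "real (s_star n l m) > 0" using s_star_pos by simp
  have "1 + others k v \<le> (\<Prod>j\<in>{1..l} - {k}. 1 + q j v)"
    unfolding others_def by (rule one_plus_sum_le_prod) auto
  then have "real (s_star n l m) * ((1 + 2 * q k v) * (1 + others k v)) \<le>
      real (s_star n l m) * ((1 + 2 * q k v) * (\<Prod>j\<in>{1..l} - {k}. 1 + q j v))"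
    by (intro mult_left_mono) auto
  also have "\<dots> \<le> real (s_star (Suc n) l m)" by (rule clone_vertex [OF v k])
  also have "\<dots> = real (s_star n l m) * (2 * (1 + gr (Suc n)))" using s by (simp add: gr_def)
  finally have "(1 + 2 * q k v) * (1 + others k v) \<le> 2 * (1 + gr (Suc n))"
    using s by (rule mult_left_le_imp_le)
  then have "(1 + 2 * q k v) * (1 + others k v) / 2 \<le> 1 + gr (Suc n)" by simp
  moreover have "1 - (1 - 2 * q k v) / 2 = (1 + 2 * q k v) / 2"
    by (simp add: diff_divide_distrib add_divide_distrib)
  ultimately show ?thesis by (simp only: times_divide_eq_left)
qed

text \<open>Deletion with the deficit dropped: use by non-owners has to account for the
  growth.\<close>

lemma gr_le_others:
  assumes v: "v \<in> {1..n}" and k: "k \<in> {1..l}" and "others k v \<le> 1 / 2"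
  shows "gr n * (1 - others k v) \<le> others k v"
proof -
  have n: "n \<ge> 1" using v by (simp add: atLeastAtMost_iff)
  have "1 * (1 - others k v) * (1 + gr n) \<le> (1 + (1 - 2 * q k v)) * (1 - others k v) * (1 + gr n)"
    using q_le_half [OF k, of v] gr_nonneg [OF n] assms(3) by (intro mult_right_mono) auto
  then show ?thesis using delete_gr [OF v k] by (simp add: algebra_simps)
qed

end

locale partitioned = structured n l m F C "{}" B \<tau>
  for n l :: nat and m :: "nat set \<Rightarrow> nat" and F :: "nat \<Rightarrow> nat set set"
    and C :: nat and B :: "nat \<Rightarrow> nat set" and \<tau> :: "nat \<Rightarrow> nat \<Rightarrow> nat" +
  assumes large: "large C n"
begin

lemma dec: "decays C n (D0 C)" "decays C n (D1 C)"
  using large by (auto simp: large_def)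

lemma n_large8: "real l * C1 C / real n \<le> 1 / 8"
  using large unfolding large_def by linarith

lemma cover: "{1..n} = (\<Union>k\<in>{1..l}. B k)"
  using B_cover by simp

lemma q_le_off: "j \<in> {1..l} \<Longrightarrow> v \<notin> B j \<Longrightarrow> q j v \<le> C1 C / real n"
  using q_le [of j v] dec by simp

lemma others_le:
  assumes "k \<in> {1..l}" "v \<in> B k"
  shows "others k v \<le> real l * C1 C / real n"
proof -
  have "others k v \<le> (\<Sum>j\<in>{1..l} - {k}. C1 C / real n)"
    unfolding others_def by (intro sum_mono q_le_off) (use assms B_disj in blast)+
  also have "\<dots> \<le> (\<Sum>j\<in>{1..l}. C1 C / real n)"
    using C1_pos [of C] by (intro sum_mono2) auto
  finally show ?thesis by simp
qed

lemma Pr_typical_ge: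
  assumes "j \<in> {1..l}"
  shows "Pr (F j) (typical B \<tau> j) \<ge> 1 - C1 C / real n"
proof -
  have "Pr (F j) (\<lambda>G. \<not> typical B \<tau> j G) \<le> C1 C / real n"
    using Pr_atypical_le [OF assms, of "{}"] dec by simp
  moreover have "Pr (F j) (\<lambda>G. \<not> typical B \<tau> j G) = 1 - Pr (F j) (typical B \<tau> j)"
    by (rule Pr_compl) (use finite_F F_nonempty assms in auto)
  ultimately show ?thesis by linarith
qed

text \<open>Some family has on average at least half a vertex in a foreign part, so some vertex
  there has use s \<ge> 1/(2n) by non-owners. Deletion at this vertex bounds the owner's deficit by
  8/7 s, which consumes only part of the gain s from cloning.\<close>

lemma gr_Suc_ge: "gr (Suc n) \<ge> 1 / (8 * real n)"
proof -
  have "\<exists>S\<in>pairs l. m S > 0"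
    using weight_pos by (metis gr0I less_irrefl sum.neutral)
  then obtain a b where ab: "a \<in> {1..l}" "b \<in> {1..l}" "a \<noteq> b" "m {a, b} > 0"
    by (auto simp: pairs_def card_2_iff)
  then have "\<tau> a b > 0 \<or> \<tau> b a > 0" using type_sum [of a b] by auto
  then obtain j k where jk: "j \<in> {1..l}" "k \<in> {1..l}" "j \<noteq> k" "\<tau> j k \<ge> 1"
    using ab by (metis One_nat_def Suc_leI)
  note n_large8
  moreover have "C1 C / real n \<le> real l * C1 C / real n"
    using l_ge C1_pos [of C] by (intro divide_right_mono) auto
  ultimately have "Pr (F j) (typical B \<tau> j) \<ge> 1 / 2"
    using Pr_typical_ge [OF jk(1)] by linarith
  then have "1 / 2 \<le> real (\<tau> j k) * Pr (F j) (typical B \<tau> j)"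
    using jk(4) mult_mono [of 1 "real (\<tau> j k)" "1 / 2" "Pr (F j) (typical B \<tau> j)"] by simp
  also have "\<dots> \<le> (\<Sum>v\<in>B k. Pr (F j) (\<lambda>G. typical B \<tau> j G \<and> v \<in> G))"
    by (rule sum_Pr_mem_ge) (use finite_F finite_B jk in \<open>auto simp: typical_def\<close>)
  also have "\<dots> \<le> (\<Sum>v\<in>B k. q j v)"
    unfolding q_def by (intro sum_mono Pr_mono) (use finite_F jk in auto)
  finally have sum: "1 / 2 \<le> (\<Sum>v\<in>B k. q j v)" .
  have "\<exists>v\<in>B k. q j v \<ge> 1 / (2 * real n)"
  proof (rule ccontr)
    assume no: "\<not> ?thesis"
    have ne: "B k \<noteq> {}" using sum by auto
    have "(\<Sum>v\<in>B k. q j v) < (\<Sum>v\<in>B k. 1 / (2 * real n))"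
      by (rule sum_strict_mono) (use ne finite_B jk no in auto)
    also have "\<dots> = real (card (B k)) * (1 / (2 * real n))" by simp
    also have "\<dots> \<le> real n * (1 / (2 * real n))"
      using card_mono [of "{1..n}" "B k"] B_sub [OF jk(2)] by (intro mult_right_mono) auto
    finally show False using sum n_pos by simp
  qed
  then obtain v where v: "v \<in> B k" "q j v \<ge> 1 / (2 * real n)" by auto
  have vn: "v \<in> {1..n}" using v B_sub jk by auto
  define s where "s = others k v"
  define h where "h = 1 - 2 * q k v"
  have "q j v \<le> s" unfolding s_def others_def
    by (rule member_le_sum) (use jk in auto)
  then have s1: "s \<ge> 1 / (2 * real n)" using v by linarith
  have s2: "s \<le> 1 / 8" using others_le [OF jk(2) v(1)] n_large8 unfolding s_def by linarith
  have s0: "s \<ge> 0" using others_nonneg by (simp add: s_def)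
  have h0: "h \<ge> 0" using q_le_half [OF jk(2), of v] by (simp add: h_def)
  have "(1 + h) * (1 - s) * 1 \<le> (1 + h) * (1 - s) * (1 + gr n)"
    using h0 s2 gr_nonneg [OF n_pos] by (intro mult_left_mono) auto
  also have "\<dots> \<le> 1" using delete_gr [OF vn jk(2)] by (simp add: s_def h_def)
  finally have "h * (1 - s) \<le> s" by (simp add: algebra_simps)
  moreover have "h * (7 / 8) \<le> h * (1 - s)" using s2 h0 by (intro mult_left_mono) auto
  ultimately have h1: "h \<le> 8 / 7 * s" by simp
  have "(1 - h / 2) * (1 + s) \<le> 1 + gr (Suc n)" using clone_gr [OF vn jk(2)] by (simp add: s_def h_def)
  moreover have "(1 - 4 / 7 * s) * (1 + s) \<le> (1 - h / 2) * (1 + s)"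
    using h1 s0 by (intro mult_right_mono) auto
  moreover have "(1 - c * s) * (1 + s) = 1 + s - c * s - c * (s * s)" for c by (simp add: algebra_simps)
  then have "(1 - 4 / 7 * s) * (1 + s) = 1 + s - 4 / 7 * s - 4 / 7 * (s * s)" .
  moreover have "s * s \<le> 1 / 8 * s" using s2 s0 by (intro mult_right_mono) auto
  ultimately have "gr (Suc n) \<ge> s / 4" using s0 by linarith
  moreover have "s / 4 \<ge> 1 / (8 * real n)" using s1 by simp
  ultimately show ?thesis by linarith
qed

section \<open>Boundary of a link\<close>

text \<open>Failures of adding \<open>u\<close> among the members through \<open>v\<close>,
  normalised by the whole family, so that 1/n is the scale for comparison with
  \<open>q j v\<close>.\<close>

definition bd :: "nat \<Rightarrow> nat \<Rightarrow> nat \<Rightarrow> real" where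
  "bd j v u = Pr (F j) (\<lambda>G. v \<in> G \<and> u \<notin> G \<and> insert u G \<notin> F j)"

text \<open>A set outside \<open>F j\<close> contains, by maximality, a conflict of bounded size, and a removable vertex
  has to be part of every conflict; so the boundary is counted from outside.\<close>

lemma card_removable_le:
  assumes j: "j \<in> {1..l}" and W: "W \<subseteq> {1..n}" "W \<notin> F j"
  shows "card {u\<in>W. W - {u} \<in> F j} \<le> sg + 1"
proof -
  obtain i G where iG: "i \<in> {1..l}" "i \<noteq> j" "G \<in> F i" "m {j, i} < card (W \<inter> G)"
    using maximal [OF j W(1)] W(2) not_le by blast
  then have "m {j, i} + 1 \<le> card (W \<inter> G)" by simp
  then obtain Q where Q: "Q \<subseteq> W \<inter> G" "card Q = m {j, i} + 1" "finite Q"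
    by (rule obtain_subset_with_card_n)
  have "{u\<in>W. W - {u} \<in> F j} \<subseteq> Q"
  proof
    fix u assume u: "u \<in> {u\<in>W. W - {u} \<in> F j}"
    show "u \<in> Q"
    proof (rule ccontr)
      assume "u \<notin> Q"
      then have "Q \<subseteq> (W - {u}) \<inter> G" using Q by auto
      then have "card Q \<le> card ((W - {u}) \<inter> G)"
        using iG finite_mem by (intro card_mono) auto
      also have "\<dots> \<le> m {j, i}" using card_Int_le [of j i "W - {u}" G] u iG j by auto
      finally show False using Q by simp
    qed
  qed
  then have "card {u\<in>W. W - {u} \<in> F j} \<le> card Q" using Q by (intro card_mono)
  also have "\<dots> \<le> sg + 1" using Q m_le_sg [of j i] iG j by auto
  finally show ?thesis .
qed

text \<open>Pairs of a member \<open>G\<close> through \<open>v\<close> and a failing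
  \<open>u\<close> are counted via the non-member \<open>W = insert u G\<close>: each
  \<open>W\<close> has at most sg + 1 removable vertices, and prescribing \<open>v\<close> off
  \<open>B j\<close> costs a factor n in the number of \<open>W\<close>. Hence the sum over all of
  \<open>B j\<close>, and not merely each term, is O(1/n).\<close>

lemma sum_bd_le:
  assumes j: "j \<in> {1..l}" and v: "v \<notin> B j"
  shows "(\<Sum>u\<in>B j. bd j v u) \<le> C4 C / real n"
proof -
  have fB: "finite (B j)" using finite_B j by blast
  define e where "e P = (SIGMA u:B j. {G\<in>F j. P G \<and> v \<in> G \<and> u \<notin> G \<and> insert u G \<notin> F j})" for P
  have fin_e: "finite (e P)" for P unfolding e_def using fB finite_F [OF j] by (intro finite_SigmaI) auto
  have card_e: "real (card (e P)) = (\<Sum>u\<in>B j. Pr (F j) (\<lambda>G. P G \<and> v \<in> G \<and> u \<notin> G \<and> insert u G \<notin> F j)) * real (card (F j))" for P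
    unfolding e_def using fB finite_F [OF j] F_nonempty [OF j]
    by (subst card_SigmaI) (auto simp: card_eq_Pr sum_distrib_right)
  \<comment> \<open>Adding \<open>u\<close> from \<open>B j\<close> does not change the trace off
    \<open>B j\<close>, so members that are not heavy lead to non-members with at most
    \<open>deg \<tau> j\<close> vertices there.\<close>
  define \<W> where "\<W> = {W. W \<subseteq> {1..n} \<and> W \<notin> F j \<and> v \<in> W \<and> card (W - B j) \<le> deg \<tau> j}"
  have fin\<W>: "finite \<W>" by (rule finite_subset [of _ "Pow {1..n}"]) (auto simp: \<W>_def)
  have light: "real (card (e (\<lambda>G. \<not> heavy B \<tau> j G))) \<le> real (sg + 1) * real (card \<W>)"
  proof -
    define T where "T = (SIGMA W:\<W>. {u\<in>W. W - {u} \<in> F j})"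
    have finrem: "\<forall>W\<in>\<W>. finite {u\<in>W. W - {u} \<in> F j}"
    proof
      fix W assume "W \<in> \<W>"
      then have "{u\<in>W. W - {u} \<in> F j} \<subseteq> {1..n}" by (auto simp: \<W>_def)
      then show "finite {u\<in>W. W - {u} \<in> F j}" by (rule finite_subset) simp
    qed
    have "card (e (\<lambda>G. \<not> heavy B \<tau> j G)) \<le> card T"
    proof (rule card_inj_on_le [where f = "\<lambda>(u, G). (insert u G, u)"])
      show "inj_on (\<lambda>(u, G). (insert u G, u)) (e (\<lambda>G. \<not> heavy B \<tau> j G))"
        by (rule inj_on_inverseI [where g = "\<lambda>(W, u). (u, W - {u})"]) (auto simp: e_def)
      show "(\<lambda>(u, G). (insert u G, u)) ` e (\<lambda>G. \<not> heavy B \<tau> j G) \<subseteq> T"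
      proof clarsimp
        fix u G assume "(u, G) \<in> e (\<lambda>G. \<not> heavy B \<tau> j G)"
        then have u: "u \<in> B j" and G: "G \<in> F j" "\<not> heavy B \<tau> j G" "v \<in> G" "u \<notin> G" "insert u G \<notin> F j"
          by (auto simp: e_def)
        have "card (G - (B j \<union> {})) \<le> deg \<tau> j"
          using card_off_light [OF j G(1,2)] card_off_typical [OF j G(1)] by (cases "typical B \<tau> j G") auto
        moreover have "insert u G - B j = G - B j" using u by auto
        moreover have "insert u G \<subseteq> {1..n}" using G F_sub [OF j] u B_sub [OF j] by auto
        ultimately show "(insert u G, u) \<in> T" using G by (auto simp: T_def \<W>_def)
      qed
      show "finite T" unfolding T_def using fin\<W>
        using finrem by (intro finite_SigmaI) auto
    qed
    also have "card T = (\<Sum>W\<in>\<W>. card {u\<in>W. W - {u} \<in> F j})"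
      unfolding T_def by (rule card_SigmaI [OF fin\<W> finrem])
    also have "\<dots> \<le> (\<Sum>W\<in>\<W>. sg + 1)"
      by (intro sum_mono card_removable_le j) (auto simp: \<W>_def)
    finally have "real (card (e (\<lambda>G. \<not> heavy B \<tau> j G))) \<le> real (card \<W> * (sg + 1))"
      by (simp only: sum_constant of_nat_id of_nat_le_iff)
    then show ?thesis by (simp add: mult.commute)
  qed
  have deg_sg: "deg \<tau> j \<le> sg"
    using member_le_sum [of j "{1..l}" "deg \<tau>"] j sum_deg [of \<tau>] type_sum by simp
  have card\<W>: "real (card \<W>) * real n \<le> real (sg + 1) * (2 ^ card (B j) * real n ^ deg \<tau> j)"
  proof -
    have "card ((\<lambda>G. G - B j) ` \<W>) \<le> card (\<Union>s\<in>{1..deg \<tau> j}. {X. X \<subseteq> {1..n} \<and> card X = s \<and> {v} \<subseteq> X})"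
    proof (rule card_mono)
      show "(\<lambda>G. G - B j) ` \<W> \<subseteq> (\<Union>s\<in>{1..deg \<tau> j}. {X. X \<subseteq> {1..n} \<and> card X = s \<and> {v} \<subseteq> X})"
      proof
        fix X assume "X \<in> (\<lambda>G. G - B j) ` \<W>"
        then obtain W where W: "W \<in> \<W>" "X = W - B j" by blast
        have "finite (W - B j)" using W by (auto simp: \<W>_def intro: finite_subset)
        then have "card (W - B j) > 0" using W v by (auto simp: \<W>_def card_gt_0_iff)
        then have "card X \<in> {1..deg \<tau> j}" "X \<subseteq> {1..n}" "v \<in> X"
          using W v by (auto simp: \<W>_def atLeastAtMost_iff)
        then show "X \<in> (\<Union>s\<in>{1..deg \<tau> j}. {X. X \<subseteq> {1..n} \<and> card X = s \<and> {v} \<subseteq> X})" by auto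
      qed
    qed auto
    also have "\<dots> \<le> (\<Sum>s\<in>{1..deg \<tau> j}. card {X. X \<subseteq> {1..n} \<and> card X = s \<and> {v} \<subseteq> X})"
      by (rule card_UN_le) simp
    also have "\<dots> \<le> (\<Sum>s\<in>{1..deg \<tau> j}. n ^ (deg \<tau> j - 1))"
    proof (rule sum_mono)
      fix s assume s: "s \<in> {1..deg \<tau> j}"
      have "card {X. X \<subseteq> {1..n} \<and> card X = s \<and> {v} \<subseteq> X} \<le> n ^ (s - 1)"
        using card_supersets_le [of "{1..n}" s "{v}"] by (simp add: One_nat_def)
      also have "\<dots> \<le> n ^ (deg \<tau> j - 1)"
        using s n_pos by (intro power_increasing) (auto simp: atLeastAtMost_iff)
      finally show "card {X. X \<subseteq> {1..n} \<and> card X = s \<and> {v} \<subseteq> X} \<le> n ^ (deg \<tau> j - 1)" .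
    qed
    also have "\<dots> = deg \<tau> j * n ^ (deg \<tau> j - 1)" by simp
    finally have "card \<W> \<le> 2 ^ card (B j) * (deg \<tau> j * n ^ (deg \<tau> j - 1))"
      using card_le_pow_times_traces [OF fin\<W> fB] by (meson le_trans mult_le_mono2)
    then have "card \<W> * n \<le> (2 ^ card (B j) * (deg \<tau> j * n ^ (deg \<tau> j - 1))) * n" by (rule mult_le_mono1)
    also have "\<dots> = deg \<tau> j * (2 ^ card (B j) * n ^ deg \<tau> j)"
    proof (cases "deg \<tau> j = 0")
      case False
      then have "n ^ (deg \<tau> j - 1) * n = n ^ deg \<tau> j" by (simp add: power_minus_mult)
      then show ?thesis by (metis mult.assoc mult.left_commute)
    qed simp
    also have "\<dots> \<le> (sg + 1) * (2 ^ card (B j) * n ^ deg \<tau> j)" using deg_sg by (intro mult_le_mono1) simp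
    finally have "real (card \<W> * n) \<le> real ((sg + 1) * (2 ^ card (B j) * n ^ deg \<tau> j))"
      by (simp only: of_nat_le_iff)
    then show ?thesis by simp
  qed
  have Fj: "real (card (F j)) > 0" using card_F_pos j by simp
  have L: "(\<Sum>u\<in>B j. Pr (F j) (\<lambda>G. \<not> heavy B \<tau> j G \<and> v \<in> G \<and> u \<notin> G \<and> insert u G \<notin> F j)) * real n \<le>
      (real sg + 1) * (real sg + 1) * real C"
  proof -
    define x where "x = (\<Sum>u\<in>B j. Pr (F j) (\<lambda>G. \<not> heavy B \<tau> j G \<and> v \<in> G \<and> u \<notin> G \<and> insert u G \<notin> F j))"
    have "x * real (card (F j)) * real n \<le> real (sg + 1) * real (card \<W>) * real n"
      using light card_e [of "\<lambda>G. \<not> heavy B \<tau> j G"] by (intro mult_right_mono) (auto simp: x_def)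
    also have "\<dots> \<le> real (sg + 1) * (real (sg + 1) * (2 ^ card (B j) * real n ^ deg \<tau> j))"
      using card\<W> by (simp only: mult.assoc) (intro mult_left_mono, auto)
    also have "\<dots> \<le> real (sg + 1) * (real (sg + 1) * (real C * real (card (F j))))"
      using card_F_ge_real [OF j] by (intro mult_left_mono) auto
    finally have "(x * real n) * real (card (F j)) \<le> ((real sg + 1) * (real sg + 1) * real C) * real (card (F j))"
      by (simp add: ac_simps)
    then show ?thesis unfolding x_def [symmetric] using Fj by (rule mult_right_le_imp_le)
  qed
  \<comment> \<open>Heavy members may have larger traces, but they are rare enough to be charged
    once for every vertex of \<open>B j\<close>.\<close>
  have Hv: "(\<Sum>u\<in>B j. Pr (F j) (\<lambda>G. heavy B \<tau> j G)) * real n \<le> 1"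
  proof -
    have "(\<Sum>u\<in>B j. Pr (F j) (\<lambda>G. heavy B \<tau> j G)) * real n \<le> (real n * (1 / real n ^ (sg + 3))) * real n"
    proof (rule mult_right_mono)
      have "(\<Sum>u\<in>B j. Pr (F j) (\<lambda>G. heavy B \<tau> j G)) = real (card (B j)) * Pr (F j) (heavy B \<tau> j)" by simp
      also have "\<dots> \<le> real n * (1 / real n ^ (sg + 3))"
        using Pr_heavy_le [OF j dec(1)] card_mono [of "{1..n}" "B j"] B_sub [OF j]
        by (intro mult_mono) auto
      finally show "(\<Sum>u\<in>B j. Pr (F j) (\<lambda>G. heavy B \<tau> j G)) \<le> real n * (1 / real n ^ (sg + 3))" .
    qed simp
    also have "\<dots> = real n ^ 2 / real n ^ (sg + 3)" by (simp add: power2_eq_square)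
    also have "\<dots> \<le> 1" using n_pos by (simp add: divide_le_eq power_increasing)
    finally show ?thesis .
  qed
  have "(\<Sum>u\<in>B j. bd j v u) \<le> (\<Sum>u\<in>B j. Pr (F j) (\<lambda>G. \<not> heavy B \<tau> j G \<and> v \<in> G \<and> u \<notin> G \<and> insert u G \<notin> F j)
      + Pr (F j) (\<lambda>G. heavy B \<tau> j G))"
    unfolding bd_def
  proof (rule sum_mono)
    fix u
    have "Pr (F j) (\<lambda>G. v \<in> G \<and> u \<notin> G \<and> insert u G \<notin> F j) \<le>
      Pr (F j) (\<lambda>G. (\<not> heavy B \<tau> j G \<and> v \<in> G \<and> u \<notin> G \<and> insert u G \<notin> F j) \<or> heavy B \<tau> j G)"
      by (rule Pr_mono) (use finite_F j in auto)
    also have "\<dots> \<le> Pr (F j) (\<lambda>G. \<not> heavy B \<tau> j G \<and> v \<in> G \<and> u \<notin> G \<and> insert u G \<notin> F j)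
      + Pr (F j) (\<lambda>G. heavy B \<tau> j G)" by (rule Pr_disj) (use finite_F j in auto)
    finally show "Pr (F j) (\<lambda>G. v \<in> G \<and> u \<notin> G \<and> insert u G \<notin> F j) \<le>
      Pr (F j) (\<lambda>G. \<not> heavy B \<tau> j G \<and> v \<in> G \<and> u \<notin> G \<and> insert u G \<notin> F j)
      + Pr (F j) (\<lambda>G. heavy B \<tau> j G)" .
  qed
  then have "(\<Sum>u\<in>B j. bd j v u) * real n \<le> (\<Sum>u\<in>B j. Pr (F j) (\<lambda>G. \<not> heavy B \<tau> j G \<and> v \<in> G \<and> u \<notin> G \<and> insert u G \<notin> F j)
      + Pr (F j) (\<lambda>G. heavy B \<tau> j G)) * real n"
    by (rule mult_right_mono) simp
  also have "\<dots> \<le> C4 C"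
    using L Hv unfolding sum.distrib distrib_right C4_def by linarith
  finally show ?thesis using n_pos by (simp add: pos_le_divide_eq)
qed

definition Bad :: "nat \<Rightarrow> nat \<Rightarrow> nat set" where
  "Bad j v = {u\<in>B j. bd j v u \<ge> eps1 / real n}"

lemma card_Bad_le:
  assumes j: "j \<in> {1..l}" and v: "v \<notin> B j"
  shows "real (card (Bad j v)) \<le> C4 C / eps1"
proof -
  have "real (card (Bad j v)) * (eps1 / real n) \<le> (\<Sum>u\<in>Bad j v. bd j v u)"
    by (rule sum_bounded_below) (auto simp: Bad_def)
  also have "\<dots> \<le> (\<Sum>u\<in>B j. bd j v u)"
    by (rule sum_mono2) (use finite_B j in \<open>auto simp: Bad_def bd_def\<close>)
  also have "\<dots> \<le> C4 C / real n" by (rule sum_bd_le [OF assms])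
  finally have "real (card (Bad j v)) * eps1 \<le> C4 C" using n_pos by (simp add: divide_le_cancel)
  then show ?thesis using eps1_pos by (simp add: pos_le_divide_eq)
qed

lemma Pr_mem_not_extend_le:
  assumes j: "j \<in> {1..l}" and D: "D \<subseteq> B j" "D \<inter> Bad j v = {}" "card D \<le> sg"
  shows "Pr (F j) (\<lambda>G. v \<in> G \<and> G \<union> D \<notin> F j) \<le> c0 / (4 * real n)"
proof -
  have fD: "finite D" using D finite_B j finite_subset by blast
  have "Pr (F j) (\<lambda>G. v \<in> G \<and> G \<union> D \<notin> F j) \<le> 2 ^ card D * (\<Sum>u\<in>D. bd j v u)"
    unfolding bd_def by (rule Pr_extension_le) (use finite_F j fD in auto)
  also have "\<dots> \<le> 2 ^ sg * (real (card D) * (eps1 / real n))"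
    using D eps1_pos by (intro mult_mono power_increasing sum_bounded_above sum_nonneg) (auto simp: Bad_def bd_def)
  also have "\<dots> \<le> 2 ^ sg * (real sg * (eps1 / real n))"
    using D eps1_pos by (intro mult_left_mono mult_right_mono) auto
  also have "\<dots> = c0 / (4 * real n)" using sg_pos by (simp add: eps1_def)
  finally show ?thesis .
qed

section \<open>Competition for a vertex\<close>

text \<open>\<open>v\<close> is a common vertex outside both owned parts and raises the overlap
  \<open>\<tau> i j + \<tau> j i\<close> by one, so every typical member of \<open>F j\<close>
  through \<open>v\<close> that absorbs \<open>G \<inter> B j\<close> excludes its trace on
  \<open>B i\<close>. Avoiding \<open>Bad j v\<close> is what makes absorption likely among members
  through \<open>v\<close>.\<close>

lemma killed_competitor:
  assumes ij: "i \<in> {1..l}" "j \<in> {1..l}" "i \<noteq> j" and v: "v \<notin> B i" "v \<notin> B j" and qv: "q j v \<ge> c0 / real n"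
    and G: "G \<in> F i" "v \<in> G" "card (G \<inter> B j) = \<tau> i j" "G \<inter> Bad j v = {}"
  shows "killed (n div D1 C) i (G - B i)"
proof -
  define X where "X = G - B i"
  have Xj: "X \<inter> B j = G \<inter> B j" using B_disj [OF ij] by (auto simp: X_def)
  have finX: "finite X" using G finite_mem ij by (auto simp: X_def)
  have small: "card (X \<inter> B j) \<le> sg"
    unfolding Xj G(3) using type_sum [OF ij] m_le_sg [OF ij] by linarith
  show ?thesis unfolding X_def [symmetric]
  proof (rule killed_of_Pr [where j = j and \<theta> = "c0 / (2 * real n)" and c = "2 * C1 C / c0" and
        P = "\<lambda>G'. (v \<in> G' \<and> typical B \<tau> j G') \<and> G' \<union> (X \<inter> B j) \<in> F j"])
    \<comment> \<open>Of the probability c0/n, one quarter at most is lost to atypical members and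
      one quarter to failed absorption, which leaves \<theta>.\<close>
    have "q j v \<le> Pr (F j) (\<lambda>G'. v \<in> G' \<and> \<not> ((v \<in> G' \<and> \<not> typical B \<tau> j G') \<or> (v \<in> G' \<and> G' \<union> (X \<inter> B j) \<notin> F j)))
        + Pr (F j) (\<lambda>G'. (v \<in> G' \<and> \<not> typical B \<tau> j G') \<or> (v \<in> G' \<and> G' \<union> (X \<inter> B j) \<notin> F j))"
      unfolding q_def by (rule Pr_diff_le) (use finite_F ij in auto)
    also have "Pr (F j) (\<lambda>G'. (v \<in> G' \<and> \<not> typical B \<tau> j G') \<or> (v \<in> G' \<and> G' \<union> (X \<inter> B j) \<notin> F j)) \<le>
        Pr (F j) (\<lambda>G'. {v} \<subseteq> G' \<and> \<not> typical B \<tau> j G') + Pr (F j) (\<lambda>G'. v \<in> G' \<and> G' \<union> (X \<inter> B j) \<notin> F j)"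
      using Pr_disj [OF finite_F [OF ij(2)], of "\<lambda>G'. v \<in> G' \<and> \<not> typical B \<tau> j G'" "\<lambda>G'. v \<in> G' \<and> G' \<union> (X \<inter> B j) \<notin> F j"]
      by simp
    also have "\<dots> \<le> C1 C / real n ^ (card {v} + 1) + c0 / (4 * real n)"
      by (intro add_mono Pr_atypical_le Pr_mem_not_extend_le dec ij(2)) (use small v G in \<open>auto simp: Xj\<close>)
    also have "C1 C / real n ^ (card {v} + 1) = (C1 C / real n) / real n" by (simp add: power2_eq_square)
    also have "\<dots> \<le> (c0 / 4) / real n" using large by (intro divide_right_mono) (auto simp: large_def)
    finally have "c0 / real n \<le> Pr (F j) (\<lambda>G'. v \<in> G' \<and> \<not> ((v \<in> G' \<and> \<not> typical B \<tau> j G') \<or> (v \<in> G' \<and> G' \<union> (X \<inter> B j) \<notin> F j)))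
        + (c0 / (4 * real n) + c0 / (4 * real n))" using qv by simp
    moreover have "c0 / real n = c0 / (2 * real n) + (c0 / (4 * real n) + c0 / (4 * real n))" by (simp add: field_simps)
    moreover have "Pr (F j) (\<lambda>G'. v \<in> G' \<and> \<not> ((v \<in> G' \<and> \<not> typical B \<tau> j G') \<or> (v \<in> G' \<and> G' \<union> (X \<inter> B j) \<notin> F j))) \<le>
        Pr (F j) (\<lambda>G'. (v \<in> G' \<and> typical B \<tau> j G') \<and> G' \<union> X \<inter> B j \<in> F j)"
      by (rule Pr_mono) (use finite_F ij in auto)
    ultimately show "c0 / (2 * real n) \<le> Pr (F j) (\<lambda>G'. (v \<in> G' \<and> typical B \<tau> j G') \<and> G' \<union> X \<inter> B j \<in> F j)"
      by linarith
    show "G' \<union> X \<inter> B j \<in> F j \<and> m {i, j} < card (G' \<inter> B i) + card (X \<inter> (G' \<union> X \<inter> B j))"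
      if G': "G' \<in> F j" "(v \<in> G' \<and> typical B \<tau> j G') \<and> G' \<union> X \<inter> B j \<in> F j" for G'
    proof -
      have "card (G' \<inter> B i) = \<tau> j i" using G' ij by (auto simp: typical_def)
      moreover have "insert v (X \<inter> B j) \<subseteq> X \<inter> (G' \<union> X \<inter> B j)"
        using G G' v by (auto simp: X_def)
      then have "card (insert v (X \<inter> B j)) \<le> card (X \<inter> (G' \<union> X \<inter> B j))" using finX by (intro card_mono) auto
      then have "\<tau> i j + 1 \<le> card (X \<inter> (G' \<union> X \<inter> B j))" 
        using finite_mem [OF ij(1) G(1)] v Xj G(3) by simp
      ultimately show ?thesis using G' type_sum [OF ij] by auto
    qed
    \<comment> \<open>Prescribing both \<open>v\<close> and \<open>u\<close> costs n^-2; relative to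
      \<theta> of order 1/n this is again the rate c/n.\<close>
    show "Pr (F j) (\<lambda>G'. ((v \<in> G' \<and> typical B \<tau> j G') \<and> G' \<union> X \<inter> B j \<in> F j) \<and> u \<in> G') \<le>
        2 * C1 C / c0 * (c0 / (2 * real n)) / real n" if u: "u \<in> B i" for u
    proof -
      have uB: "u \<notin> B j" using u B_disj [OF ij] by auto
      have "u \<noteq> v" using u v by auto
      then have c2: "card {v, u} = 2" by simp
      have "Pr (F j) (\<lambda>G'. ((v \<in> G' \<and> typical B \<tau> j G') \<and> G' \<union> X \<inter> B j \<in> F j) \<and> u \<in> G') \<le>
         Pr (F j) (\<lambda>G'. {v, u} \<subseteq> G')"
        by (rule Pr_mono) (use finite_F ij in auto)
      also have "\<dots> \<le> C1 C / real n ^ card {v, u}"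
        by (rule Pr_contains_le) (use ij v uB c2 dec in auto)
      also have "\<dots> = 2 * C1 C / c0 * (c0 / (2 * real n)) / real n"
        using c0_pos c2 by (simp add: power2_eq_square)
      finally show ?thesis .
    qed
    show "real sg * (2 * C1 C / c0) < real (D1 C)"
      unfolding D1_def using real_nat_ceiling_ge [of "real sg * (2 * C1 C / c0)"] by simp
    show "0 \<le> 2 * C1 C / c0" using c0_pos C1_pos [of C] by simp
    show "0 < c0 / (2 * real n)" using c0_pos n_pos by simp
  qed (use ij finX in \<open>auto simp: X_def\<close>)
qed

text \<open>A member of \<open>F i\<close> containing \<open>R\<close> is atypical, meets the
  bounded set \<open>Bad j v\<close>, or is killed. The first two cost one more factor n each, the
  last is negligible.\<close>

lemma Pr_competitor_le:
  assumes ij: "i \<in> {1..l}" "j \<in> {1..l}" "i \<noteq> j" and R: "R \<inter> B i = {}" "R \<inter> B j = {}" "finite R" "card R \<le> sg + 1"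
    and v: "v \<in> R" "q j v \<ge> c0 / real n"
  shows "Pr (F i) (\<lambda>G. R \<subseteq> G) \<le> C5 C / real n ^ (card R + 1)"
proof -
  have vB: "v \<notin> B i" "v \<notin> B j" using v R by auto
  have fBad: "finite (Bad j v)" using finite_B [OF ij(2)] by (auto simp: Bad_def)
  have "Pr (F i) (\<lambda>G. R \<subseteq> G) \<le> Pr (F i) (\<lambda>G. (R \<subseteq> G \<and> \<not> typical B \<tau> i G) \<or>
      (\<exists>u\<in>Bad j v. insert u R \<subseteq> G) \<or> (R \<subseteq> G \<and> typical B \<tau> i G \<and> G \<inter> Bad j v = {}))"
    by (rule Pr_mono) (use finite_F ij in auto)
  also have "\<dots> \<le> Pr (F i) (\<lambda>G. R \<subseteq> G \<and> \<not> typical B \<tau> i G) + (Pr (F i) (\<lambda>G. \<exists>u\<in>Bad j v. insert u R \<subseteq> G)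
      + Pr (F i) (\<lambda>G. R \<subseteq> G \<and> typical B \<tau> i G \<and> G \<inter> Bad j v = {}))"
    using Pr_disj [OF finite_F [OF ij(1)]] by (intro order_trans [OF Pr_disj [OF finite_F [OF ij(1)]]] add_mono) auto
  also have "\<dots> \<le> C1 C / real n ^ (card R + 1) + ((C4 C / eps1) * (C1 C / real n ^ (card R + 1)) + 1 / real n ^ (card R + 1))"
  proof (intro add_mono)
    show "Pr (F i) (\<lambda>G. R \<subseteq> G \<and> \<not> typical B \<tau> i G) \<le> C1 C / real n ^ (card R + 1)"
      by (rule Pr_atypical_le) (use ij R dec in auto)
    have "Pr (F i) (\<lambda>G. \<exists>u\<in>Bad j v. insert u R \<subseteq> G) \<le> (\<Sum>u\<in>Bad j v. Pr (F i) (\<lambda>G. insert u R \<subseteq> G))"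
      by (rule Pr_Bex) (use finite_F ij fBad in auto)
    also have "\<dots> \<le> real (card (Bad j v)) * (C1 C / real n ^ (card R + 1))"
    proof (rule sum_bounded_above)
      fix u assume "u \<in> Bad j v"
      then have u: "u \<in> B j" by (simp add: Bad_def)
      then have ui: "u \<notin> B i" "u \<notin> R" using B_disj [OF ij] R by auto
      have "Pr (F i) (\<lambda>G. insert u R \<subseteq> G) \<le> C1 C / real n ^ card (insert u R)"
        by (rule Pr_contains_le) (use ij ui R dec in auto)
      moreover have "card (insert u R) = card R + 1" using ui R by simp
      ultimately show "Pr (F i) (\<lambda>G. insert u R \<subseteq> G) \<le> C1 C / real n ^ (card R + 1)" by (simp only:)
    qed
    also have "\<dots> \<le> (C4 C / eps1) * (C1 C / real n ^ (card R + 1))"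
      using card_Bad_le [OF ij(2) vB(2)] C1_pos [of C] by (intro mult_right_mono) auto
    finally show "Pr (F i) (\<lambda>G. \<exists>u\<in>Bad j v. insert u R \<subseteq> G) \<le> (C4 C / eps1) * (C1 C / real n ^ (card R + 1))" .
    have "Pr (F i) (\<lambda>G. R \<subseteq> G \<and> typical B \<tau> i G \<and> G \<inter> Bad j v = {}) \<le> 1 / real n ^ (sg + 3)"
    proof (rule Pr_killed_small [OF ij(1) dec(2)])
      fix G assume "G \<in> F i" "R \<subseteq> G \<and> typical B \<tau> i G \<and> G \<inter> Bad j v = {}"
      then show "killed (n div D1 C) i (G - B i)"
        by (intro killed_competitor [OF ij vB v(2)]) (use v ij in \<open>auto simp: typical_def\<close>)
    qed
    also have "\<dots> \<le> 1 / real n ^ (card R + 1)"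
      using n_pos R by (intro divide_left_mono power_increasing) auto
    finally show "Pr (F i) (\<lambda>G. R \<subseteq> G \<and> typical B \<tau> i G \<and> G \<inter> Bad j v = {}) \<le> 1 / real n ^ (card R + 1)" .
  qed
  also have "\<dots> = C5 C / real n ^ (card R + 1)" by (simp add: C5_def add_divide_distrib)
  finally show ?thesis .
qed

end

lemma (in overlap_problem) partitioned_exists:
  obtains C :: nat where "C \<ge> 1"
    "\<forall>\<^sub>F n in sequentially. \<forall>F. extremal n l m F \<longrightarrow> (\<exists>B \<tau>. partitioned n l m F C B \<tau>)"
proof -
  obtain C :: nat where C: "C \<ge> 1" and
    ev: "\<forall>\<^sub>F n in sequentially. \<forall>F. extremal n l m F \<longrightarrow> (\<exists>H B \<tau>. structured n l m F C H B \<tau>)"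
    by (rule structured_exists)
  have "\<forall>\<^sub>F n in sequentially. (C1 C + C3 C) / real n \<le> 1 / (2 * real C)"
    "\<forall>\<^sub>F n in sequentially. (C1 C + 1) / real n \<le> 1 / (2 * real C)"
    using C by (intro eventually_divide_le; simp)+
  with ev eventually_large [of C]
  have "\<forall>\<^sub>F n in sequentially. \<forall>F. extremal n l m F \<longrightarrow> (\<exists>B \<tau>. partitioned n l m F C B \<tau>)"
  proof eventually_elim
    case (elim n)
    show ?case
    proof (intro allI impI)
      fix F assume "extremal n l m F"
      then obtain H B \<tau> where st: "structured n l m F C H B \<tau>" using elim by blast
      interpret structured n l m F C H B \<tau> by (rule st)
      have "real l * C1 C / real n \<le> 1 / 2" "decays C n (D0 C)"
        using elim(2) unfolding large_def by linarith+
      then have "H = {}" using elim by (intro H_empty)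
      then have "partitioned n l m F C B \<tau>"
        using st elim(2) by (simp add: partitioned_def partitioned_axioms_def)
      then show "\<exists>B \<tau>. partitioned n l m F C B \<tau>" by blast
    qed
  qed
  with C show ?thesis by (rule that)
qed

section \<open>Orientation\<close>

text \<open>Two neighbouring terms of the Vandermonde sum suffice: \<open>ratio\<close> ensures that
  moving one chosen element from the second set to the first keeps at least a proportion c of the
  count.\<close>

lemma binomial_product_lt_vandermonde:
  assumes s: "s \<ge> 1" and t: "t \<ge> 1" and b: "b \<ge> t" and c: "0 \<le> c"
    and ratio: "c * (real (s + 1) * real (b + 1 - t)) \<le> real (a - s) * real t"
  shows "real ((a choose s) * (b choose t)) * (1 + c) \<le> real ((a + b) choose (s + t))"
proof -
  define f where "f i = (a choose i) * (b choose (s + t - i))" for i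
  have "(\<Sum>i\<in>{s, s + 1}. f i) \<le> (\<Sum>i\<le>s + t. f i)" using t by (intro sum_mono2) auto
  also have "\<dots> = (a + b) choose (s + t)" unfolding f_def by (rule vandermonde)
  finally have 1: "f s + f (s + 1) \<le> (a + b) choose (s + t)" by simp
  have sa: "real (s + 1) * real (a choose (s + 1)) = real (a - s) * real (a choose s)"
  proof (cases "s \<le> a")
    case True
    have "Suc s * (a choose Suc s) = (a - s) * (a choose s)"
      using binomial_absorb_comp [of a s] binomial_absorption [of s a] by (cases a) (auto simp: ac_simps)
    then have "real ((s + 1) * (a choose (s + 1))) = real ((a - s) * (a choose s))" by (simp only: Suc_eq_plus1)
    then show ?thesis by (simp only: of_nat_mult)
  qed simp
  have tb: "real t * real (b choose t) = real (b + 1 - t) * real (b choose (t - 1))"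
  proof -
    obtain t' where t': "t = Suc t'" using t by (cases t) auto
    have "Suc t' * (b choose Suc t') = (b - t') * (b choose t')"
      using binomial_absorb_comp [of b t'] binomial_absorption [of t' b] by (cases b) (auto simp: ac_simps)
    then have "real (Suc t' * (b choose Suc t')) = real ((b - t') * (b choose t'))" by simp
    then show ?thesis using t' b by (simp add: algebra_simps)
  qed
  have pos: "real (s + 1) * real (b + 1 - t) > 0" using b by simp
  have "(real (s + 1) * real (b + 1 - t)) * (c * (real (a choose s) * real (b choose t))) \<le>
        (real (a - s) * real t) * (real (a choose s) * real (b choose t))"
    using mult_right_mono [OF ratio, of "real (a choose s) * real (b choose t)"] by (simp add: ac_simps)
  also have "\<dots> = (real (a - s) * real (a choose s)) * (real t * real (b choose t))" by (simp only: ac_simps)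
  also have "\<dots> = (real (s + 1) * real (b + 1 - t)) * (real (a choose (s + 1)) * real (b choose (t - 1)))"
    unfolding sa [symmetric] tb by (simp only: ac_simps)
  finally have "c * (real (a choose s) * real (b choose t)) \<le> real (a choose (s + 1)) * real (b choose (t - 1))"
    using pos by (rule mult_left_le_imp_le)
  moreover have "f s = (a choose s) * (b choose t)" "f (s + 1) = (a choose (s + 1)) * (b choose (t - 1))"
    by (simp_all add: f_def)
  moreover have "real (f s) + real (f (s + 1)) \<le> real ((a + b) choose (s + t))"
    using 1 by (simp flip: of_nat_add)
  ultimately show ?thesis by (simp add: algebra_simps)
qed

lemma binomial_product_le:
  "(a choose s) * (b choose t) \<le> (a + b) choose (s + t)"
proof -
  have "(\<Sum>i\<in>{s}. (a choose i) * (b choose (s + t - i))) \<le> (\<Sum>i\<le>s + t. (a choose i) * (b choose (s + t - i)))"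
    by (intro sum_mono2) auto
  also have "\<dots> = (a + b) choose (s + t)" by (rule vandermonde)
  finally show ?thesis by simp
qed

locale grown = partitioned +
  assumes gr_ge: "gr n \<ge> 1 / (8 * real n)"
begin

text \<open>A growth of at least 1/(8n) forces total use of \<open>v\<close> by non-owners of at
  least 7/(64 n), more than l shares of c0/n.\<close>

lemma ex_limiter:
  assumes k: "k \<in> {1..l}" and v: "v \<in> B k"
  shows "\<exists>j\<in>{1..l} - {k}. q j v \<ge> c0 / real n"
proof (rule ccontr)
  assume no: "\<not> ?thesis"
  define s where "s = others k v"
  have vn: "v \<in> {1..n}" using v B_sub k by auto
  have s8: "s \<le> 1 / 8" using others_le [OF k v] n_large8 unfolding s_def by linarith
  have "gr n * (1 - s) \<le> s" unfolding s_def by (rule gr_le_others [OF vn k]) (use s8 in \<open>simp add: s_def\<close>)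
  moreover have "1 / (8 * real n) * (7 / 8) \<le> gr n * (1 - s)"
    using gr_ge s8 gr_nonneg [OF n_pos] by (intro mult_mono) auto
  ultimately have "1 / (8 * real n) * (7 / 8) \<le> s" by linarith
  moreover have "s \<le> (\<Sum>j\<in>{1..l} - {k}. c0 / real n)"
    unfolding s_def others_def by (intro sum_mono) (use no in force)
  moreover have "(\<Sum>j\<in>{1..l} - {k}. c0 / real n) \<le> (\<Sum>j\<in>{1..l}. c0 / real n)"
    using c0_pos by (intro sum_mono2) auto
  moreover have "(\<Sum>j\<in>{1..l}. c0 / real n) = 1 / (16 * real n)" using l_ge by (simp add: c0_def)
  ultimately have "1 / (8 * real n) * (7 / 8) \<le> 1 / (16 * real n)" by linarith
  then show False using n_pos by (simp add: field_simps)
qed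

definition own :: "nat \<Rightarrow> nat" where "own v = (THE k. k \<in> {1..l} \<and> v \<in> B k)"

definition limr :: "nat \<Rightarrow> nat" where
  "limr v = (SOME j. j \<in> {1..l} - {own v} \<and> q j v \<ge> c0 / real n)"

text \<open>The first index is the limited family, the second the owner, in agreement with
  \<open>\<tau> j k\<close> and with the direction of the edges.\<close>

definition A :: "nat \<Rightarrow> nat \<Rightarrow> nat set" where "A j k = {v\<in>{1..n}. own v = k \<and> limr v = j}"

lemma own_eq: "k \<in> {1..l} \<Longrightarrow> v \<in> B k \<Longrightarrow> own v = k"
  unfolding own_def using B_disj by (intro the_equality) auto

lemma own_mem:
  assumes "v \<in> {1..n}"
  shows "own v \<in> {1..l}" "v \<in> B (own v)"
proof -
  obtain k where "k \<in> {1..l}" "v \<in> B k" using assms cover by blast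
  then show "own v \<in> {1..l}" "v \<in> B (own v)" using own_eq by auto
qed

lemma B_eq:
  assumes "k \<in> {1..l}"
  shows "B k = {v\<in>{1..n}. own v = k}"
proof
  show "B k \<subseteq> {v\<in>{1..n}. own v = k}" using own_eq [OF assms] B_sub [OF assms] by blast
  show "{v\<in>{1..n}. own v = k} \<subseteq> B k" using own_mem(2) by blast
qed

lemma limr_mem:
  assumes "v \<in> {1..n}"
  shows "limr v \<in> {1..l}" "limr v \<noteq> own v" "q (limr v) v \<ge> c0 / real n"
proof -
  have "\<exists>j. j \<in> {1..l} - {own v} \<and> q j v \<ge> c0 / real n"
    using ex_limiter [OF own_mem [OF assms]] by blast
  from someI_ex [OF this] show "limr v \<in> {1..l}" "limr v \<noteq> own v" "q (limr v) v \<ge> c0 / real n"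
    by (auto simp: limr_def)
qed

lemma finite_A [simp]: "finite (A j k)"
  by (simp add: A_def)

lemma A_sub: "k \<in> {1..l} \<Longrightarrow> A j k \<subseteq> B k"
  by (auto simp: A_def B_eq)

lemma q_other_le:
  assumes v: "v \<in> {1..n}" and i: "i \<in> {1..l}" "i \<noteq> own v" "i \<noteq> limr v"
  shows "q i v \<le> C5 C / real n ^ 2"
proof -
  have "Pr (F i) (\<lambda>G. {v} \<subseteq> G) \<le> C5 C / real n ^ (card {v} + 1)"
    by (rule Pr_competitor_le [where j = "limr v" and v = v])
       (use i limr_mem [OF v] own_eq [of i v] own_eq [of "limr v" v] in auto)
  then show ?thesis by (simp add: q_def numeral_2_eq_2)
qed

text \<open>With cap 0 every member of \<open>F j\<close> through such a vertex is heavy, hence far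
  too rare for a use of c0/n.\<close>

lemma A_empty:
  assumes jk: "j \<in> {1..l}" "k \<in> {1..l}" "j \<noteq> k" and "\<tau> j k = 0"
  shows "A j k = {}"
proof (rule ccontr)
  assume "A j k \<noteq> {}"
  then obtain v where v: "v \<in> {1..n}" "own v = k" "limr v = j" by (auto simp: A_def)
  have "q j v \<le> Pr (F j) (heavy B \<tau> j)"
    unfolding q_def
  proof (rule Pr_mono)
    fix G assume G: "G \<in> F j" "v \<in> G"
    have "v \<in> G \<inter> B k" using own_mem [OF v(1)] v G by auto
    then have "card (G \<inter> B k) > 0" using finite_B [OF jk(2)] by (auto simp: card_gt_0_iff)
    then show "heavy B \<tau> j G" unfolding heavy_def
      by (intro bexI [of _ k]) (use jk assms(4) in auto)
  qed (use finite_F jk in auto)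
  also have "\<dots> \<le> 1 / real n ^ (sg + 3)" by (rule Pr_heavy_le [OF jk(1) dec(1)])
  also have "\<dots> \<le> 1 / real n ^ 2" using n_pos by (intro divide_left_mono power_increasing) auto
  also have "\<dots> = (1 / real n) / real n" by (simp add: power2_eq_square)
  also have "\<dots> \<le> (c0 / 2) / real n"
    using large unfolding large_def by (intro divide_right_mono) auto
  also have "\<dots> < c0 / real n" using c0_pos n_pos by (intro divide_strict_right_mono) auto
  finally show False using limr_mem(3) [OF v(1)] v by simp
qed

definition exact :: "nat \<Rightarrow> nat set \<Rightarrow> bool" where
  "exact j G \<longleftrightarrow> typical B \<tau> j G \<and> (\<forall>v\<in>G. own v = j \<or> limr v = j)"

lemma exact_Int:
  assumes "j \<in> {1..l}" "k \<in> {1..l}" "j \<noteq> k" "G \<in> F j" "exact j G"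
  shows "G \<inter> B k = G \<inter> A j k" "card (G \<inter> A j k) = \<tau> j k"
proof -
  show "G \<inter> B k = G \<inter> A j k"
    using assms unfolding exact_def A_def B_eq [OF assms(2)] by auto
  moreover have "card (G \<inter> B k) = \<tau> j k"
    using assms unfolding exact_def typical_def by blast
  ultimately show "card (G \<inter> A j k) = \<tau> j k" by simp
qed

text \<open>At most n vertices are of the wrong kind and each is used with probability O(1/n^2), so
  the union bound still gives O(1/n).\<close>

lemma Pr_exact_ge:
  assumes j: "j \<in> {1..l}"
  shows "1 - C6 C / real n \<le> Pr (F j) (exact j)"
proof -
  define U where "U = {v\<in>{1..n}. own v \<noteq> j \<and> limr v \<noteq> j}"
  have "Pr (F j) (\<lambda>G. \<not> exact j G) \<le> Pr (F j) (\<lambda>G. ({} \<subseteq> G \<and> \<not> typical B \<tau> j G) \<or> (\<exists>v\<in>U. v \<in> G))"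
    by (rule Pr_mono) (use finite_F j F_sub [OF j] in \<open>auto simp: exact_def U_def\<close>)
  also have "\<dots> \<le> Pr (F j) (\<lambda>G. {} \<subseteq> G \<and> \<not> typical B \<tau> j G) + Pr (F j) (\<lambda>G. \<exists>v\<in>U. v \<in> G)"
    by (rule Pr_disj) (use finite_F j in auto)
  also have "\<dots> \<le> C1 C / real n ^ (card ({}::nat set) + 1) + (\<Sum>v\<in>U. Pr (F j) (\<lambda>G. v \<in> G))"
    by (intro add_mono Pr_atypical_le Pr_Bex dec) (use finite_F j in \<open>auto simp: U_def\<close>)
  also have "(\<Sum>v\<in>U. Pr (F j) (\<lambda>G. v \<in> G)) \<le> real (card U) * (C5 C / real n ^ 2)"
    by (rule sum_bounded_above) (use q_other_le j in \<open>auto simp: U_def q_def\<close>)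
  also have "\<dots> \<le> real n * (C5 C / real n ^ 2)"
    using card_mono [of "{1..n}" U] C5_ge [of C] by (intro mult_right_mono) (auto simp: U_def)
  also have "C1 C / real n ^ (card ({}::nat set) + 1) + real n * (C5 C / real n ^ 2) = C6 C / real n"
    using n_pos by (simp add: C6_def power2_eq_square add_divide_distrib)
  finally have "Pr (F j) (\<lambda>G. \<not> exact j G) \<le> C6 C / real n" by simp
  moreover have "Pr (F j) (\<lambda>G. \<not> exact j G) = 1 - Pr (F j) (exact j)"
    by (rule Pr_compl) (use finite_F F_nonempty j in auto)
  ultimately show ?thesis by linarith
qed

lemma C6_half: "C6 C / real n \<le> 1 / 2"
  using large unfolding large_def by linarith

lemma card_F_exact_le:
  assumes j: "j \<in> {1..l}"
  shows "(1 - C6 C / real n) * real (card (F j)) \<le>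
    2 ^ card (B j) * (\<Prod>k\<in>{1..l} - {j}. real (card (A j k) choose \<tau> j k))"
proof -
  define \<O> where "\<O> = {G\<in>F j. exact j G}"
  have fin: "finite \<O>" "finite (B j)" using finite_F finite_B j by (auto simp: \<O>_def)
  have "card ((\<lambda>G. G - B j) ` \<O>) \<le>
      card {Y. Y \<subseteq> (\<Union>k\<in>{1..l} - {j}. A j k) \<and> (\<forall>k\<in>{1..l} - {j}. card (Y \<inter> A j k) = \<tau> j k)}"
  proof (rule card_mono)
    show "(\<lambda>G. G - B j) ` \<O> \<subseteq>
        {Y. Y \<subseteq> (\<Union>k\<in>{1..l} - {j}. A j k) \<and> (\<forall>k\<in>{1..l} - {j}. card (Y \<inter> A j k) = \<tau> j k)}"
    proof
      fix Y assume "Y \<in> (\<lambda>G. G - B j) ` \<O>"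
      then obtain G where G: "G \<in> F j" "exact j G" "Y = G - B j" by (auto simp: \<O>_def)
      have "Y \<subseteq> (\<Union>k\<in>{1..l} - {j}. A j k)"
      proof
        fix v assume v: "v \<in> Y"
        then have "v \<in> {1..n}" using G F_sub [OF j] by auto
        then show "v \<in> (\<Union>k\<in>{1..l} - {j}. A j k)"
          using v G own_mem [of v] B_eq [OF j] by (auto simp: exact_def A_def)
      qed
      moreover have "Y \<inter> A j k = G \<inter> A j k" if "k \<in> {1..l} - {j}" for k
        using A_sub [of k j] B_disj [OF j, of k] that G(3) by auto
      ultimately show "Y \<in> {Y. Y \<subseteq> (\<Union>k\<in>{1..l} - {j}. A j k) \<and> (\<forall>k\<in>{1..l} - {j}. card (Y \<inter> A j k) = \<tau> j k)}"
        using exact_Int(2) [OF j _ _ G(1,2)] by auto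
    qed
    show "finite {Y. Y \<subseteq> (\<Union>k\<in>{1..l} - {j}. A j k) \<and> (\<forall>k\<in>{1..l} - {j}. card (Y \<inter> A j k) = \<tau> j k)}"
      by (rule finite_subset [of _ "Pow (\<Union>k\<in>{1..l} - {j}. A j k)"]) auto
  qed
  also have "\<dots> = (\<Prod>k\<in>{1..l} - {j}. card (A j k) choose \<tau> j k)"
    by (rule card_exact_subsets) (auto simp: A_def)
  finally have "card \<O> \<le> 2 ^ card (B j) * (\<Prod>k\<in>{1..l} - {j}. card (A j k) choose \<tau> j k)"
    using card_le_pow_times_traces [OF fin] by (meson le_trans mult_le_mono2)
  then have "real (card \<O>) \<le> real (2 ^ card (B j) * (\<Prod>k\<in>{1..l} - {j}. card (A j k) choose \<tau> j k))"
    by (simp only: of_nat_le_iff)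
  moreover have "(1 - C6 C / real n) * real (card (F j)) \<le> real (card \<O>)"
    using Pr_exact_ge [OF j] card_F_pos [OF j] unfolding Pr_def \<O>_def [symmetric]
    by (simp add: pos_le_divide_eq)
  ultimately show ?thesis by simp
qed

lemma sum_card_B: "(\<Sum>j\<in>{1..l}. card (B j)) = n"
proof -
  have "(\<Sum>j\<in>{1..l}. card (B j)) = card (\<Union>j\<in>{1..l}. B j)"
    by (rule card_UN_disjoint [symmetric]) (use finite_B B_disj in auto)
  then show ?thesis unfolding cover [symmetric] by simp
qed

lemma s_star_le:
  "(1 - C6 C / real n) ^ l * real (s_star n l m) \<le>
     2 ^ n * (\<Prod>j\<in>{1..l}. \<Prod>k\<in>{1..l} - {j}. real (card (A j k) choose \<tau> j k))"
proof -
  have "(1 - C6 C / real n) ^ l * real (s_star n l m) = (\<Prod>j\<in>{1..l}. (1 - C6 C / real n) * real (card (F j)))"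
    unfolding prod_card [symmetric] by (simp add: prod.distrib)
  also have "\<dots> \<le> (\<Prod>j\<in>{1..l}. 2 ^ card (B j) * (\<Prod>k\<in>{1..l} - {j}. real (card (A j k) choose \<tau> j k)))"
  proof (intro prod_mono conjI card_F_exact_le mult_nonneg_nonneg)
    show "0 \<le> 1 - C6 C / real n" using C6_half by linarith
  qed auto
  also have "\<dots> = 2 ^ n * (\<Prod>j\<in>{1..l}. \<Prod>k\<in>{1..l} - {j}. real (card (A j k) choose \<tau> j k))"
    by (simp only: prod.distrib power_sum [symmetric] sum_card_B)
  finally show ?thesis .
qed

lemma sum_q_A_ge:
  assumes jk: "j \<in> {1..l}" "k \<in> {1..l}" "j \<noteq> k"
  shows "real (\<tau> j k) * (1 - C6 C / real n) \<le> (\<Sum>v\<in>A j k. q j v)"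
proof -
  have "real (\<tau> j k) * (1 - C6 C / real n) \<le> real (\<tau> j k) * Pr (F j) (exact j)"
    by (intro mult_left_mono Pr_exact_ge jk) auto
  also have "\<dots> \<le> (\<Sum>v\<in>A j k. Pr (F j) (\<lambda>G. exact j G \<and> v \<in> G))"
    by (rule sum_Pr_mem_ge) (use finite_F jk exact_Int in auto)
  also have "\<dots> \<le> (\<Sum>v\<in>A j k. q j v)"
    unfolding q_def by (intro sum_mono Pr_mono) (use finite_F jk in auto)
  finally show ?thesis .
qed

text \<open>The expected number of vertices used in \<open>A j k\<close> is at least 1/2 and each
  vertex contributes O(1/n), so the part has linear size.\<close>

lemma card_A_ge:
  assumes jk: "j \<in> {1..l}" "k \<in> {1..l}" "j \<noteq> k" and "\<tau> j k \<ge> 1"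
  shows "real n / (2 * C1 C) \<le> real (card (A j k))"
proof -
  have "1 * (1 / 2) \<le> real (\<tau> j k) * (1 - C6 C / real n)"
    using assms(4) C6_half by (intro mult_mono) auto
  also have "\<dots> \<le> (\<Sum>v\<in>A j k. q j v)" by (rule sum_q_A_ge [OF jk])
  also have "\<dots> \<le> real (card (A j k)) * (C1 C / real n)"
  proof (rule sum_bounded_above)
    fix v assume v: "v \<in> A j k"
    show "q j v \<le> C1 C / real n"
      by (rule q_le_off [OF jk(1)]) (use v A_sub [OF jk(2)] B_disj [OF jk] in blast)
  qed
  finally have "real n \<le> 2 * (real (card (A j k)) * C1 C)" using n_pos by (simp add: field_simps)
  then show ?thesis using C1_pos [of C] by (simp add: field_simps)
qed

lemma orientation:
  assumes jk: "j \<in> {1..l}" "k \<in> {1..l}" "j \<noteq> k"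
  shows "\<tau> j k = 0 \<or> \<tau> k j = 0"
proof (rule ccontr)
  assume "\<not> ?thesis"
  then have pos: "\<tau> j k \<ge> 1" "\<tau> k j \<ge> 1" by auto
  define a where "a i i' = card (A i i')" for i i'
  \<comment> \<open>Comparison example: the two parts of every pair are united, owned by the larger
    index and limited by the smaller with the full cap. By the plain Vandermonde bound no pair
    loses.\<close>
  define ow where "ow v = max (own v) (limr v)" for v
  define lm where "lm v = min (own v) (limr v)" for v
  define cc where "cc i i' = (if i < i' then m {i, i'} else 0)" for i i'
  have "2 ^ n * (\<Prod>i\<in>{1..l}. \<Prod>i'\<in>{1..l} - {i}. card {v\<in>{1..n}. ow v = i' \<and> lm v = i} choose cc i i') \<le> s_star n l m"
  proof (rule s_star_ge_Ideal)
    show "ow ` {1..n} \<subseteq> {1..l}" using own_mem limr_mem by (auto simp: ow_def max_def)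
  qed (auto simp: cc_def insert_commute)
  also have "(\<Prod>i\<in>{1..l}. \<Prod>i'\<in>{1..l} - {i}. card {v\<in>{1..n}. ow v = i' \<and> lm v = i} choose cc i i') =
      (\<Prod>(i, i')\<in>ordpairs l. (a i i' + a i' i) choose m {i, i'})"
    unfolding prod_offdiag
  proof (rule prod.cong [OF refl], clarify)
    fix i i' assume ii: "(i, i') \<in> ordpairs l"
    have lt: "i < i'" using ii by (simp add: ordpairs_def)
    have "(max (own v) (limr v) = i' \<and> min (own v) (limr v) = i) \<longleftrightarrow>
        (own v = i' \<and> limr v = i) \<or> (own v = i \<and> limr v = i')" for v
      using lt by linarith
    then have "{v\<in>{1..n}. ow v = i' \<and> lm v = i} = A i i' \<union> A i' i"
      unfolding ow_def lm_def A_def by blast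
    moreover have "A i i' \<inter> A i' i = {}" using less_imp_neq [OF lt] unfolding A_def by blast
    then have "card (A i i' \<union> A i' i) = a i i' + a i' i"
      unfolding a_def by (intro card_Un_disjoint finite_A)
    ultimately show "(card {v\<in>{1..n}. ow v = i' \<and> lm v = i} choose cc i i') *
        (card {v\<in>{1..n}. ow v = i \<and> lm v = i'} choose cc i' i) = (a i i' + a i' i) choose m {i, i'}"
      using ii by (simp add: cc_def ordpairs_def)
  qed
  finally have "real (2 ^ n * (\<Prod>(i, i')\<in>ordpairs l. (a i i' + a i' i) choose m {i, i'})) \<le> real (s_star n l m)"
    by (simp only: of_nat_le_iff)
  then have low: "2 ^ n * (\<Prod>(i, i')\<in>ordpairs l. real ((a i i' + a i' i) choose m {i, i'})) \<le> real (s_star n l m)"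
    by (simp add: case_prod_unfold)
  define P where "P x = (case x of (i, i') \<Rightarrow> real ((a i i' choose \<tau> i i') * (a i' i choose \<tau> i' i)))" for x
  define Q where "Q x = (case x of (i, i') \<Rightarrow> real ((a i i' + a i' i) choose m {i, i'}))" for x
  have PQ: "0 \<le> P x" "P x \<le> Q x" if "x \<in> ordpairs l" for x
  proof -
    obtain i i' where x: "x = (i, i')" "i \<in> {1..l}" "i' \<in> {1..l}" "i \<noteq> i'" using \<open>x \<in> ordpairs l\<close> by (auto simp: ordpairs_def)
    show "0 \<le> P x" by (simp add: P_def case_prod_unfold)
    have "(a i i' choose \<tau> i i') * (a i' i choose \<tau> i' i) \<le> (a i i' + a i' i) choose (\<tau> i i' + \<tau> i' i)"
      by (rule binomial_product_le)
    then show "P x \<le> Q x" unfolding P_def Q_def x(1) case_prod_conv type_sum [OF x(2-4)] of_nat_le_iff .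
  qed
  have up: "(1 - C6 C / real n) ^ l * real (s_star n l m) \<le> 2 ^ n * (\<Prod>x\<in>ordpairs l. P x)"
    using s_star_le unfolding prod_offdiag by (simp add: P_def a_def case_prod_unfold)
  \<comment> \<open>Both parts have linear size, so the neighbouring Vandermonde term keeps at least
    the constant proportion \<open>c7 C\<close>.\<close>
  have gain: "P (i, i') * (1 + c7 C) \<le> Q (i, i')"
    if ii: "i \<in> {1..l}" "i' \<in> {1..l}" "i \<noteq> i'" "\<tau> i i' \<ge> 1" "\<tau> i' i \<ge> 1" for i i'
  proof -
    have tle: "\<tau> i i' \<le> sg" "\<tau> i' i \<le> sg" using type_sum [OF ii(1-3)] m_le_sg [OF ii(1-3)] by linarith+
    have big: "4 * C1 C * (real sg + 1) \<le> real n"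
      using large n_pos unfolding large_def by (simp add: divide_le_eq)
    have C1p: "C1 C > 0" using C1_pos [of C] by simp
    have half: "real n / (4 * C1 C) \<ge> real sg + 1" using big C1p by (simp add: pos_le_divide_eq ac_simps)
    have quart: "real n / (2 * C1 C) = real n / (4 * C1 C) + real n / (4 * C1 C)" by (simp add: field_simps)
    have a1: "real (a i i') \<ge> real n / (4 * C1 C) + real n / (4 * C1 C)"
      using card_A_ge [OF ii(1-4)] unfolding a_def quart .
    have a2: "real (a i' i) \<ge> real n / (4 * C1 C) + real n / (4 * C1 C)"
      using card_A_ge [OF ii(2,1)] ii unfolding a_def quart by auto
    have an: "a i' i \<le> n" unfolding a_def using card_mono [of "{1..n}" "A i' i"] by (auto simp: A_def)
    have "P (i, i') * (1 + c7 C) = real ((a i i' choose \<tau> i i') * (a i' i choose \<tau> i' i)) * (1 + c7 C)"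
      by (simp add: P_def)
    also have "\<dots> \<le> real ((a i i' + a i' i) choose (\<tau> i i' + \<tau> i' i))"
    proof (rule binomial_product_lt_vandermonde)
      have "real sg + 1 \<le> real (a i' i)" using a2 half by linarith
      then show "\<tau> i' i \<le> a i' i" using tle by linarith
      have "c7 C * (real (\<tau> i i' + 1) * real (a i' i + 1 - \<tau> i' i)) \<le> c7 C * ((real sg + 1) * real n)"
        using c7_pos [of C] tle an ii by (intro mult_left_mono mult_mono) auto
      also have "\<dots> = real n / (4 * C1 C)"
      proof -
        have "real sg + 1 > 0" by simp
        then show ?thesis by (simp add: c7_def)
      qed
      also have "\<dots> \<le> real (a i i') - real (\<tau> i i')" using a1 half tle by linarith
      also have "\<dots> \<le> real (a i i' - \<tau> i i')" by linarith
      also have "\<dots> \<le> real (a i i' - \<tau> i i') * real (\<tau> i' i)"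
        using ii(5) mult_left_mono [of 1 "real (\<tau> i' i)" "real (a i i' - \<tau> i i')"] by simp
      finally show "c7 C * (real (\<tau> i i' + 1) * real (a i' i + 1 - \<tau> i' i)) \<le> real (a i i' - \<tau> i i') * real (\<tau> i' i)" .
    qed (use ii c7_pos [of C] in auto)
    finally show ?thesis using type_sum [OF ii(1-3)] by (simp add: Q_def)
  qed
  define x0 where "x0 = (min j k, max j k)"
  have x0: "x0 \<in> ordpairs l" using jk by (auto simp: x0_def ordpairs_def min_def max_def)
  have "P x0 * (1 + c7 C) \<le> Q x0"
    unfolding x0_def by (rule gain) (use jk pos in \<open>auto simp: min_def max_def\<close>)
  moreover have "0 \<le> Q x0" using PQ [OF x0] by linarith
  moreover have "(\<Prod>x\<in>ordpairs l - {x0}. P x) \<le> (\<Prod>x\<in>ordpairs l - {x0}. Q x)"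
    by (intro prod_mono) (use PQ in blast)
  moreover have "0 \<le> (\<Prod>x\<in>ordpairs l - {x0}. P x)" by (intro prod_nonneg) (use PQ in blast)
  ultimately have "(P x0 * (1 + c7 C)) * (\<Prod>x\<in>ordpairs l - {x0}. P x) \<le> Q x0 * (\<Prod>x\<in>ordpairs l - {x0}. Q x)"
    by (intro mult_mono)
  then have "(1 + c7 C) * (\<Prod>x\<in>ordpairs l. P x) \<le> Q x0 * (\<Prod>x\<in>ordpairs l - {x0}. Q x)"
    unfolding prod.remove [OF finite_ordpairs x0, of P] by (simp only: ac_simps)
  also have "\<dots> = (\<Prod>x\<in>ordpairs l. Q x)"
    unfolding prod.remove [OF finite_ordpairs x0, of Q] ..
  finally have PQ2: "(1 + c7 C) * (\<Prod>x\<in>ordpairs l. P x) \<le> (\<Prod>x\<in>ordpairs l. Q x)" .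
  have "((1 + c7 C) * (1 - C6 C / real n) ^ l) * real (s_star n l m) \<le> (1 + c7 C) * (2 ^ n * (\<Prod>x\<in>ordpairs l. P x))"
    using up c7_pos [of C] by (simp add: mult.assoc)
  also have "\<dots> = 2 ^ n * ((1 + c7 C) * (\<Prod>x\<in>ordpairs l. P x))" by (simp add: ac_simps)
  also have "\<dots> \<le> 2 ^ n * (\<Prod>x\<in>ordpairs l. Q x)" using PQ2 by (intro mult_left_mono) auto
  also have "\<dots> \<le> 1 * real (s_star n l m)" using low by (simp add: Q_def)
  finally have "(1 + c7 C) * (1 - C6 C / real n) ^ l \<le> 1"
    by (rule mult_right_le_imp_le) (simp add: s_star_pos)
  \<comment> \<open>The gain 1 + c7 meets a loss of at most c7/4, and (1 + c7)(1 - c7/4) > 1 because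
    0 < c7 \<le> 1.\<close>
  moreover have "1 - c7 C / 4 \<le> (1 - C6 C / real n) ^ l"
  proof -
    have "1 + real l * (- (C6 C / real n)) \<le> (1 + - (C6 C / real n)) ^ l"
      by (intro Bernoulli_inequality) (use C6_half in linarith)
    moreover have "real l * C6 C / real n \<le> c7 C / 4" using large unfolding large_def by linarith
    ultimately show ?thesis by simp
  qed
  then have "(1 + c7 C) * (1 - c7 C / 4) \<le> (1 + c7 C) * (1 - C6 C / real n) ^ l"
    using c7_pos [of C] by (intro mult_left_mono) auto
  moreover have "(1 + c7 C) * (1 - c7 C / 4) = 1 + c7 C - c7 C / 4 - c7 C * c7 C / 4"
    by (simp add: distrib_right right_diff_distrib add_divide_distrib)
  moreover have "c7 C * c7 C \<le> c7 C * 1" using c7_pos [of C] by (intro mult_left_mono) auto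
  ultimately show False using c7_pos [of C] by simp
qed

lemma type_cases:
  assumes "j \<in> {1..l}" "k \<in> {1..l}" "j \<noteq> k"
  shows "\<tau> j k = 0 \<or> \<tau> j k = m {j, k}"
  using orientation [OF assms] type_sum [OF assms] by auto

end

text \<open>An extremal example on n - 1 points supplies the growth bound at n; the shift by 2 in
  the threshold keeps n - 1 both in range and positive.\<close>

lemma (in overlap_problem) grown_exists:
  obtains C :: nat where "C \<ge> 1"
    "\<forall>\<^sub>F n in sequentially. \<forall>F. extremal n l m F \<longrightarrow> (\<exists>B \<tau>. grown n l m F C B \<tau>)"
proof -
  obtain C :: nat where C: "C \<ge> 1" and
    ev: "\<forall>\<^sub>F n in sequentially. \<forall>F. extremal n l m F \<longrightarrow> (\<exists>B \<tau>. partitioned n l m F C B \<tau>)"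
    by (rule partitioned_exists)
  then obtain N where N: "\<And>n F. n \<ge> N \<Longrightarrow> extremal n l m F \<Longrightarrow> \<exists>B \<tau>. partitioned n l m F C B \<tau>"
    unfolding eventually_sequentially by blast
  have "\<exists>B \<tau>. grown n l m F C B \<tau>" if n: "n \<ge> N + 2" and F: "extremal n l m F" for n F
  proof -
    obtain F' where F': "extremal (n - 1) l m F'" using ex_extremal by blast
    have "n - 1 \<ge> N" using n by simp
    then obtain B' \<tau>' where "partitioned (n - 1) l m F' C B' \<tau>'" using N F' by blast
    then interpret prev: partitioned "n - 1" l m F' C B' \<tau>' .
    have "gr n \<ge> 1 / (8 * real (n - 1))" using prev.gr_Suc_ge n by simp
    moreover have "1 / (8 * real n) \<le> 1 / (8 * real (n - 1))" using n by (intro divide_left_mono) auto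
    ultimately have g: "gr n \<ge> 1 / (8 * real n)" by (meson order_trans)
    obtain B \<tau> where "partitioned n l m F C B \<tau>" using N [of n F] n F by auto
    then have "grown n l m F C B \<tau>" using g by (simp add: grown_def grown_axioms_def)
    then show ?thesis by blast
  qed
  then have "\<forall>\<^sub>F n in sequentially. \<forall>F. extremal n l m F \<longrightarrow> (\<exists>B \<tau>. grown n l m F C B \<tau>)"
    unfolding eventually_sequentially by blast
  with C show ?thesis by (rule that)
qed

section \<open>Growth rate and part sizes\<close>

lemma ex_le_average:
  fixes f :: "'a \<Rightarrow> real"
  assumes "finite S" "S \<noteq> {}" "(\<Sum>v\<in>S. f v) \<le> c"
  shows "\<exists>v\<in>S. f v \<le> c / real (card S)"
proof (rule ccontr)
  assume "\<not> ?thesis"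
  then have "(\<Sum>v\<in>S. c / real (card S)) < (\<Sum>v\<in>S. f v)"
    using assms by (intro sum_strict_mono) auto
  then show False using assms by simp
qed

lemma ex_ge_average:
  fixes f :: "'a \<Rightarrow> real"
  assumes "finite S" "S \<noteq> {}" "c \<le> (\<Sum>v\<in>S. f v)"
  shows "\<exists>v\<in>S. c / real (card S) \<le> f v"
  using ex_le_average [of S "\<lambda>v. - f v" "- c"] assms by (auto simp: sum_negf)

text \<open>Here h is the owner's deficit, x the use by the others, y and z consecutive growth
  ratios. To first order deletion gives h \<le> x - y and cloning gives z \<ge> x - h/2; eliminating
  h yields the mean of x and y, with all products O(t^2).\<close>

lemma growth_step:
  fixes h x y z t :: real
  assumes "0 \<le> h" "0 \<le> x" "x \<le> t" "0 \<le> y" "t \<le> 1 / 8"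
    and del: "(1 + h) * (1 - x) * (1 + y) \<le> 1" and clone: "(1 - h / 2) * (1 + x) \<le> 1 + z"
  shows "(x + y) / 2 - 5 * (t * t) \<le> z"
proof -
  have t0: "0 \<le> t" using assms by linarith
  have "1 * (1 - x) * (1 + y) \<le> (1 + h) * (1 - x) * (1 + y)"
    using assms by (intro mult_right_mono) auto
  then have "(1 - x) * (1 + y) \<le> 1" using del by linarith
  then have y1: "y * (1 - x) \<le> x" by (simp add: algebra_simps)
  have "y * (1 / 2) \<le> y * (1 - x)" using assms by (intro mult_left_mono) auto
  then have y2: "y \<le> 2 * t" using y1 assms by linarith
  define d where "d = x - y + x * y"
  have d: "(1 - x) * (1 + y) = 1 - d" by (simp add: d_def algebra_simps)
  have hd: "h \<le> d + h * d"
  proof -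
    have "(1 + h) * (1 - d) \<le> 1" using del by (simp only: d [symmetric] mult.assoc)
    then show ?thesis by (simp add: algebra_simps)
  qed
  have xy: "x * y \<le> 2 * (t * t)"
  proof -
    have "x * y \<le> t * (2 * t)" using assms y2 t0 by (intro mult_mono) auto
    then show ?thesis by simp
  qed
  have tt: "t * t \<le> t * (1 / 8)" using assms t0 by (intro mult_left_mono) auto
  have d2: "d \<le> 5 / 4 * t" using xy tt assms unfolding d_def by linarith
  have d0: "d \<le> 5 / 32" using d2 assms by linarith
  have "h * d \<le> h * (5 / 32)" using d0 assms by (intro mult_left_mono) auto
  then have h1: "h \<le> 2 * t" using hd d2 t0 by linarith
  have "h * d \<le> h * (5 / 4 * t)" using d2 assms by (intro mult_left_mono) auto
  also have "\<dots> \<le> 2 * t * (5 / 4 * t)" using h1 t0 by (intro mult_right_mono) auto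
  finally have "h \<le> d + 5 / 2 * (t * t)" using hd by simp
  then have h2: "h \<le> x - y + 9 / 2 * (t * t)" using xy by (simp add: d_def)
  have "h * x \<le> 2 * t * t" using h1 assms t0 by (intro mult_mono) auto
  then have hx: "h * x \<le> 2 * (t * t)" by simp
  have "(1 - h / 2) * (1 + x) = 1 + x - h / 2 - (h * x) / 2" by (simp add: algebra_simps)
  then have "1 + x - h / 2 - (h * x) / 2 \<le> 1 + z" using clone by simp
  moreover have "0 \<le> t * t" by simp
  ultimately show ?thesis using h2 hx unfolding add_divide_distrib by linarith
qed

text \<open>The defect s/n - f(n) is halved at each step up to c/n^2. With K \<ge> 6c the new defect
  is at most (1/2 + 1/6) K/n^2, and 2/3 \<le> (n/(n+1))^2 from n = 5 on.\<close>

lemma growth_recursion: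
  fixes f :: "nat \<Rightarrow> real"
  assumes s: "s \<ge> 0" and c: "c \<ge> 0"
    and step: "\<And>n. n \<ge> N \<Longrightarrow> (s / real n + f n) / 2 - c / real n ^ 2 \<le> f (Suc n)"
  obtains K where "K \<ge> 0" "\<forall>\<^sub>F n in sequentially. s / real n - K / real n ^ 2 \<le> f n"
proof -
  define M where "M = N + 5"
  define K where "K = max (6 * c) ((s / real M - f M) * real M ^ 2)"
  have K: "K \<ge> 6 * c" "K \<ge> 0" using c by (auto simp: K_def)
  have "s / real n - f n \<le> K / real n ^ 2" if "n \<ge> M" for n
    using that
  proof (induction n rule: dec_induct)
    case base
    have "(s / real M - f M) * real M ^ 2 \<le> K" by (simp add: K_def)
    then show ?case by (subst pos_le_divide_eq) (auto simp: M_def)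
  next
    case (step n)
    have n5: "n \<ge> 5" using step by (simp add: M_def)
    have "(s / real n + f n) / 2 - c / real n ^ 2 \<le> f (Suc n)" using step by (intro assms(3)) (simp add: M_def)
    moreover have "s / real (Suc n) \<le> s / real n" using s n5 by (intro divide_left_mono) auto
    ultimately have "s / real (Suc n) - f (Suc n) \<le> (s / real n - f n) / 2 + c / real n ^ 2"
      unfolding add_divide_distrib diff_divide_distrib by linarith
    also have "\<dots> \<le> (K / real n ^ 2) / 2 + (K / 6) / real n ^ 2"
      using step K by (intro add_mono divide_right_mono) auto
    also have "\<dots> = (K * (2 / 3)) / real n ^ 2" by (simp add: field_simps)
    also have "\<dots> \<le> K / real (Suc n) ^ 2"
    proof -
      have "2 * (real n + 1) ^ 2 \<le> 3 * real n ^ 2"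
      proof -
        have "5 * real n \<le> real n * real n" using n5 by (intro mult_right_mono) auto
        moreover have "5 \<le> real n" using n5 by simp
        moreover have "2 * (real n + 1) ^ 2 = 2 * (real n * real n) + 4 * real n + 2"
          by (simp add: power2_eq_square algebra_simps)
        moreover have "3 * real n ^ 2 = 3 * (real n * real n)" by (simp add: power2_eq_square)
        ultimately show ?thesis by linarith
      qed
      then have "(2 / 3) * real (Suc n) ^ 2 \<le> real n ^ 2" by (simp add: add.commute)
      then have "K * ((2 / 3) * real (Suc n) ^ 2) \<le> K * real n ^ 2" using K by (intro mult_left_mono) auto
      then show ?thesis using n5 by (simp add: divide_le_eq pos_le_divide_eq mult.assoc)
    qed
    finally show ?case .
  qed
  then have "\<forall>\<^sub>F n in sequentially. s / real n - K / real n ^ 2 \<le> f n"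
    unfolding eventually_sequentially by (intro exI [of _ M]) (auto simp: algebra_simps)
  with K(2) show ?thesis by (rule that)
qed

context overlap_problem
begin

definition C8 :: "nat \<Rightarrow> real" where "C8 C = real l * C5 C + 2 * (real l * C1 C) ^ 2"

definition C10 :: "nat \<Rightarrow> real" where "C10 C = 5 * (real l * C1 C) ^ 2 + real sg * C6 C"

lemma C8_nonneg: "C8 C \<ge> 0"
  using C5_ge [of C] by (simp add: C8_def)

lemma C10_nonneg: "C10 C \<ge> 0"
  using C6_pos [of C] by (simp add: C10_def)

end

context grown
begin

lemma card_A_pos:
  assumes "j \<in> {1..l}" "k \<in> {1..l}" "j \<noteq> k" "\<tau> j k \<ge> 1"
  shows "card (A j k) > 0"
proof -
  have "0 < real n / (2 * C1 C)" using n_pos C1_pos [of C] by simp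
  also have "\<dots> \<le> real (card (A j k))" by (rule card_A_ge [OF assms])
  finally show ?thesis by simp
qed

lemma sum_card_A: "(\<Sum>j\<in>{1..l}. \<Sum>k\<in>{1..l} - {j}. card (A j k)) = n"
proof -
  have "(\<Sum>k\<in>{1..l} - {j}. card (A j k)) = card {v\<in>{1..n}. limr v = j}" if "j \<in> {1..l}" for j
  proof -
    have "(\<Sum>k\<in>{1..l} - {j}. card (A j k)) = card (\<Union>k\<in>{1..l} - {j}. A j k)"
      by (rule card_UN_disjoint [symmetric]) (auto simp: A_def)
    also have "(\<Union>k\<in>{1..l} - {j}. A j k) = {v\<in>{1..n}. limr v = j}"
      using own_mem limr_mem limr_mem(2) [THEN not_sym] by (auto simp: A_def)
    finally show ?thesis .
  qed
  then have "(\<Sum>j\<in>{1..l}. \<Sum>k\<in>{1..l} - {j}. card (A j k)) = (\<Sum>j\<in>{1..l}. card {v\<in>{1..n}. limr v = j})"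
    by (intro sum.cong) auto
  also have "\<dots> = card (\<Union>j\<in>{1..l}. {v\<in>{1..n}. limr v = j})"
    by (rule card_UN_disjoint [symmetric]) auto
  also have "(\<Union>j\<in>{1..l}. {v\<in>{1..n}. limr v = j}) = {1..n}" using limr_mem by auto
  finally show ?thesis by simp
qed

lemma sum_tau: "(\<Sum>j\<in>{1..l}. \<Sum>k\<in>{1..l} - {j}. \<tau> j k) = sg"
  using sum_deg [of \<tau>] type_sum by (simp add: deg_def)

text \<open>Every member of \<open>F j\<close> has at most \<open>m {j, k} = \<tau> j k\<close>
  vertices in \<open>A j k\<close>, so an average vertex there has use at most \<tau>/|A| plus the
  O(1/n^2) of third families. Deleting a vertex of at most average use bounds the growth.\<close>

lemma gr_upper:
  assumes jk: "j \<in> {1..l}" "k \<in> {1..l}" "j \<noteq> k" and t: "\<tau> j k \<ge> 1"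
  shows "gr n \<le> real (\<tau> j k) / real (card (A j k)) + C8 C / real n ^ 2"
proof -
  define a where "a = real (card (A j k))"
  have a0: "a > 0" using card_A_pos [OF jk t] by (simp add: a_def)
  have "(\<Sum>v\<in>A j k. others k v) = (\<Sum>i\<in>{1..l} - {k}. \<Sum>v\<in>A j k. q i v)"
    unfolding others_def by (rule sum.swap)
  also have "\<dots> = (\<Sum>v\<in>A j k. q j v) + (\<Sum>i\<in>{1..l} - {k} - {j}. \<Sum>v\<in>A j k. q i v)"
    using jk by (subst sum.remove [of _ j]) auto
  also have "\<dots> \<le> real (\<tau> j k) + real l * (a * (C5 C / real n ^ 2))"
  proof (rule add_mono)
    have "(\<Sum>v\<in>A j k. Pr (F j) (\<lambda>G. True \<and> v \<in> G)) \<le> real (\<tau> j k) * Pr (F j) (\<lambda>G. True)"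
    proof (rule sum_Pr_mem_le)
      fix G assume G: "G \<in> F j"
      have "card (G \<inter> A j k) \<le> card (G \<inter> B k)"
        using A_sub [OF jk(2), of j] finite_B [OF jk(2)] by (intro card_mono) auto
      also have "\<dots> \<le> m {j, k}" by (rule card_trace_le [OF jk G])
      also have "\<dots> = \<tau> j k" using type_cases [OF jk] t by auto
      finally show "card (G \<inter> A j k) \<le> \<tau> j k" .
    qed (use finite_F jk in auto)
    also have "\<dots> \<le> real (\<tau> j k) * 1" using finite_F jk by (intro mult_left_mono Pr_le_1) auto
    finally show "(\<Sum>v\<in>A j k. q j v) \<le> real (\<tau> j k)" by (simp add: q_def)
    have "(\<Sum>i\<in>{1..l} - {k} - {j}. \<Sum>v\<in>A j k. q i v) \<le> (\<Sum>i\<in>{1..l} - {k} - {j}. a * (C5 C / real n ^ 2))"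
      unfolding a_def by (intro sum_mono sum_bounded_above q_other_le) (auto simp: A_def)
    also have "\<dots> \<le> (\<Sum>i\<in>{1..l}. a * (C5 C / real n ^ 2))"
      using a0 C5_ge [of C] by (intro sum_mono2) auto
    finally show "(\<Sum>i\<in>{1..l} - {k} - {j}. \<Sum>v\<in>A j k. q i v) \<le> real l * (a * (C5 C / real n ^ 2))" by simp
  qed
  finally have "\<exists>v\<in>A j k. others k v \<le> (real (\<tau> j k) + real l * (a * (C5 C / real n ^ 2))) / a"
    unfolding a_def by (intro ex_le_average) (use a0 in \<open>auto simp: a_def\<close>)
  then obtain v where v: "v \<in> A j k" "others k v \<le> (real (\<tau> j k) + real l * (a * (C5 C / real n ^ 2))) / a" by blast
  define s where "s = others k v"
  define t where "t = real l * C1 C / real n"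
  have s1: "s \<le> real (\<tau> j k) / a + real l * C5 C / real n ^ 2"
    using v(2) a0 by (simp add: s_def add_divide_distrib)
  have vB: "v \<in> B k" using v A_sub jk by blast
  have s0: "0 \<le> s" using others_nonneg by (simp add: s_def)
  have st: "s \<le> t" unfolding s_def t_def by (rule others_le [OF jk(2) vB])
  have t8: "t \<le> 1 / 8" unfolding t_def by (rule n_large8)
  have vn: "v \<in> {1..n}" using v by (simp add: A_def)
  have g: "gr n * (1 - s) \<le> s" unfolding s_def by (rule gr_le_others [OF vn jk(2)]) (use st t8 s_def in linarith)
  have g0: "0 \<le> gr n" by (rule gr_nonneg [OF n_pos])
  have "gr n * (1 / 2) \<le> gr n * (1 - s)" using st t8 g0 by (intro mult_left_mono) auto
  then have g2: "gr n \<le> 2 * t" using g st by linarith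
  have "gr n * s \<le> 2 * t * t" using g2 st s0 g0 by (intro mult_mono) auto
  then have "gr n \<le> s + 2 * (t * t)" using g by (simp add: algebra_simps)
  also have "t * t = (real l * C1 C) ^ 2 / real n ^ 2" by (simp add: t_def power2_eq_square)
  finally show ?thesis using s1 by (simp add: C8_def a_def add_divide_distrib)
qed

text \<open>The parts sum to n and the caps to \<open>sg\<close>, so some part with positive cap has
  at most its proportional share. Its vertices have average use of nearly sg/n or more, which drives
  the recursion.\<close>

lemma ex_dense_pair:
  "\<exists>j\<in>{1..l}. \<exists>k\<in>{1..l} - {j}. \<tau> j k \<ge> 1 \<and> sg * card (A j k) \<le> \<tau> j k * n"
proof (rule ccontr)
  assume no: "\<not> ?thesis"
  have le: "\<tau> j k * n \<le> sg * card (A j k)" if "j \<in> {1..l}" "k \<in> {1..l} - {j}" for j k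
  proof (cases "\<tau> j k \<ge> 1")
    case True
    then show ?thesis using no that by (meson nat_le_linear)
  next
    case False
    then have "\<tau> j k = 0" by linarith
    then show ?thesis by simp
  qed
  have "\<exists>j\<in>{1..l}. \<exists>k\<in>{1..l} - {j}. \<tau> j k \<noteq> 0"
  proof (rule ccontr)
    assume "\<not> ?thesis"
    then have "(\<Sum>j\<in>{1..l}. \<Sum>k\<in>{1..l} - {j}. \<tau> j k) = 0" by simp
    then show False using sum_tau sg_pos by simp
  qed
  then obtain j k where jk: "j \<in> {1..l}" "k \<in> {1..l} - {j}" "\<tau> j k \<noteq> 0" by blast
  then have lt: "\<tau> j k * n < sg * card (A j k)" using no by (force simp: One_nat_def Suc_le_eq)
  have "(\<Sum>j\<in>{1..l}. \<Sum>k\<in>{1..l} - {j}. \<tau> j k * n) < (\<Sum>j\<in>{1..l}. \<Sum>k\<in>{1..l} - {j}. sg * card (A j k))"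
  proof (rule sum_strict_mono_ex1)
    show "\<forall>x\<in>{1..l}. (\<Sum>k\<in>{1..l} - {x}. \<tau> x k * n) \<le> (\<Sum>k\<in>{1..l} - {x}. sg * card (A x k))"
      using le by (intro ballI sum_mono)
    show "\<exists>a\<in>{1..l}. (\<Sum>k\<in>{1..l} - {a}. \<tau> a k * n) < (\<Sum>k\<in>{1..l} - {a}. sg * card (A a k))"
    proof (rule bexI [OF _ jk(1)])
      show "(\<Sum>k\<in>{1..l} - {j}. \<tau> j k * n) < (\<Sum>k\<in>{1..l} - {j}. sg * card (A j k))"
        by (rule sum_strict_mono_ex1) (use le jk lt in auto)
    qed
  qed simp
  then have "(\<Sum>j\<in>{1..l}. \<Sum>k\<in>{1..l} - {j}. \<tau> j k) * n < sg * (\<Sum>j\<in>{1..l}. \<Sum>k\<in>{1..l} - {j}. card (A j k))"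
    by (simp only: sum_distrib_right sum_distrib_left)
  then show False unfolding sum_tau sum_card_A by simp
qed

lemma gr_step: "(real sg / real n + gr n) / 2 - C10 C / real n ^ 2 \<le> gr (Suc n)"
proof -
  obtain j k where jk: "j \<in> {1..l}" "k \<in> {1..l}" "j \<noteq> k" and t: "\<tau> j k \<ge> 1"
    and dense: "sg * card (A j k) \<le> \<tau> j k * n" using ex_dense_pair by blast
  define a where "a = real (card (A j k))"
  have a0: "a > 0" using card_A_pos [OF jk t] by (simp add: a_def)
  have "real (sg * card (A j k)) \<le> real (\<tau> j k * n)" using dense by (simp only: of_nat_le_iff)
  then have d: "real sg / real n \<le> real (\<tau> j k) / a"
    using a0 n_pos by (simp add: a_def divide_le_eq pos_le_divide_eq field_simps)
  have "\<exists>v\<in>A j k. real (\<tau> j k) * (1 - C6 C / real n) / real (card (A j k)) \<le> q j v"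
    by (rule ex_ge_average) (use sum_q_A_ge [OF jk] a0 in \<open>auto simp: a_def\<close>)
  then obtain v where v: "v \<in> A j k" "real (\<tau> j k) * (1 - C6 C / real n) / a \<le> q j v" by (auto simp: a_def)
  define x where "x = others k v"
  define T where "T = real l * C1 C / real n"
  have vB: "v \<in> B k" using v A_sub jk by blast
  have vn: "v \<in> {1..n}" using v by (simp add: A_def)
  have "q j v \<le> x" unfolding x_def others_def by (rule member_le_sum) (use jk in auto)
  moreover have "(real sg / real n) * (1 - C6 C / real n) \<le> (real (\<tau> j k) / a) * (1 - C6 C / real n)"
    using d C6_half by (intro mult_right_mono) linarith+
  ultimately have "(real sg / real n) * (1 - C6 C / real n) \<le> x" using v(2) by simp
  moreover have "(real sg / real n) * (1 - C6 C / real n) = real sg / real n - real sg * C6 C / real n ^ 2"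
    by (simp add: power2_eq_square right_diff_distrib)
  ultimately have x1: "real sg / real n - real sg * C6 C / real n ^ 2 \<le> x" by simp
  have "(x + gr n) / 2 - 5 * (T * T) \<le> gr (Suc n)"
  proof (rule growth_step [where h = "1 - 2 * q k v"])
    show "0 \<le> 1 - 2 * q k v" using q_le_half [OF jk(2), of v] by simp
    show "0 \<le> x" using others_nonneg by (simp add: x_def)
    show "x \<le> T" unfolding x_def T_def by (rule others_le [OF jk(2) vB])
    show "T \<le> 1 / 8" unfolding T_def by (rule n_large8)
    show "0 \<le> gr n" by (rule gr_nonneg [OF n_pos])
    show "(1 + (1 - 2 * q k v)) * (1 - x) * (1 + gr n) \<le> 1" unfolding x_def by (rule delete_gr [OF vn jk(2)])
    show "(1 - (1 - 2 * q k v) / 2) * (1 + x) \<le> 1 + gr (Suc n)" unfolding x_def by (rule clone_gr [OF vn jk(2)])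
  qed
  moreover have "C10 C / real n ^ 2 = 5 * (T * T) + real sg * C6 C / real n ^ 2"
    by (simp add: C10_def add_divide_distrib T_def power2_eq_square)
  moreover have "0 \<le> real sg * C6 C / real n ^ 2" using C6_pos [of C] by simp
  moreover have "(s + y) / 2 - (5 * P + Q) \<le> z" if "(x + y) / 2 - 5 * P \<le> z" "0 \<le> Q" "s - Q \<le> x" for s y P Q z
    using that unfolding add_divide_distrib by linarith
  ultimately show ?thesis using x1 by simp
qed

text \<open>Lower and upper bounds on the growth meet in an upper bound for every part. Parts and
  target sizes both sum to n, so the slacks d sum to at most l^2 \<kappa>; this gives the lower
  bounds.\<close>

lemma card_A_approx:
  assumes K: "K \<ge> 0" "real sg / real n - K / real n ^ 2 \<le> gr n" and jk: "j \<in> {1..l}" "k \<in> {1..l}" "j \<noteq> k"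
  shows "\<bar>real (card (A j k)) - real (\<tau> j k) * real n / real sg\<bar> \<le> real (l * l) * (K + C8 C)"
proof -
  define \<kappa> where "\<kappa> = K + C8 C"
  have \<kappa>0: "\<kappa> \<ge> 0" using K C8_nonneg [of C] by (simp add: \<kappa>_def)
  have upper: "real (card (A j k)) \<le> real (\<tau> j k) * real n / real sg + \<kappa>"
    if jk: "j \<in> {1..l}" "k \<in> {1..l}" "j \<noteq> k" for j k
  proof (cases "\<tau> j k \<ge> 1")
    case True
    define a where "a = real (card (A j k))"
    have a0: "a > 0" using card_A_pos [OF jk True] by (simp add: a_def)
    have an: "a \<le> real n" unfolding a_def using card_mono [of "{1..n}" "A j k"] by (auto simp: A_def)
    have "real sg / real n - \<kappa> / real n ^ 2 \<le> real (\<tau> j k) / a"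
      using gr_upper [OF jk True] K unfolding a_def \<kappa>_def add_divide_distrib by linarith
    then have "(real sg / real n - \<kappa> / real n ^ 2) * a \<le> real (\<tau> j k)" using a0 by (simp add: pos_le_divide_eq)
    then have "(real sg / real n - \<kappa> / real n ^ 2) * a * real n \<le> real (\<tau> j k) * real n"
      by (rule mult_right_mono) simp
    moreover have "(real sg / real n - \<kappa> / real n ^ 2) * a * real n = real sg * a - \<kappa> * (a / real n)"
      using n_pos by (simp add: field_simps power2_eq_square)
    moreover have "\<kappa> * (a / real n) \<le> \<kappa> * 1" using an n_pos \<kappa>0 by (intro mult_left_mono) auto
    moreover have "\<kappa> \<le> real sg * \<kappa>" using sg_pos \<kappa>0 mult_right_mono [of 1 "real sg" \<kappa>] by simp
    ultimately have "real sg * a \<le> real (\<tau> j k) * real n + real sg * \<kappa>" by linarith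
    then have "a \<le> (real (\<tau> j k) * real n + real sg * \<kappa>) / real sg"
      using sg_pos by (simp add: pos_le_divide_eq mult.commute)
    then show ?thesis using sg_pos by (simp add: a_def add_divide_distrib)
  next
    case False
    then have "A j k = {}" using A_empty [OF jk] by (simp add: One_nat_def not_le)
    then show ?thesis using \<kappa>0 by simp
  qed
  have "real (card (A j k)) \<ge> real (\<tau> j k) * real n / real sg - real (l * l) * \<kappa>"
  proof -
    define d where "d i i' = real (\<tau> i i') * real n / real sg + \<kappa> - real (card (A i i'))" for i i'
    have d0: "0 \<le> d i i'" if "i \<in> {1..l}" "i' \<in> {1..l} - {i}" for i i' using upper [of i i'] that by (auto simp: d_def)
    have "d j k \<le> (\<Sum>i'\<in>{1..l} - {j}. d j i')" by (rule member_le_sum) (use d0 jk in auto)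
    also have "\<dots> \<le> (\<Sum>i\<in>{1..l}. \<Sum>i'\<in>{1..l} - {i}. d i i')"
      by (rule member_le_sum [of j "{1..l}" "\<lambda>i. \<Sum>i'\<in>{1..l} - {i}. d i i'"]) (use d0 jk in \<open>auto intro: sum_nonneg\<close>)
    also have "\<dots> = real (\<Sum>i\<in>{1..l}. \<Sum>i'\<in>{1..l} - {i}. \<tau> i i') * real n / real sg
        + (\<Sum>i\<in>{1..l}. \<Sum>i'\<in>{1..l} - {i}. \<kappa>) - real (\<Sum>i\<in>{1..l}. \<Sum>i'\<in>{1..l} - {i}. card (A i i'))"
      unfolding d_def by (simp add: sum.distrib sum_subtractf sum_distrib_right sum_divide_distrib)
    also have "\<dots> = (\<Sum>i\<in>{1..l}. \<Sum>i'\<in>{1..l} - {i}. \<kappa>)"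
      unfolding sum_tau sum_card_A using sg_pos by simp
    also have "\<dots> \<le> (\<Sum>i\<in>{1..l}. \<Sum>i'\<in>{1..l}. \<kappa>)"
      using \<kappa>0 by (intro sum_mono sum_mono2) auto
    also have "\<dots> = real (l * l) * \<kappa>" by simp
    finally show ?thesis using \<kappa>0 by (simp add: d_def)
  qed
  moreover have "\<kappa> \<le> real (l * l) * \<kappa>"
  proof -
    have "1 * 1 \<le> l * l" using l_ge by (intro mult_mono) auto
    then have "1 \<le> real (l * l)" by (metis mult_1 of_nat_1 of_nat_le_iff)
    then show ?thesis using \<kappa>0 mult_right_mono [of 1 "real (l * l)" \<kappa>] by simp
  qed
  ultimately show ?thesis using upper [OF jk] unfolding \<kappa>_def [symmetric] by linarith
qed

end

lemma (in overlap_problem) gr_lower: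
  obtains K where "K \<ge> 0" "\<forall>\<^sub>F n in sequentially. real sg / real n - K / real n ^ 2 \<le> gr n"
proof -
  obtain C :: nat where
    "\<forall>\<^sub>F n in sequentially. \<forall>F. extremal n l m F \<longrightarrow> (\<exists>B \<tau>. grown n l m F C B \<tau>)"
    by (rule grown_exists)
  then obtain N where N: "\<And>n F. n \<ge> N \<Longrightarrow> extremal n l m F \<Longrightarrow> \<exists>B \<tau>. grown n l m F C B \<tau>"
    unfolding eventually_sequentially by blast
  have step: "(real sg / real n + gr n) / 2 - C10 C / real n ^ 2 \<le> gr (Suc n)" if n: "n \<ge> N" for n
  proof -
    obtain F where "extremal n l m F" using ex_extremal by blast
    then obtain B \<tau> where "grown n l m F C B \<tau>" using N n by blast
    then interpret grown n l m F C B \<tau> .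
    show ?thesis by (rule gr_step)
  qed
  obtain K where "K \<ge> 0" "\<forall>\<^sub>F n in sequentially. real sg / real n - K / real n ^ 2 \<le> gr n"
    by (rule growth_recursion [OF of_nat_0_le_iff C10_nonneg step])
  then show ?thesis by (rule that)
qed

section \<open>Extremal families contain the ideal ones\<close>

lemma Ideal_subset:
  assumes "finite V" "Y \<in> Ideal V ow lm c j" "D \<subseteq> Y"
  shows "D \<in> Ideal V ow lm c j"
proof -
  have Y: "Y \<subseteq> V" "\<And>v. v \<in> Y \<Longrightarrow> ow v = j \<or> lm v = j"
    "\<And>k. k \<noteq> j \<Longrightarrow> card {v\<in>Y. ow v = k \<and> lm v = j} \<le> c j k"
    using assms(2) by (auto simp: Ideal_def)
  have "card {v\<in>D. ow v = k \<and> lm v = j} \<le> c j k" if "k \<noteq> j" for k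
  proof -
    have "finite Y" using Y(1) assms(1) finite_subset by blast
    then have "card {v\<in>D. ow v = k \<and> lm v = j} \<le> card {v\<in>Y. ow v = k \<and> lm v = j}"
      using assms(3) by (intro card_mono) auto
    then show ?thesis using Y(3) [OF that] by linarith
  qed
  moreover have "ow v = j \<or> lm v = j" if "v \<in> D" for v using Y(2) assms(3) that by blast
  ultimately show ?thesis using Y(1) assms(3) unfolding Ideal_def by blast
qed

text \<open>With total gain S and each loss at most \<kappa> S, the product is at least (1 - cS)(1 +
  S) for c = |I| \<kappa>, which exceeds 1 when S > 0 and c (1 + S) < 1. The a priori bound Z on S
  makes this requirement uniform.\<close>

lemma no_gain:
  fixes x y :: "'a \<Rightarrow> real"
  assumes "finite I" and x: "\<And>i. i \<in> I \<Longrightarrow> 0 \<le> x i \<and> x i \<le> 1 \<and> x i \<le> \<kappa> * (\<Sum>i\<in>I. y i)"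
    and y: "\<And>i. i \<in> I \<Longrightarrow> 0 \<le> y i" and Y: "(\<Sum>i\<in>I. y i) \<le> Z"
    and \<kappa>: "0 \<le> \<kappa>" "real (card I) * \<kappa> * (1 + Z) < 1"
    and prod: "(\<Prod>i\<in>I. 1 - x i + y i) \<le> 1"
  shows "(\<Sum>i\<in>I. y i) = 0"
proof (rule ccontr)
  define S where "S = (\<Sum>i\<in>I. y i)"
  assume "(\<Sum>i\<in>I. y i) \<noteq> 0"
  moreover have "S \<ge> 0" using y by (auto simp: S_def intro: sum_nonneg)
  ultimately have S0: "S > 0" by (simp add: S_def)
  define c where "c = real (card I) * \<kappa>"
  have c0: "c \<ge> 0" using \<kappa> by (simp add: c_def)
  have cS: "c * (1 + S) < 1"
  proof -
    have "c * (1 + S) \<le> c * (1 + Z)" using Y c0 by (intro mult_left_mono) (auto simp: S_def)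
    then show ?thesis using \<kappa>(2) by (simp add: c_def)
  qed
  have sx: "(\<Sum>i\<in>I. x i) \<le> c * S"
    using sum_bounded_above [of I x "\<kappa> * S"] x by (simp add: c_def S_def)
  have "1 - c * S \<le> (\<Prod>i\<in>I. 1 - x i)"
    using one_minus_sum_le_prod [of I x] assms(1) x sx by fastforce
  moreover have "1 + S \<le> (\<Prod>i\<in>I. 1 + y i)"
    using one_plus_sum_le_prod [of I y] assms(1) y by (simp add: S_def)
  moreover have "0 \<le> 1 - c * S" using cS c0 by (simp add: algebra_simps)
  ultimately have "(1 - c * S) * (1 + S) \<le> (\<Prod>i\<in>I. 1 - x i) * (\<Prod>i\<in>I. 1 + y i)"
    using S0 by (intro mult_mono) auto
  also have "\<dots> = (\<Prod>i\<in>I. (1 - x i) * (1 + y i))" by (simp add: prod.distrib)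
  also have "\<dots> \<le> (\<Prod>i\<in>I. 1 - x i + y i)"
  proof (rule prod_mono)
    fix i assume i: "i \<in> I"
    have "0 \<le> x i * y i" using x [OF i] y [OF i] by simp
    moreover have "(1 - x i) * (1 + y i) = 1 - x i + y i - x i * y i" by (simp add: algebra_simps)
    moreover have "0 \<le> (1 - x i) * (1 + y i)" using x [OF i] y [OF i] by simp
    ultimately show "0 \<le> (1 - x i) * (1 + y i) \<and> (1 - x i) * (1 + y i) \<le> 1 - x i + y i" by linarith
  qed
  finally have "(1 - c * S) * (1 + S) \<le> 1" using prod by linarith
  moreover have "(1 - c * S) * (1 + S) = 1 + S * (1 - c * (1 + S))" by (simp add: algebra_simps)
  moreover have "S * (1 - c * (1 + S)) > 0" using S0 cS by simp
  ultimately show False by linarith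
qed

context overlap_problem
begin

definition w9 :: "nat \<Rightarrow> real" where "w9 C = 4 * C1 C * (real sg + 1)"

definition Z9 :: "nat \<Rightarrow> real" where "Z9 C = 2 ^ (sg + 2) * w9 C ^ sg"

definition C16 :: "nat \<Rightarrow> real" where "C16 C = (C5 C + 2) * Z9 C * 2 ^ sg"

definition large2 :: "nat \<Rightarrow> nat \<Rightarrow> bool" where
  "large2 C n \<longleftrightarrow> (real l * C16 C * (1 + real l * (real (sg + 1) * real C))) / real n \<le> 1 / 2"

lemma eventually_large2: "\<forall>\<^sub>F n in sequentially. large2 C n"
  unfolding large2_def by (rule eventually_divide_le) simp

lemma w9_ge: "w9 C \<ge> 1"
proof -
  have "1 * 1 \<le> (4 * C1 C) * (real sg + 1)" using C1_pos [of C] by (intro mult_mono) auto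
  then show ?thesis by (simp add: w9_def)
qed

lemma Z9_pos: "Z9 C > 0"
  using w9_ge [of C] by (simp add: Z9_def)

lemma C16_nonneg: "C16 C \<ge> 0"
  using C5_ge [of C] Z9_pos [of C] by (simp add: C16_def)

end

context grown
begin

abbreviation Idl :: "nat \<Rightarrow> nat set set" where "Idl \<equiv> Ideal {1..n} own limr \<tau>"

lemma Idl_Int_le:
  "\<lbrakk>i \<in> {1..l}; j \<in> {1..l}; i \<noteq> j; X \<in> Idl i; Y \<in> Idl j\<rbrakk> \<Longrightarrow> card (X \<inter> Y) \<le> m {i, j}"
  by (rule Ideal_Int_le [of "{1..n}" i j \<tau>]) (use type_sum in auto)

lemma finite_Idl: "finite (Idl j)"
  by (rule finite_subset [of _ "Pow {1..n}"]) (auto simp: Ideal_def)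

lemma Idl_sub: "Y \<in> Idl j \<Longrightarrow> Y \<subseteq> {1..n}"
  by (auto simp: Ideal_def)

lemma finite_Idl_mem: "Y \<in> Idl j \<Longrightarrow> finite Y"
  using Idl_sub finite_subset by blast

lemma Idl_diff_eq:
  assumes j: "j \<in> {1..l}" and Y: "Y \<in> Idl j"
  shows "Y - B j = (\<Union>k\<in>{1..l} - {j}. Y \<inter> A j k)"
  using Y own_mem(1) limr_mem(2) unfolding Ideal_def A_def B_eq [OF j] by fastforce

lemma card_Idl_Int_A:
  assumes "Y \<in> Idl j" "k \<noteq> j"
  shows "card (Y \<inter> A j k) \<le> \<tau> j k"
proof -
  have "Y \<inter> A j k = {v\<in>Y. own v = k \<and> limr v = j}" using assms by (auto simp: Ideal_def A_def)
  then show ?thesis using assms by (simp add: Ideal_def)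
qed

lemma card_Idl_diff:
  assumes j: "j \<in> {1..l}" and Y: "Y \<in> Idl j"
  shows "card (Y - B j) = (\<Sum>k\<in>{1..l} - {j}. card (Y \<inter> A j k))"
  unfolding Idl_diff_eq [OF assms] by (rule card_UN_disjoint) (auto simp: A_def)

lemma card_Idl_diff_le:
  assumes j: "j \<in> {1..l}" and Y: "Y \<in> Idl j"
  shows "card (Y - B j) \<le> deg \<tau> j"
  unfolding card_Idl_diff [OF assms] deg_def by (intro sum_mono card_Idl_Int_A Y) auto

lemma deg_le_sg: "j \<in> {1..l} \<Longrightarrow> deg \<tau> j \<le> sg"
  using member_le_sum [of j "{1..l}" "deg \<tau>"] sum_deg [of \<tau>] type_sum by simp

lemma card_Idl_le:
  assumes j: "j \<in> {1..l}"
  shows "real (card (Idl j)) \<le> (real (sg + 1) * real C) * real (card (F j))"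
proof -
  have "card ((\<lambda>G. G - B j) ` Idl j) \<le> card {X. X \<subseteq> {1..n} \<and> card X \<le> deg \<tau> j}"
    using card_Idl_diff_le [OF j] Idl_sub by (intro card_mono) auto
  also have "\<dots> \<le> (deg \<tau> j + 1) * n ^ deg \<tau> j"
    using card_small_subsets_le [of "{1..n}" "deg \<tau> j"] n_pos by simp
  also have "\<dots> \<le> (sg + 1) * n ^ deg \<tau> j" using deg_le_sg [OF j] by (intro mult_right_mono) auto
  finally have "card (Idl j) \<le> 2 ^ card (B j) * ((sg + 1) * n ^ deg \<tau> j)"
    using card_le_pow_times_traces [OF finite_Idl finite_B [OF j], of j] by (meson le_trans mult_le_mono2)
  then have "real (card (Idl j)) \<le> real (2 ^ card (B j) * ((sg + 1) * n ^ deg \<tau> j))" by (simp only: of_nat_le_iff)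
  also have "\<dots> = real (sg + 1) * (2 ^ card (B j) * real n ^ deg \<tau> j)" by simp
  also have "\<dots> \<le> real (sg + 1) * (real C * real (card (F j)))"
    by (intro mult_left_mono card_F_ge_real j) simp
  finally show ?thesis by (simp only: mult.assoc)
qed

lemma card_F_le:
  assumes j: "j \<in> {1..l}"
  shows "real (card (F j)) \<le> 2 * (2 ^ card (B j) * real n ^ deg \<tau> j)"
proof -
  have "(1 / 2) * real (card (F j)) \<le> (1 - C6 C / real n) * real (card (F j))"
    by (rule mult_right_mono) (use C6_half in linarith, simp)
  also have "\<dots> \<le> 2 ^ card (B j) * (\<Prod>k\<in>{1..l} - {j}. real (card (A j k) choose \<tau> j k))"
    by (rule card_F_exact_le [OF j])
  also have "(\<Prod>k\<in>{1..l} - {j}. real (card (A j k) choose \<tau> j k)) \<le> (\<Prod>k\<in>{1..l} - {j}. real n ^ \<tau> j k)"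
  proof (intro prod_mono conjI)
    fix k
    have "card (A j k) choose \<tau> j k \<le> card (A j k) ^ \<tau> j k"
      by (cases "\<tau> j k \<le> card (A j k)") (simp_all add: binomial_le_pow binomial_eq_0)
    also have "\<dots> \<le> n ^ \<tau> j k"
      using card_mono [of "{1..n}" "A j k"] by (intro power_mono) (auto simp: A_def)
    finally have "real (card (A j k) choose \<tau> j k) \<le> real (n ^ \<tau> j k)" by (simp only: of_nat_le_iff)
    then show "real (card (A j k) choose \<tau> j k) \<le> real n ^ \<tau> j k" by simp
  qed simp
  also have "(\<Prod>k\<in>{1..l} - {j}. real n ^ \<tau> j k) = real n ^ deg \<tau> j" by (simp add: deg_def power_sum)
  finally show ?thesis by simp
qed

text \<open>\<open>D\<close> together with an ideal member off \<open>D\<close>, with each cap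
  reduced by what \<open>D\<close> uses, is an ideal member. Only vertices of \<open>D\<close> off
  \<open>B j\<close> cost a factor n; those inside cost a factor 2 each, absorbed in
  \<open>Z9\<close>.\<close>

lemma card_Idl_supersets_ge:
  assumes j: "j \<in> {1..l}" and D: "D \<in> Idl j" "card D \<le> sg + 1"
  shows "real (card (F j)) \<le> Z9 C * real n ^ card (D - B j) * real (card {Y\<in>Idl j. D \<subseteq> Y})"
proof -
  define r where "r k = card (D \<inter> A j k)" for k
  define c where "c i k = \<tau> i k - r k" for i k
  have fD: "finite D" using D finite_Idl_mem by blast
  have rle: "r k \<le> \<tau> j k" if "k \<noteq> j" for k unfolding r_def by (rule card_Idl_Int_A [OF D(1) that])
  have "card (Ideal ({1..n} - D) own limr c j) \<le> card {Y\<in>Idl j. D \<subseteq> Y}"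
  proof (rule card_inj_on_le [where f = "\<lambda>Y. Y \<union> D"])
    show "inj_on (\<lambda>Y. Y \<union> D) (Ideal ({1..n} - D) own limr c j)"
      by (rule inj_on_inverseI [where g = "\<lambda>Y. Y - D"]) (auto simp: Ideal_def)
    show "(\<lambda>Y. Y \<union> D) ` Ideal ({1..n} - D) own limr c j \<subseteq> {Y\<in>Idl j. D \<subseteq> Y}"
    proof
      fix W assume "W \<in> (\<lambda>Y. Y \<union> D) ` Ideal ({1..n} - D) own limr c j"
      then obtain Y where Y: "Y \<in> Ideal ({1..n} - D) own limr c j" "W = Y \<union> D" by auto
      have "card {v\<in>W. own v = k \<and> limr v = j} \<le> \<tau> j k" if k: "k \<noteq> j" for k
      proof -
        have "{v\<in>W. own v = k \<and> limr v = j} \<subseteq> {v\<in>Y. own v = k \<and> limr v = j} \<union> (D \<inter> A j k)"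
          using Y Idl_sub [OF D(1)] by (auto simp: A_def)
        moreover have "finite Y" using Y by (auto simp: Ideal_def intro: finite_subset)
        ultimately have "card {v\<in>W. own v = k \<and> limr v = j} \<le> card ({v\<in>Y. own v = k \<and> limr v = j} \<union> (D \<inter> A j k))"
          using fD by (intro card_mono) auto
        also have "\<dots> \<le> card {v\<in>Y. own v = k \<and> limr v = j} + r k" unfolding r_def by (rule card_Un_le)
        also have "\<dots> \<le> c j k + r k" using Y(1) k by (simp add: Ideal_def)
        also have "\<dots> = \<tau> j k" using rle [OF k] by (simp add: c_def)
        finally show ?thesis .
      qed
      then show "W \<in> {Y\<in>Idl j. D \<subseteq> Y}" using Y D(1) by (auto simp: Ideal_def)
    qed
    show "finite {Y\<in>Idl j. D \<subseteq> Y}" using finite_Idl by simp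
  qed
  moreover have "2 ^ card {v\<in>{1..n} - D. own v = j} *
      (\<Prod>k\<in>{1..l} - {j}. card {v\<in>{1..n} - D. own v = k \<and> limr v = j} choose c j k)
      \<le> card (Ideal ({1..n} - D) own limr c j)"
    by (rule card_Ideal_ge) (use j own_mem in auto)
  moreover have "{v\<in>{1..n} - D. own v = j} = B j - D" unfolding B_eq [OF j] by auto
  moreover have "{v\<in>{1..n} - D. own v = k \<and> limr v = j} = A j k - D" for k by (auto simp: A_def)
  ultimately have "2 ^ card (B j - D) * (\<Prod>k\<in>{1..l} - {j}. card (A j k - D) choose c j k) \<le> card {Y\<in>Idl j. D \<subseteq> Y}"
    by simp
  then have "real (2 ^ card (B j - D) * (\<Prod>k\<in>{1..l} - {j}. card (A j k - D) choose c j k)) \<le> real (card {Y\<in>Idl j. D \<subseteq> Y})"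
    by (simp only: of_nat_le_iff)
  then have count: "2 ^ card (B j - D) * (\<Prod>k\<in>{1..l} - {j}. real (card (A j k - D) choose c j k)) \<le> real (card {Y\<in>Idl j. D \<subseteq> Y})"
    by simp
  have w1: "w9 C \<ge> 1" by (rule w9_ge)
  have wn: "w9 C \<le> real n" using large n_pos unfolding large_def w9_def by (simp add: divide_le_eq)
  have bin: "(real n / w9 C) ^ c j k \<le> real (card (A j k - D) choose c j k)" if k: "k \<in> {1..l} - {j}" for k
  proof (cases "c j k = 0")
    case False
    then have t: "\<tau> j k \<ge> 1" by (simp add: c_def)
    have csg: "c j k \<le> sg"
      using type_sum [of j k] m_le_sg [of j k] j k by (auto simp: c_def)
    have C1p: "C1 C > 0" using C1_pos [of C] by simp
    have half: "real sg + 1 \<le> real n / (4 * C1 C)"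
      using wn C1p by (simp add: w9_def pos_le_divide_eq ac_simps)
    have "real n / (2 * C1 C) \<le> real (card (A j k))" by (rule card_A_ge) (use j k t in auto)
    moreover have "card (A j k) \<le> card (A j k - D) + card D"
      using card_Un_le [of "A j k - D" D] card_mono [of "(A j k - D) \<union> D" "A j k"] fD by auto
    ultimately have "real n / (2 * C1 C) \<le> real (card (A j k - D)) + (real sg + 1)"
      using D(2) by linarith
    moreover have "real n / (2 * C1 C) = real n / (4 * C1 C) + real n / (4 * C1 C)" by (simp add: field_simps)
    ultimately have big: "real n / (4 * C1 C) \<le> real (card (A j k - D))" using half by linarith
    then have "c j k \<le> card (A j k - D)" using half csg by linarith
    then have "(real (card (A j k - D)) / real (c j k)) ^ c j k \<le> real (card (A j k - D) choose c j k)"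
      by (rule binomial_ge_n_over_k_pow_k)
    moreover have "real n / w9 C \<le> real (card (A j k - D)) / real (c j k)"
    proof -
      have "real n / w9 C = (real n / (4 * C1 C)) / (real sg + 1)" by (simp add: w9_def)
      also have "\<dots> \<le> real (card (A j k - D)) / real (c j k)"
        using big csg False by (intro frac_le) auto
      finally show ?thesis .
    qed
    then have "(real n / w9 C) ^ c j k \<le> (real (card (A j k - D)) / real (c j k)) ^ c j k"
      using w1 by (intro power_mono) auto
    ultimately show ?thesis by linarith
  qed simp
  define R where "R = card (D - B j)"
  have sumc: "(\<Sum>k\<in>{1..l} - {j}. c j k) + R = deg \<tau> j"
  proof -
    have "(\<Sum>k\<in>{1..l} - {j}. c j k) + R = (\<Sum>k\<in>{1..l} - {j}. c j k + r k)"
      unfolding R_def card_Idl_diff [OF j D(1)] r_def by (simp add: sum.distrib)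
    also have "\<dots> = deg \<tau> j" unfolding deg_def
      by (rule sum.cong) (use rle in \<open>auto simp: c_def\<close>)
    finally show ?thesis .
  qed
  define s where "s = (\<Sum>k\<in>{1..l} - {j}. c j k)"
  have "(real n / w9 C) ^ s = (\<Prod>k\<in>{1..l} - {j}. (real n / w9 C) ^ c j k)" by (simp add: s_def power_sum)
  also have "\<dots> \<le> (\<Prod>k\<in>{1..l} - {j}. real (card (A j k - D) choose c j k))"
    using bin w1 by (intro prod_mono) auto
  finally have prods: "(real n / w9 C) ^ s \<le> (\<Prod>k\<in>{1..l} - {j}. real (card (A j k - D) choose c j k))" .
  have "(2::real) ^ card (B j - D) * (real n / w9 C) ^ s \<le> 2 ^ card (B j - D) * (\<Prod>k\<in>{1..l} - {j}. real (card (A j k - D) choose c j k))"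
    by (intro mult_left_mono prods) simp
  then have cnt: "2 ^ card (B j - D) * (real n / w9 C) ^ s \<le> real (card {Y\<in>Idl j. D \<subseteq> Y})"
    using count by linarith
  have b: "(2::real) ^ card (B j) \<le> 2 ^ (sg + 1) * 2 ^ card (B j - D)"
  proof -
    have "card (B j) \<le> card (B j - D) + card D"
      using card_Un_le [of "B j - D" D] card_mono [of "(B j - D) \<union> D" "B j"] fD finite_B [OF j] by auto
    then have "card (B j) \<le> (sg + 1) + card (B j - D)" using D(2) by linarith
    then have "(2::real) ^ card (B j) \<le> 2 ^ ((sg + 1) + card (B j - D))" by (intro power_increasing) auto
    then show ?thesis by (simp only: power_add)
  qed
  have "real n ^ deg \<tau> j = real n ^ s * real n ^ R" using sumc by (simp add: s_def power_add [symmetric])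
  moreover have "real n ^ s = w9 C ^ s * (real n / w9 C) ^ s" using w1 by (simp add: power_divide)
  moreover have "w9 C ^ s * (real n / w9 C) ^ s \<le> w9 C ^ sg * (real n / w9 C) ^ s"
    using w1 sumc deg_le_sg [OF j] by (intro mult_right_mono power_increasing) (auto simp: s_def)
  ultimately have nd: "real n ^ deg \<tau> j \<le> (w9 C ^ sg * (real n / w9 C) ^ s) * real n ^ R"
    by (simp add: mult_right_mono)
  have "real (card (F j)) \<le> 2 * (2 ^ card (B j) * real n ^ deg \<tau> j)" by (rule card_F_le [OF j])
  also have "\<dots> \<le> 2 * ((2 ^ (sg + 1) * 2 ^ card (B j - D)) * ((w9 C ^ sg * (real n / w9 C) ^ s) * real n ^ R))"
    using b nd w1 by (intro mult_left_mono mult_mono) auto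
  also have "\<dots> = Z9 C * real n ^ R * (2 ^ card (B j - D) * (real n / w9 C) ^ s)"
  proof -
    have "(2::real) ^ (sg + 2) = 2 * 2 ^ (sg + 1)" by (simp add: power_add)
    then show ?thesis unfolding Z9_def by (simp only: ac_simps)
  qed
  also have "\<dots> \<le> Z9 C * real n ^ R * real (card {Y\<in>Idl j. D \<subseteq> Y})"
    using cnt Z9_pos [of C] by (intro mult_left_mono) auto
  finally show ?thesis by (simp add: R_def)
qed

text \<open>A minimal conflict of \<open>F i\<close> with the ideal family of \<open>j\<close> is a
  set of size m + 1 in both. It is recorded by its trace off \<open>B j\<close>, in terms of which
  both the conflict probability and the number of missing supersets are bounded.\<close>

definition RR :: "nat \<Rightarrow> nat \<Rightarrow> nat set set" where
  "RR i j = {D - B j | D. D \<in> F i \<and> D \<in> Idl j \<and> card D = m {i, j} + 1}"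

lemma RR_D:
  assumes ij: "i \<in> {1..l}" "j \<in> {1..l}" "i \<noteq> j" and R: "R \<in> RR i j"
  obtains D where "R = D - B j" "D \<in> F i" "D \<in> Idl j" "card D = m {i, j} + 1" "card D \<le> sg + 1" "D \<notin> F j"
proof -
  obtain D where D: "R = D - B j" "D \<in> F i" "D \<in> Idl j" "card D = m {i, j} + 1" using R by (auto simp: RR_def)
  moreover have "card D \<le> sg + 1" using D(4) m_le_sg [OF ij] by simp
  moreover have "D \<notin> F j"
  proof
    assume "D \<in> F j"
    then have "card (D \<inter> D) \<le> m {i, j}" using card_Int_le [OF ij D(2)] by blast
    then show False using D(4) by simp
  qed
  ultimately show ?thesis by (rule that)
qed

lemma finite_RR: "i \<in> {1..l} \<Longrightarrow> finite (RR i j)"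
  by (rule finite_subset [of _ "(\<lambda>D. D - B j) ` F i"]) (auto simp: RR_def finite_F)

text \<open>If the trace avoids \<open>B i\<close>, one of its vertices is limited by
  \<open>j\<close> and foreign to \<open>i\<close>, and competition gives the extra 1/n. If it meets
  \<open>B i\<close>, then \<open>A j i\<close> is nonempty and the orientation gives
  \<open>\<tau> i j = 0\<close>, so members of \<open>F i\<close> meeting \<open>B j\<close> are
  heavy.\<close>

lemma Pr_conflict_R:
  assumes ij: "i \<in> {1..l}" "j \<in> {1..l}" "i \<noteq> j" and R: "R \<in> RR i j"
  shows "Pr (F i) (\<lambda>G. \<exists>D. D \<subseteq> G \<and> D \<in> Idl j \<and> card D = m {i, j} + 1 \<and> D - B j = R)
    \<le> (C5 C + 2) / real n ^ (card R + 1)"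
proof -
  obtain D where D: "R = D - B j" "D \<in> F i" "D \<in> Idl j" "card D = m {i, j} + 1" "card D \<le> sg + 1"
    using RR_D [OF assms] by metis
  have fD: "finite D" using D finite_Idl_mem by blast
  have fR: "finite R" using D(1) fD by simp
  have "card R \<le> card D" unfolding D(1) using fD by (intro card_mono) auto
  then have cR: "card R \<le> sg + 1" using D(5) by simp
  have RB: "R \<inter> B j = {}" using D(1) by auto
  have lim: "limr v = j" "v \<in> {1..n}" if "v \<in> R" for v
    using that D(1,3) B_eq [OF ij(2)] by (auto simp: Ideal_def)
  have "R \<noteq> {}"
  proof
    assume "R = {}"
    then have "D \<inter> B j = D" using D(1) by auto
    then have "card D \<le> m {i, j}" using card_trace_le [OF ij D(2)] by simp
    then show False using D(4) by simp
  qed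
  show ?thesis
  proof (cases "R \<inter> B i = {}")
    case True
    obtain v where v: "v \<in> R" using \<open>R \<noteq> {}\<close> by auto
    have "Pr (F i) (\<lambda>G. \<exists>D. D \<subseteq> G \<and> D \<in> Idl j \<and> card D = m {i, j} + 1 \<and> D - B j = R) \<le> Pr (F i) (\<lambda>G. R \<subseteq> G)"
      by (rule Pr_mono) (use finite_F ij in auto)
    also have "\<dots> \<le> C5 C / real n ^ (card R + 1)"
      by (rule Pr_competitor_le [OF ij True RB fR cR v]) (use limr_mem(3) [OF lim(2) [OF v]] lim(1) [OF v] in simp)
    also have "\<dots> \<le> (C5 C + 2) / real n ^ (card R + 1)" by (intro divide_right_mono) auto
    finally show ?thesis .
  next
    case False
    then obtain u where u: "u \<in> R" "u \<in> B i" by auto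
    have "u \<in> A j i" using u lim own_eq [OF ij(1)] by (auto simp: A_def)
    then have tji: "\<tau> j i \<noteq> 0" using A_empty [OF ij(2,1)] ij(3) by auto
    then have tij: "\<tau> i j = 0" using orientation [OF ij] by auto
    have tm: "\<tau> j i = m {i, j}" using type_sum [OF ij] tij by simp
    have heavyI: "heavy B \<tau> i G" if "G \<inter> B j \<noteq> {}" "G \<in> F i" for G
    proof -
      have "card (G \<inter> B j) > 0" using that finite_B [OF ij(2)] by (simp add: card_gt_0_iff)
      then show ?thesis unfolding heavy_def by (intro bexI [of _ j]) (use ij tij in auto)
    qed
    have small: "1 / real n ^ (sg + 3) \<le> 1 / real n ^ (card R + 1)"
      using n_pos cR by (intro divide_left_mono power_increasing) auto
    have H: "Pr (F i) (heavy B \<tau> i) \<le> 1 / real n ^ (sg + 3)" by (rule Pr_heavy_le [OF ij(1) dec(1)])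
    have "Pr (F i) (\<lambda>G. \<exists>D. D \<subseteq> G \<and> D \<in> Idl j \<and> card D = m {i, j} + 1 \<and> D - B j = R) \<le> 2 / real n ^ (card R + 1)"
    proof (cases "R \<subseteq> B i")
      case True
      have "Pr (F i) (\<lambda>G. \<exists>D. D \<subseteq> G \<and> D \<in> Idl j \<and> card D = m {i, j} + 1 \<and> D - B j = R) \<le> Pr (F i) (heavy B \<tau> i)"
      proof (rule Pr_mono)
        fix G assume G: "G \<in> F i" "\<exists>D. D \<subseteq> G \<and> D \<in> Idl j \<and> card D = m {i, j} + 1 \<and> D - B j = R"
        then obtain D' where D': "D' \<subseteq> G" "D' \<in> Idl j" "card D' = m {i, j} + 1" "D' - B j = R" by blast
        \<comment> \<open>Otherwise \<open>D'\<close> would lie in \<open>A j i\<close>, where an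
          ideal member of \<open>j\<close> has at most \<open>\<tau> j i = m {i, j}\<close>
          vertices, one fewer than |D'|.\<close>
        have "G \<inter> B j \<noteq> {}"
        proof
          assume "G \<inter> B j = {}"
          then have "D' = R" using D' by auto
          then have "D' \<subseteq> D' \<inter> A j i" using True lim own_eq [OF ij(1)] by (auto simp: A_def)
          then have "card D' \<le> card (D' \<inter> A j i)" by (intro card_mono) auto
          also have "\<dots> \<le> \<tau> j i" by (rule card_Idl_Int_A [OF D'(2) ij(3)])
          finally show False using D'(3) tm by simp
        qed
        then show "heavy B \<tau> i G" using heavyI G by blast
      qed (use finite_F ij in auto)
      also have "\<dots> \<le> 1 / real n ^ (card R + 1)" using H small by linarith
      also have "\<dots> \<le> 2 / real n ^ (card R + 1)" by (intro divide_right_mono) auto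
      finally show ?thesis .
    next
      case False
      then obtain v where v: "v \<in> R" "v \<notin> B i" by auto
      have vj: "v \<notin> B j" using v RB by auto
      have qv: "c0 / real n \<le> q j v" using limr_mem(3) [OF lim(2) [OF v(1)]] lim(1) [OF v(1)] by simp
      have "Pr (F i) (\<lambda>G. \<exists>D. D \<subseteq> G \<and> D \<in> Idl j \<and> card D = m {i, j} + 1 \<and> D - B j = R) \<le>
          Pr (F i) (\<lambda>G. heavy B \<tau> i G \<or> (v \<in> G \<and> G \<inter> B j = {}))"
        by (rule Pr_mono) (use finite_F ij heavyI v in auto)
      also have "\<dots> \<le> Pr (F i) (heavy B \<tau> i) + Pr (F i) (\<lambda>G. v \<in> G \<and> G \<inter> B j = {})"
        by (rule Pr_disj) (use finite_F ij in auto)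
      \<comment> \<open>A member avoiding \<open>B j\<close> has exactly
        \<open>\<tau> i j = 0\<close> vertices there and misses \<open>Bad j v\<close>, so
        competition applies.\<close>
      also have "Pr (F i) (\<lambda>G. v \<in> G \<and> G \<inter> B j = {}) \<le> 1 / real n ^ (sg + 3)"
      proof (rule Pr_killed_small [OF ij(1) dec(2)])
        fix G assume "G \<in> F i" "v \<in> G \<and> G \<inter> B j = {}"
        then show "killed (n div D1 C) i (G - B i)"
          by (intro killed_competitor [OF ij v(2) vj qv]) (use tij in \<open>auto simp: Bad_def\<close>)
      qed
      finally show ?thesis using H small by simp
    qed
    also have "\<dots> \<le> (C5 C + 2) / real n ^ (card R + 1)"
      using C5_ge [of C] by (intro divide_right_mono) auto
    finally show ?thesis .
  qed
qed

definition Conf :: "nat \<Rightarrow> nat set set" where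
  "Conf i = {G\<in>F i. \<exists>j\<in>{1..l} - {i}. \<exists>Y\<in>Idl j. m {i, j} < card (G \<inter> Y)}"

definition miss :: "nat \<Rightarrow> real" where
  "miss j = real (card (Idl j - F j)) / real (card (F j))"

text \<open>All ideal supersets of a conflict \<open>D\<close> are missing from \<open>F j\<close>,
  because \<open>D\<close> is and \<open>F j\<close> is closed under subsets. A missing set is
  charged at most 2^sg times, once per trace inside its at most \<open>sg\<close> vertices off
  \<open>B j\<close>.\<close>

lemma miss_ge:
  assumes ij: "i \<in> {1..l}" "j \<in> {1..l}" "i \<noteq> j"
  shows "(\<Sum>R\<in>RR i j. 1 / real n ^ card R) \<le> Z9 C * 2 ^ sg * miss j"
proof -
  define Ms where "Ms = Idl j - F j"
  have finM: "finite Ms" using finite_Idl by (simp add: Ms_def)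
  have Fj: "real (card (F j)) > 0" using card_F_pos ij by simp
  have "(\<Sum>R\<in>RR i j. 1 / real n ^ card R) \<le> (\<Sum>R\<in>RR i j. Z9 C / real (card (F j)) * real (card {Y\<in>Ms. R \<subseteq> Y}))"
  proof (rule sum_mono)
    fix R assume R: "R \<in> RR i j"
    obtain D where D: "R = D - B j" "D \<in> F i" "D \<in> Idl j" "card D \<le> sg + 1" "D \<notin> F j"
      using RR_D [OF ij R] by metis
    have "real (card (F j)) \<le> Z9 C * real n ^ card R * real (card {Y\<in>Idl j. D \<subseteq> Y})"
      using card_Idl_supersets_ge [OF ij(2) D(3,4)] by (simp only: D(1))
    also have "\<dots> \<le> Z9 C * real n ^ card R * real (card {Y\<in>Ms. R \<subseteq> Y})"
    proof (intro mult_left_mono of_nat_mono card_mono)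
      show "{Y\<in>Idl j. D \<subseteq> Y} \<subseteq> {Y\<in>Ms. R \<subseteq> Y}"
        using D(5) downset [OF ij(2)] unfolding Ms_def D(1) by blast
    qed (use finM Z9_pos [of C] in auto)
    finally show "1 / real n ^ card R \<le> Z9 C / real (card (F j)) * real (card {Y\<in>Ms. R \<subseteq> Y})"
      using Fj n_pos by (simp add: field_simps)
  qed
  also have "\<dots> = Z9 C / real (card (F j)) * real (\<Sum>R\<in>RR i j. card {Y\<in>Ms. R \<subseteq> Y})"
    by (simp add: sum_distrib_left)
  also have "(\<Sum>R\<in>RR i j. card {Y\<in>Ms. R \<subseteq> Y}) = (\<Sum>Y\<in>Ms. card {R\<in>RR i j. R \<subseteq> Y})"
  proof -
    have "(\<Sum>R\<in>RR i j. card {Y\<in>Ms. R \<subseteq> Y}) = (\<Sum>R\<in>RR i j. \<Sum>Y\<in>Ms. if R \<subseteq> Y then 1 else 0)"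
      using finM by (intro sum.cong refl) (simp add: sum.If_cases Int_def)
    also have "\<dots> = (\<Sum>Y\<in>Ms. \<Sum>R\<in>RR i j. if R \<subseteq> Y then 1 else 0)" by (rule sum.swap)
    also have "\<dots> = (\<Sum>Y\<in>Ms. card {R\<in>RR i j. R \<subseteq> Y})"
      using finite_RR [OF ij(1)] by (intro sum.cong refl) (simp add: sum.If_cases Int_def)
    finally show ?thesis .
  qed
  also have "real (\<Sum>Y\<in>Ms. card {R\<in>RR i j. R \<subseteq> Y}) \<le> real (card Ms * 2 ^ sg)"
  proof (intro of_nat_mono sum_bounded_above [THEN order_trans])
    fix Y assume Y: "Y \<in> Ms"
    have fY: "finite (Y - B j)" using Y finite_Idl_mem by (auto simp: Ms_def)
    have "card {R\<in>RR i j. R \<subseteq> Y} \<le> card (Pow (Y - B j))"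
      by (rule card_mono) (use fY in \<open>auto simp: RR_def\<close>)
    also have "\<dots> = 2 ^ card (Y - B j)" by (rule card_Pow [OF fY])
    also have "\<dots> \<le> 2 ^ sg"
      using card_Idl_diff_le [OF ij(2), of Y] deg_le_sg [OF ij(2)] Y by (intro power_increasing) (auto simp: Ms_def)
    finally show "card {R\<in>RR i j. R \<subseteq> Y} \<le> 2 ^ sg" .
  qed simp
  then have "Z9 C / real (card (F j)) * real (\<Sum>Y\<in>Ms. card {R\<in>RR i j. R \<subseteq> Y}) \<le>
      Z9 C / real (card (F j)) * real (card Ms * 2 ^ sg)"
    using Z9_pos [of C] by (intro mult_left_mono) auto
  also have "\<dots> = Z9 C * 2 ^ sg * miss j" by (simp add: miss_def Ms_def)
  finally show ?thesis .
qed

lemma Pr_Conf_le: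
  assumes i: "i \<in> {1..l}"
  shows "Pr (F i) (\<lambda>G. G \<in> Conf i) \<le> (C16 C / real n) * (\<Sum>j\<in>{1..l}. miss j)"
proof -
  have miss0: "0 \<le> miss j" for j by (simp add: miss_def)
  have "Pr (F i) (\<lambda>G. G \<in> Conf i) \<le> Pr (F i) (\<lambda>G. \<exists>j\<in>{1..l} - {i}. \<exists>R\<in>RR i j.
      \<exists>D. D \<subseteq> G \<and> D \<in> Idl j \<and> card D = m {i, j} + 1 \<and> D - B j = R)"
  proof (rule Pr_mono)
    fix G assume G: "G \<in> F i" "G \<in> Conf i"
    then obtain j Y where jY: "j \<in> {1..l} - {i}" "Y \<in> Idl j" "m {i, j} < card (G \<inter> Y)" by (auto simp: Conf_def)
    then have "m {i, j} + 1 \<le> card (G \<inter> Y)" by simp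
    then obtain D where D: "D \<subseteq> G \<inter> Y" "card D = m {i, j} + 1" "finite D"
      by (rule obtain_subset_with_card_n)
    have "D \<in> F i" using D downset [OF i G(1)] by blast
    moreover have "D \<in> Idl j" using Ideal_subset [OF _ jY(2)] D by auto
    ultimately have "D - B j \<in> RR i j" using D(2) by (auto simp: RR_def)
    then show "\<exists>j\<in>{1..l} - {i}. \<exists>R\<in>RR i j. \<exists>D. D \<subseteq> G \<and> D \<in> Idl j \<and> card D = m {i, j} + 1 \<and> D - B j = R"
      using jY(1) D \<open>D \<in> Idl j\<close> by blast
  qed (rule finite_F [OF i])
  also have "\<dots> \<le> (\<Sum>j\<in>{1..l} - {i}. Pr (F i) (\<lambda>G. \<exists>R\<in>RR i j.
      \<exists>D. D \<subseteq> G \<and> D \<in> Idl j \<and> card D = m {i, j} + 1 \<and> D - B j = R))"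
    by (rule Pr_Bex [OF finite_F [OF i]]) simp
  also have "\<dots> \<le> (\<Sum>j\<in>{1..l} - {i}. (C16 C / real n) * miss j)"
  proof (rule sum_mono)
    fix j assume j: "j \<in> {1..l} - {i}"
    then have ij: "i \<in> {1..l}" "j \<in> {1..l}" "i \<noteq> j" using i by auto
    have "Pr (F i) (\<lambda>G. \<exists>R\<in>RR i j. \<exists>D. D \<subseteq> G \<and> D \<in> Idl j \<and> card D = m {i, j} + 1 \<and> D - B j = R) \<le>
       (\<Sum>R\<in>RR i j. Pr (F i) (\<lambda>G. \<exists>D. D \<subseteq> G \<and> D \<in> Idl j \<and> card D = m {i, j} + 1 \<and> D - B j = R))"
      by (rule Pr_Bex [OF finite_F [OF i] finite_RR [OF i]])
    also have "\<dots> \<le> (\<Sum>R\<in>RR i j. (C5 C + 2) / real n * (1 / real n ^ card R))"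
    proof (rule sum_mono)
      fix R assume "R \<in> RR i j"
      from Pr_conflict_R [OF ij this]
      show "Pr (F i) (\<lambda>G. \<exists>D. D \<subseteq> G \<and> D \<in> Idl j \<and> card D = m {i, j} + 1 \<and> D - B j = R) \<le>
          (C5 C + 2) / real n * (1 / real n ^ card R)" by (simp add: power_add mult.commute)
    qed
    also have "\<dots> = (C5 C + 2) / real n * (\<Sum>R\<in>RR i j. 1 / real n ^ card R)" by (simp add: sum_distrib_left)
    also have "\<dots> \<le> (C5 C + 2) / real n * (Z9 C * 2 ^ sg * miss j)"
      using C5_ge [of C] by (intro mult_left_mono miss_ge ij) auto
    also have "\<dots> = (C16 C / real n) * miss j" by (simp add: C16_def)
    finally show "Pr (F i) (\<lambda>G. \<exists>R\<in>RR i j. \<exists>D. D \<subseteq> G \<and> D \<in> Idl j \<and> card D = m {i, j} + 1 \<and> D - B j = R)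
      \<le> (C16 C / real n) * miss j" .
  qed
  also have "\<dots> = (C16 C / real n) * (\<Sum>j\<in>{1..l} - {i}. miss j)" by (simp add: sum_distrib_left)
  also have "\<dots> \<le> (C16 C / real n) * (\<Sum>j\<in>{1..l}. miss j)"
    using miss0 C16_nonneg [of C] by (intro mult_left_mono sum_mono2) auto
  finally show ?thesis .
qed

lemma Idl_contained:
  assumes l2: "large2 C n" and j: "j \<in> {1..l}"
  shows "Idl j \<subseteq> F j"
proof -
  define x where "x i = Pr (F i) (\<lambda>G. G \<in> Conf i)" for i
  define F' where "F' i = (F i - Conf i) \<union> Idl i" for i
  have ConfF: "Conf i \<subseteq> F i" for i by (auto simp: Conf_def)
  \<comment> \<open>Ideal members do not conflict among themselves, so nothing added is also removed
    and the new cardinality is exact.\<close>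
  have disj: "Idl i \<inter> Conf i = {}" if "i \<in> {1..l}" for i
    using Idl_Int_le [OF that] by (fastforce simp: Conf_def not_le [symmetric])
  have card: "real (card (F' i)) = real (card (F i)) * (1 - x i + miss i)" if i: "i \<in> {1..l}" for i
  proof -
    have "F' i = (F i - Conf i) \<union> (Idl i - F i)" using disj [OF i] ConfF [of i] by (auto simp: F'_def)
    then have "card (F' i) = card (F i - Conf i) + card (Idl i - F i)"
      using finite_F [OF i] finite_Idl by (simp only:) (rule card_Un_disjoint, auto)
    moreover have "real (card (F i - Conf i)) = real (card (F i)) - real (card (Conf i))"
      using finite_F [OF i] ConfF [of i] by (simp add: card_Diff_subset finite_subset card_mono of_nat_diff)
    moreover have "real (card (Conf i)) = x i * real (card (F i))"
    proof -
      have "{G\<in>F i. G \<in> Conf i} = Conf i" using ConfF by auto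
      then show ?thesis using card_eq_Pr [OF finite_F [OF i] F_nonempty [OF i], of "\<lambda>G. G \<in> Conf i"] by (simp add: x_def)
    qed
    moreover have "real (card (Idl i - F i)) = miss i * real (card (F i))"
      using card_F_pos [OF i] by (simp add: miss_def)
    ultimately show ?thesis by (simp add: algebra_simps)
  qed
  have ov: "overlapping n l m F'"
    unfolding overlapping_def
  proof (intro conjI ballI impI)
    fix i assume i: "i \<in> {1..l}"
    show "F' i \<subseteq> Pow {1..n}" using F_sub [OF i] Idl_sub by (fastforce simp: F'_def)
  next
    fix i k X Y assume ik: "i \<in> {1..l}" "k \<in> {1..l}" "i \<noteq> k" and X: "X \<in> F' i" and Y: "Y \<in> F' k"
    have mixed: "card (X \<inter> Y) \<le> m {i, k}"
      if "i \<in> {1..l}" "k \<in> {1..l}" "i \<noteq> k" "X \<in> F i - Conf i" "Y \<in> Idl k" for i k X Y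
      using that by (auto simp: Conf_def not_less)
    consider "X \<in> F i" "Y \<in> F k" | "X \<in> F i - Conf i" "Y \<in> Idl k" | "X \<in> Idl i" "Y \<in> F k - Conf k" | "X \<in> Idl i" "Y \<in> Idl k"
      using X Y by (auto simp: F'_def)
    then show "card (X \<inter> Y) \<le> m {i, k}"
    proof cases
      case 1 then show ?thesis using card_Int_le ik by blast
    next
      case 2 then show ?thesis using mixed ik by blast
    next
      case 3
      then have "card (Y \<inter> X) \<le> m {k, i}" using mixed ik by blast
      then show ?thesis by (simp add: Int_commute insert_commute)
    next
      case 4 then show ?thesis using Idl_Int_le ik by blast
    qed
  qed
  have "(\<Sum>i\<in>{1..l}. miss i) = 0"
  proof (rule no_gain [where \<kappa> = "C16 C / real n" and x = x and Z = "real l * (real (sg + 1) * real C)"])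
    show "0 \<le> x i \<and> x i \<le> 1 \<and> x i \<le> C16 C / real n * (\<Sum>i\<in>{1..l}. miss i)" if "i \<in> {1..l}" for i
      using Pr_Conf_le [OF that] Pr_le_1 [OF finite_F [OF that]] by (simp add: x_def)
    show "(\<Sum>i\<in>{1..l}. miss i) \<le> real l * (real (sg + 1) * real C)"
    proof -
      have "miss i \<le> real (sg + 1) * real C" if i: "i \<in> {1..l}" for i
      proof -
        have "real (card (Idl i - F i)) \<le> real (card (Idl i))" using finite_Idl by (intro of_nat_mono card_mono) auto
        also have "\<dots> \<le> (real (sg + 1) * real C) * real (card (F i))" by (rule card_Idl_le [OF i])
        finally show ?thesis using card_F_pos [OF i] by (simp add: miss_def divide_le_eq)
      qed
      then show ?thesis using sum_bounded_above [of "{1..l}" miss "real (sg + 1) * real C"] by simp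
    qed
    have "real (card {1..l}) * (C16 C / real n) * (1 + real l * (real (sg + 1) * real C)) =
        (real l * C16 C * (1 + real l * (real (sg + 1) * real C))) / real n" by simp
    also have "\<dots> < 1" using l2 unfolding large2_def by linarith
    finally show "real (card {1..l}) * (C16 C / real n) * (1 + real l * (real (sg + 1) * real C)) < 1" .
    have "(\<Prod>i\<in>{1..l}. real (card (F i))) * (\<Prod>i\<in>{1..l}. 1 - x i + miss i) = (\<Prod>i\<in>{1..l}. real (card (F' i)))"
      using card by (simp add: prod.distrib)
    also have "\<dots> \<le> (\<Prod>i\<in>{1..l}. real (card (F i)))"
      using prod_le_s_star [OF ov] unfolding prod_card [symmetric] by (simp flip: of_nat_prod)
    finally have "(\<Prod>i\<in>{1..l}. real (card (F i))) * (\<Prod>i\<in>{1..l}. 1 - x i + miss i) \<le> (\<Prod>i\<in>{1..l}. real (card (F i))) * 1"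
      by simp
    then show "(\<Prod>i\<in>{1..l}. 1 - x i + miss i) \<le> 1"
      by (rule mult_left_le_imp_le) (use card_F_pos in \<open>auto intro!: prod_pos\<close>)
  qed (use C16_nonneg [of C] in \<open>auto simp: miss_def\<close>)
  then have "miss j = 0" using j by (subst (asm) sum_nonneg_eq_0_iff) (auto simp: miss_def)
  then have "card (Idl j - F j) = 0" using card_F_pos [OF j] by (simp add: miss_def)
  then show ?thesis using finite_Idl by simp
qed

end

section \<open>Asymptotics and conclusion\<close>

lemma binomial_lower:
  assumes "s \<le> a"
  shows "(real a - real s) ^ s \<le> fact s * real (a choose s)"
proof -
  have "(real a - real s) ^ s = (\<Prod>i\<in>{0..<s}. real a - real s)" by simp
  also have "\<dots> \<le> (\<Prod>i\<in>{0..<s}. real a - real i)" using assms by (intro prod_mono) auto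
  also have "\<dots> = fact s * real (a choose s)"
    by (simp add: binomial_gbinomial gbinomial_mult_fact)
  finally show ?thesis .
qed

text \<open>\<eta> is one relative error covering both the deviation \<delta> of a from b and the
  shift by s in the falling factorial.\<close>

lemma binomial_approx:
  fixes a s :: nat and b \<delta> \<eta> :: real
  assumes b: "b > 0" and \<eta>: "(\<delta> + real s) \<le> \<eta> * b" "\<eta> \<le> 1" and ab: "\<bar>real a - b\<bar> \<le> \<delta>"
  shows "(1 - \<eta>) ^ s * ((1 / fact s) * b ^ s) \<le> real (a choose s)"
    and "real (a choose s) \<le> (1 + \<eta>) ^ s * ((1 / fact s) * b ^ s)"
proof -
  have low: "(1 - \<eta>) * b \<le> real a - real s" using \<eta> ab by (simp add: algebra_simps)
  moreover have pos: "0 \<le> (1 - \<eta>) * b" using \<eta> b by simp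
  ultimately have "s \<le> a" by linarith
  have "((1 - \<eta>) * b) ^ s \<le> (real a - real s) ^ s" by (rule power_mono [OF low pos])
  also have "\<dots> \<le> fact s * real (a choose s)" by (rule binomial_lower) fact
  finally show "(1 - \<eta>) ^ s * ((1 / fact s) * b ^ s) \<le> real (a choose s)"
    by (simp add: power_mult_distrib divide_le_eq mult.commute)
  have "real ((a choose s) * fact s) \<le> real (a ^ s)"
    using binomial_fact_pow [of a s] by (simp only: of_nat_le_iff)
  then have "real (a choose s) * fact s \<le> real a ^ s" by simp
  also have "\<dots> \<le> ((1 + \<eta>) * b) ^ s"
  proof (rule power_mono)
    show "real a \<le> (1 + \<eta>) * b" using \<eta> ab by (simp add: algebra_simps)
  qed simp
  finally show "real (a choose s) \<le> (1 + \<eta>) ^ s * ((1 / fact s) * b ^ s)"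
    by (simp add: power_mult_distrib pos_le_divide_eq)
qed

context grown
begin

text \<open>\<open>gain 0 = 1\<close>, so the direction with cap 0 is neutral and
  \<open>main_term\<close> can be written over ordered pairs.\<close>

definition gain :: "nat \<Rightarrow> real" where
  "gain t = (1 / fact t) * (real t * real n / real sg) ^ t"

lemma main_term_eq:
  "main_term n l m = 2 ^ n * (\<Prod>j\<in>{1..l}. \<Prod>k\<in>{1..l} - {j}. gain (\<tau> j k))"
proof -
  have "(\<Prod>S\<in>pairs l. gain (m S)) = (\<Prod>(j, k)\<in>ordpairs l. gain (\<tau> j k) * gain (\<tau> k j))"
    unfolding prod_pairs
  proof (rule prod.cong [OF refl], clarify)
    fix j k assume "(j, k) \<in> ordpairs l"
    then have jk: "j \<in> {1..l}" "k \<in> {1..l}" "j \<noteq> k" by (auto simp: ordpairs_def)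
    have "gain 0 = 1" by (simp add: gain_def)
    then show "gain (m {j, k}) = gain (\<tau> j k) * gain (\<tau> k j)"
      using orientation [OF jk] type_sum [OF jk] by auto
  qed
  then show ?thesis unfolding prod_offdiag
    by (simp add: main_term_def gain_def sg_def)
qed

lemma gain_pos: "gain t > 0"
  using n_pos sg_pos by (cases "t = 0") (auto simp: gain_def)

lemma s_star_approx:
  assumes \<delta>: "\<delta> \<ge> 0" "\<And>j k. j \<in> {1..l} \<Longrightarrow> k \<in> {1..l} \<Longrightarrow> j \<noteq> k \<Longrightarrow>
      \<bar>real (card (A j k)) - real (\<tau> j k) * real n / real sg\<bar> \<le> \<delta>"
    and \<theta>: "\<theta> = (real l * C6 C + real (l * l * sg) * ((\<delta> + real sg) * real sg)) / real n" "\<theta> \<le> 1 / 2"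
  shows "\<bar>real (s_star n l m) - main_term n l m\<bar> \<le> 2 * \<theta> * main_term n l m"
proof -
  define \<eta> where "\<eta> = (\<delta> + real sg) * real sg / real n"
  define N where "N = l * l * sg"
  define Pb where "Pb = (\<Prod>j\<in>{1..l}. \<Prod>k\<in>{1..l} - {j}. real (card (A j k) choose \<tau> j k))"
  define Q where "Q = (\<Prod>j\<in>{1..l}. \<Prod>k\<in>{1..l} - {j}. gain (\<tau> j k))"
  have \<eta>0: "\<eta> \<ge> 0" using \<delta> by (simp add: \<eta>_def)
  have \<theta>_eq: "\<theta> = real l * C6 C / real n + real N * \<eta>"
    by (simp add: \<theta>(1) \<eta>_def N_def add_divide_distrib)
  have C60: "real l * C6 C / real n \<ge> 0" using C6_pos [of C] by simp
  have N\<eta>: "real N * \<eta> \<le> 1 / 2" using \<theta>(2) \<theta>_eq C60 by linarith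
  have N1: "real N \<ge> 1"
  proof -
    have "1 * 1 * 1 \<le> l * l * sg" using l_ge sg_pos by (intro mult_le_mono) auto
    then have "1 \<le> N" by (simp add: N_def)
    then show ?thesis by simp
  qed
  have \<eta>1: "\<eta> \<le> 1"
  proof -
    have "1 * \<eta> \<le> real N * \<eta>" using N1 \<eta>0 by (intro mult_right_mono)
    then show ?thesis using N\<eta> by linarith
  qed
  have Q0: "Q > 0" unfolding Q_def using gain_pos by (intro prod_pos) auto
  have each: "(1 - \<eta>) ^ sg * gain (\<tau> j k) \<le> real (card (A j k) choose \<tau> j k)"
    "real (card (A j k) choose \<tau> j k) \<le> (1 + \<eta>) ^ sg * gain (\<tau> j k)"
    if jk: "j \<in> {1..l}" "k \<in> {1..l}" "j \<noteq> k" for j k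
  proof -
    have tsg: "\<tau> j k \<le> sg" using type_sum [OF jk] m_le_sg [OF jk] by linarith
    have "(1 - \<eta>) ^ \<tau> j k * gain (\<tau> j k) \<le> real (card (A j k) choose \<tau> j k) \<and>
      real (card (A j k) choose \<tau> j k) \<le> (1 + \<eta>) ^ \<tau> j k * gain (\<tau> j k)"
    proof (cases "\<tau> j k = 0")
      case True
      then show ?thesis by (simp add: gain_def)
    next
      case False
      define b where "b = real (\<tau> j k) * real n / real sg"
      have b1: "b \<ge> real n / real sg" unfolding b_def
        using False mult_right_mono [of 1 "real (\<tau> j k)" "real n"] by (intro divide_right_mono) auto
      have b0: "b > 0" using False n_pos sg_pos by (simp add: b_def)
      have "\<delta> + real (\<tau> j k) \<le> \<delta> + real sg" using tsg by simp
      also have "\<dots> = \<eta> * (real n / real sg)" using n_pos sg_pos by (simp add: \<eta>_def)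
      also have "\<dots> \<le> \<eta> * b" using b1 \<eta>0 by (intro mult_left_mono)
      finally show ?thesis
        using binomial_approx [OF b0 _ \<eta>1 \<delta>(2) [OF jk, folded b_def]] by (simp add: gain_def b_def)
    qed
    moreover have "(1 - \<eta>) ^ sg * gain (\<tau> j k) \<le> (1 - \<eta>) ^ \<tau> j k * gain (\<tau> j k)"
      using tsg \<eta>0 \<eta>1 gain_pos [of "\<tau> j k"] by (intro mult_right_mono power_decreasing) auto
    moreover have "(1 + \<eta>) ^ \<tau> j k * gain (\<tau> j k) \<le> (1 + \<eta>) ^ sg * gain (\<tau> j k)"
      using tsg \<eta>0 gain_pos [of "\<tau> j k"] by (intro mult_right_mono power_increasing) auto
    ultimately show "(1 - \<eta>) ^ sg * gain (\<tau> j k) \<le> real (card (A j k) choose \<tau> j k)"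
      "real (card (A j k) choose \<tau> j k) \<le> (1 + \<eta>) ^ sg * gain (\<tau> j k)" by linarith+
  qed
  define M where "M = (\<Sum>j\<in>{1..l}. card ({1..l} - {j})) * sg"
  have MN: "M \<le> N"
  proof -
    have "(\<Sum>j\<in>{1..l}. card ({1..l} - {j})) \<le> (\<Sum>j\<in>{1..l}. l)"
      using card_mono [of "{1..l}"] by (intro sum_mono) (metis Diff_subset card_atLeastAtMost diff_Suc_1 finite_atLeastAtMost One_nat_def)
    then show ?thesis by (simp add: M_def N_def)
  qed
  have collect: "(\<Prod>j\<in>{1..l}. \<Prod>k\<in>{1..l} - {j}. c ^ sg * gain (\<tau> j k)) = c ^ M * Q" for c :: real
    unfolding M_def Q_def
    by (simp only: prod.distrib prod_constant power_mult [symmetric] power_sum [symmetric]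
        sum_distrib_right mult.commute [of sg])
  have bern: "1 - real N * \<eta> \<le> (1 - \<eta>) ^ M"
  proof -
    have "1 - real N * \<eta> \<le> 1 + real M * (- \<eta>)" using MN \<eta>0 by (simp add: mult_right_mono)
    also have "\<dots> \<le> (1 + (- \<eta>)) ^ M" by (rule Bernoulli_inequality) (use \<eta>1 in simp)
    finally show ?thesis by simp
  qed
  have PQ1: "(1 - real N * \<eta>) * Q \<le> Pb"
  proof -
    have "(1 - real N * \<eta>) * Q \<le> (1 - \<eta>) ^ M * Q" using bern Q0 by (intro mult_right_mono) auto
    also have "\<dots> \<le> Pb" unfolding collect [symmetric] Pb_def
      using each(1) \<eta>1 gain_pos [THEN less_imp_le] by (intro prod_mono conjI prod_nonneg) auto
    finally show ?thesis .
  qed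
  \<comment> \<open>By (1 - \<eta>)(1 + \<eta>) \<le> 1 the upper bound with 1 + \<eta> is restated
    with a factor on the left, so both directions share one \<theta>.\<close>
  have PQ2: "(1 - real N * \<eta>) * Pb \<le> Q"
  proof -
    have "Pb \<le> (1 + \<eta>) ^ M * Q" unfolding collect [symmetric] Pb_def
      using each(2) by (intro prod_mono conjI prod_nonneg) auto
    moreover have "0 \<le> Pb" unfolding Pb_def by (intro prod_nonneg) auto
    ultimately have "(1 - real N * \<eta>) * Pb \<le> (1 - \<eta>) ^ M * ((1 + \<eta>) ^ M * Q)"
      using bern \<eta>1 by (intro mult_mono) auto
    also have "\<dots> = ((1 - \<eta>) * (1 + \<eta>)) ^ M * Q" by (simp add: power_mult_distrib)
    also have "(1 - \<eta>) * (1 + \<eta>) = 1 - \<eta> * \<eta>" by (simp add: algebra_simps)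
    also have "(1 - \<eta> * \<eta>) ^ M * Q \<le> 1 * Q"
      using \<eta>0 \<eta>1 Q0 mult_le_one [of \<eta> \<eta>] by (intro mult_right_mono power_le_one) auto
    finally show ?thesis by simp
  qed
  have mt: "main_term n l m = 2 ^ n * Q" by (simp add: main_term_eq Q_def)
  have low: "2 ^ n * Pb \<le> real (s_star n l m)"
  proof -
    have "2 ^ n * (\<Prod>j\<in>{1..l}. \<Prod>k\<in>{1..l} - {j}. card {v\<in>{1..n}. own v = k \<and> limr v = j} choose \<tau> j k) \<le> s_star n l m"
      by (rule s_star_ge_Ideal) (use type_sum own_mem in auto)
    then have "real (2 ^ n * (\<Prod>j\<in>{1..l}. \<Prod>k\<in>{1..l} - {j}. card (A j k) choose \<tau> j k)) \<le> real (s_star n l m)"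
      unfolding A_def by (simp only: of_nat_le_iff)
    then show ?thesis by (simp add: Pb_def)
  qed
  have up: "(1 - real l * C6 C / real n) * real (s_star n l m) \<le> 2 ^ n * Pb"
  proof -
    have "1 + real l * (- (C6 C / real n)) \<le> (1 + - (C6 C / real n)) ^ l"
      by (intro Bernoulli_inequality) (use C6_half in linarith)
    then have "(1 - real l * C6 C / real n) * real (s_star n l m) \<le> (1 - C6 C / real n) ^ l * real (s_star n l m)"
      by (intro mult_right_mono) auto
    also have "\<dots> \<le> 2 ^ n * Pb" unfolding Pb_def by (rule s_star_le)
    finally show ?thesis .
  qed
  have l1: "main_term n l m - \<theta> * main_term n l m \<le> real (s_star n l m)"
  proof -
    have "(1 - \<theta>) * (2 ^ n * Q) \<le> (1 - real N * \<eta>) * (2 ^ n * Q)"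
      using \<theta>_eq C60 Q0 by (intro mult_right_mono) auto
    also have "\<dots> = 2 ^ n * ((1 - real N * \<eta>) * Q)" by simp
    also have "\<dots> \<le> 2 ^ n * Pb" by (intro mult_left_mono PQ1) simp
    finally show ?thesis using low by (simp add: mt left_diff_distrib)
  qed
  have u1: "(1 - \<theta>) * real (s_star n l m) \<le> main_term n l m"
  proof -
    have "(1 - \<theta>) \<le> (1 - real N * \<eta>) * (1 - real l * C6 C / real n)"
    proof -
      have "0 \<le> (real N * \<eta>) * (real l * C6 C / real n)"
        using C60 \<eta>0 by (intro mult_nonneg_nonneg) auto
      moreover have "1 - (y + x) \<le> (1 - x) * (1 - y)" if "0 \<le> x * y" for x y :: real
        using that by (simp add: algebra_simps)
      ultimately show ?thesis unfolding \<theta>_eq by blast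
    qed
    then have "(1 - \<theta>) * real (s_star n l m) \<le> (1 - real N * \<eta>) * (1 - real l * C6 C / real n) * real (s_star n l m)"
      by (rule mult_right_mono) simp
    also have "\<dots> = (1 - real N * \<eta>) * ((1 - real l * C6 C / real n) * real (s_star n l m))" by simp
    also have "\<dots> \<le> (1 - real N * \<eta>) * (2 ^ n * Pb)" using N\<eta> by (intro mult_left_mono up) auto
    also have "\<dots> = 2 ^ n * ((1 - real N * \<eta>) * Pb)" by simp
    also have "\<dots> \<le> 2 ^ n * Q" by (intro mult_left_mono PQ2) simp
    finally show ?thesis by (simp add: mt)
  qed
  have mt0: "main_term n l m > 0" using Q0 by (simp add: mt)
  have \<theta>0: "\<theta> \<ge> 0" using \<theta>_eq C60 \<eta>0 by simp
  \<comment> \<open>\<theta> \<le> 1/2 gives a crude factor 2, which converts an error relative to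
    \<open>s_star\<close> into one relative to \<open>main_term\<close>.\<close>
  have "(1 / 2) * real (s_star n l m) \<le> (1 - \<theta>) * real (s_star n l m)"
    using \<theta>(2) by (intro mult_right_mono) auto
  then have "real (s_star n l m) \<le> 2 * main_term n l m" using u1 by linarith
  then have "\<theta> * real (s_star n l m) \<le> \<theta> * (2 * main_term n l m)" using \<theta>0 by (intro mult_left_mono)
  then have "real (s_star n l m) \<le> main_term n l m + 2 * \<theta> * main_term n l m"
    using u1 by (simp add: left_diff_distrib)
  moreover have "0 \<le> \<theta> * main_term n l m" using \<theta>0 mt0 by simp
  ultimately show ?thesis using l1 by (simp add: abs_le_iff)
qed

text \<open>Edges point from the limited family to the owner, so the parts on incoming edges are the
  free ones.\<close>

definition edges :: "(nat \<times> nat) set" where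
  "edges = {(j, k). j \<in> {1..l} \<and> k \<in> {1..l} \<and> j \<noteq> k \<and> \<tau> j k > 0}"

lemma edges_tau: "(j, k) \<in> edges \<Longrightarrow> \<tau> j k = m {j, k}"
  using type_cases [of j k] by (auto simp: edges_def)

lemma join_subset_Idl:
  assumes k: "k \<in> {1..l}"
  shows "join (Pow (\<Union>k'\<in>{k'. (k', k) \<in> edges}. A k' k))
      (Join {k'. (k, k') \<in> edges} (\<lambda>k'. subsets_le (A k k') (m {k, k'}))) \<subseteq> Idl k"
proof
  fix W assume "W \<in> join (Pow (\<Union>k'\<in>{k'. (k', k) \<in> edges}. A k' k))
      (Join {k'. (k, k') \<in> edges} (\<lambda>k'. subsets_le (A k k') (m {k, k'})))"
  then obtain X g where W: "W = X \<union> \<Union> (g ` {k'. (k, k') \<in> edges})"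
    and X: "X \<subseteq> (\<Union>k'\<in>{k'. (k', k) \<in> edges}. A k' k)"
    and g: "\<And>k'. (k, k') \<in> edges \<Longrightarrow> g k' \<subseteq> A k k' \<and> card (g k') \<le> m {k, k'}"
    unfolding join_def Join_def subsets_le_def by blast
  have Xv: "own v = k" "v \<in> {1..n}" if "v \<in> X" for v using X that by (auto simp: A_def)
  have gv: "own v = k'" "limr v = k" "v \<in> {1..n}" if "(k, k') \<in> edges" "v \<in> g k'" for v k'
    using g [OF that(1)] that(2) by (auto simp: A_def)
  have "card {v\<in>W. own v = k' \<and> limr v = k} \<le> \<tau> k k'" if k': "k' \<noteq> k" for k'
  proof (cases "(k, k') \<in> edges")
    case True
    have "{v\<in>W. own v = k' \<and> limr v = k} \<subseteq> g k'" using W Xv gv k' by auto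
    moreover have "finite (g k')" using g [OF True] finite_A finite_subset by blast
    ultimately have "card {v\<in>W. own v = k' \<and> limr v = k} \<le> card (g k')" by (intro card_mono)
    then show ?thesis using g [OF True] edges_tau [OF True] by simp
  next
    case False
    have "{v\<in>W. own v = k' \<and> limr v = k} = {}" using W Xv gv k' False by auto
    then show ?thesis by (simp only: card.empty)
  qed
  then show "W \<in> Idl k" using W Xv gv unfolding Ideal_def by auto
qed

lemma extremal_structure:
  assumes l2: "large2 C n" and K: "K \<ge> 0" "real sg / real n - K / real n ^ 2 \<le> gr n"
    and Cf: "real (l * l) * (K + C8 C) * real sg \<le> Cf"
  shows "\<exists>E A. E \<subseteq> {1..l} \<times> {1..l} \<and>
         (\<forall>k1\<in>{1..l}. \<forall>k2\<in>{1..l}. k1 \<noteq> k2 \<longrightarrow>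
            (((k1, k2) \<in> E \<or> (k2, k1) \<in> E) \<longleftrightarrow> m {k1, k2} > 0) \<and>
            \<not> ((k1, k2) \<in> E \<and> (k2, k1) \<in> E)) \<and>
         (\<forall>k. (k, k) \<notin> E) \<and>
         (\<Union>e\<in>E. A e) = {1..n} \<and>
         (\<forall>e\<in>E. \<forall>e'\<in>E. e \<noteq> e' \<longrightarrow> A e \<inter> A e' = {}) \<and>
         (\<forall>(k, k')\<in>E.
            \<bar>real (card (A (k, k'))) - real (m {k, k'}) * real n / real (\<Sum>S\<in>pairs l. m S)\<bar>
              \<le> Cf / real n * (real (m {k, k'}) * real n / real (\<Sum>S\<in>pairs l. m S))) \<and>
         (\<forall>k\<in>{1..l}.
            join (Pow (\<Union>k'\<in>{k'. (k', k) \<in> E}. A (k', k)))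
                 (Join {k'. (k, k') \<in> E} (\<lambda>k'. subsets_le (A (k, k')) (m {k, k'})))
              \<subseteq> F k)"
proof (intro exI conjI)
  let ?A = "\<lambda>(j, k). A j k"
  show "edges \<subseteq> {1..l} \<times> {1..l}" by (auto simp: edges_def)
  show "\<forall>k1\<in>{1..l}. \<forall>k2\<in>{1..l}. k1 \<noteq> k2 \<longrightarrow>
            (((k1, k2) \<in> edges \<or> (k2, k1) \<in> edges) \<longleftrightarrow> m {k1, k2} > 0) \<and>
            \<not> ((k1, k2) \<in> edges \<and> (k2, k1) \<in> edges)"
  proof (intro ballI impI)
    fix k1 k2 assume k: "k1 \<in> {1..l}" "k2 \<in> {1..l}" "k1 \<noteq> k2"
    show "(((k1, k2) \<in> edges \<or> (k2, k1) \<in> edges) \<longleftrightarrow> m {k1, k2} > 0) \<and>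
            \<not> ((k1, k2) \<in> edges \<and> (k2, k1) \<in> edges)"
      using orientation [OF k] type_sum [OF k, symmetric] k by (auto simp: edges_def)
  qed
  show "\<forall>k. (k, k) \<notin> edges" by (auto simp: edges_def)
  show "(\<Union>e\<in>edges. ?A e) = {1..n}"
  proof
    show "(\<Union>e\<in>edges. ?A e) \<subseteq> {1..n}" by (auto simp: A_def)
    show "{1..n} \<subseteq> (\<Union>e\<in>edges. ?A e)"
    proof
      fix v assume v: "v \<in> {1..n}"
      then have vA: "v \<in> A (limr v) (own v)" by (simp add: A_def)
      then have "\<tau> (limr v) (own v) \<noteq> 0"
        using A_empty [of "limr v" "own v"] own_mem [OF v] limr_mem [OF v] by auto
      then have "(limr v, own v) \<in> edges"
        using own_mem [OF v] limr_mem [OF v] by (auto simp: edges_def)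
      then show "v \<in> (\<Union>e\<in>edges. ?A e)" using vA by (intro UN_I) auto
    qed
  qed
  show "\<forall>e\<in>edges. \<forall>e'\<in>edges. e \<noteq> e' \<longrightarrow> ?A e \<inter> ?A e' = {}" by (auto simp: A_def)
  show "\<forall>(k, k')\<in>edges.
            \<bar>real (card (?A (k, k'))) - real (m {k, k'}) * real n / real (\<Sum>S\<in>pairs l. m S)\<bar>
              \<le> Cf / real n * (real (m {k, k'}) * real n / real (\<Sum>S\<in>pairs l. m S))"
  proof clarify
    fix j k assume e: "(j, k) \<in> edges"
    then have jk: "j \<in> {1..l}" "k \<in> {1..l}" "j \<noteq> k" by (auto simp: edges_def)
    have m1: "m {j, k} \<ge> 1" using e edges_tau [OF e] by (auto simp: edges_def)
    have 1: "\<bar>real (card (A j k)) - real (m {j, k}) * real n / real sg\<bar> \<le> real (l * l) * (K + C8 C)"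
      using card_A_approx [OF K jk] by (simp only: edges_tau [OF e])
    \<comment> \<open>The absolute error is bounded and the target size is at least n/sg because the
      cap is at least 1; this makes the relative error O(1/n).\<close>
    have "real (l * l) * (K + C8 C) * 1 \<le> real (l * l) * (K + C8 C) * real (m {j, k})"
      using m1 K C8_nonneg [of C] by (intro mult_left_mono) auto
    also have "\<dots> = (real (l * l) * (K + C8 C) * real sg) / real n * (real (m {j, k}) * real n / real sg)"
      using n_pos sg_pos by simp
    also have "\<dots> \<le> Cf / real n * (real (m {j, k}) * real n / real sg)"
      using Cf by (intro mult_right_mono divide_right_mono) auto
    finally show "\<bar>real (card (A j k)) - real (m {j, k}) * real n / real (\<Sum>S\<in>pairs l. m S)\<bar>
              \<le> Cf / real n * (real (m {j, k}) * real n / real (\<Sum>S\<in>pairs l. m S))"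
      using 1 unfolding sg_def [symmetric] by linarith
  qed
  show "\<forall>k\<in>{1..l}.
            join (Pow (\<Union>k'\<in>{k'. (k', k) \<in> edges}. ?A (k', k)))
                 (Join {k'. (k, k') \<in> edges} (\<lambda>k'. subsets_le (?A (k, k')) (m {k, k'})))
              \<subseteq> F k"
    unfolding case_prod_conv using join_subset_Idl Idl_contained [OF l2] by blast
qed

end

theorem mainTheorem1:
  fixes l :: nat and m :: "nat set \<Rightarrow> nat"
  assumes "l \<ge> 2"
    and "(\<Sum>S\<in>pairs l. m S) > 0"
  shows "\<exists>C::real. \<exists>N::nat.
    (\<forall>n\<ge>N. \<bar>real (s_star n l m) - main_term n l m\<bar> \<le> C / real n * main_term n l m) \<and>
    (\<forall>n\<ge>N. \<forall>F. extremal n l m F \<longrightarrow>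
      (\<exists>(E :: (nat \<times> nat) set) (A :: nat \<times> nat \<Rightarrow> nat set).
         E \<subseteq> {1..l} \<times> {1..l} \<and>
         (\<forall>k1\<in>{1..l}. \<forall>k2\<in>{1..l}. k1 \<noteq> k2 \<longrightarrow>
            (((k1, k2) \<in> E \<or> (k2, k1) \<in> E) \<longleftrightarrow> m {k1, k2} > 0) \<and>
            \<not> ((k1, k2) \<in> E \<and> (k2, k1) \<in> E)) \<and>
         (\<forall>k. (k, k) \<notin> E) \<and>
         (\<Union>e\<in>E. A e) = {1..n} \<and>
         (\<forall>e\<in>E. \<forall>e'\<in>E. e \<noteq> e' \<longrightarrow> A e \<inter> A e' = {}) \<and>
         (\<forall>(k, k')\<in>E.
            \<bar>real (card (A (k, k'))) - real (m {k, k'}) * real n / real (\<Sum>S\<in>pairs l. m S)\<bar>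
              \<le> C / real n * (real (m {k, k'}) * real n / real (\<Sum>S\<in>pairs l. m S))) \<and>
         (\<forall>k\<in>{1..l}.
            join (Pow (\<Union>k'\<in>{k'. (k', k) \<in> E}. A (k', k)))
                 (Join {k'. (k, k') \<in> E} (\<lambda>k'. subsets_le (A (k, k')) (m {k, k'})))
              \<subseteq> F k)))"
proof -
  interpret overlap_problem l m by unfold_locales (use assms in auto)
  obtain C :: nat where C: "\<forall>\<^sub>F n in sequentially. \<forall>F. extremal n l m F \<longrightarrow> (\<exists>B \<tau>. grown n l m F C B \<tau>)"
    by (rule grown_exists)
  obtain K where K: "K \<ge> 0" "\<forall>\<^sub>F n in sequentially. real sg / real n - K / real n ^ 2 \<le> gr n"
    by (rule gr_lower)
  define \<delta> where "\<delta> = real (l * l) * (K + C8 C)"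
  define \<theta> where "\<theta> = real l * C6 C + real (l * l * sg) * ((\<delta> + real sg) * real sg)"
  \<comment> \<open>One constant for both claims: 2 \<theta> serves the asymptotics of
    \<open>s_star\<close> and \<delta> sg the part sizes, both summands being non-negative.\<close>
  define Cf where "Cf = 2 * \<theta> + \<delta> * real sg"
  have \<delta>0: "\<delta> \<ge> 0" using K C8_nonneg [of C] by (simp add: \<delta>_def)
  have \<theta>0: "\<theta> \<ge> 0" using \<delta>0 C6_pos [of C] by (simp add: \<theta>_def)
  have "\<forall>\<^sub>F n in sequentially. \<theta> / real n \<le> 1 / 2" by (rule eventually_divide_le) simp
  with C K(2) eventually_large2 [of C]
  have "\<forall>\<^sub>F n in sequentially. (\<forall>F. extremal n l m F \<longrightarrow> (\<exists>B \<tau>. grown n l m F C B \<tau>)) \<and>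
      real sg / real n - K / real n ^ 2 \<le> gr n \<and> large2 C n \<and> \<theta> / real n \<le> 1 / 2"
    by eventually_elim simp
  then obtain N where N: "\<And>n F. n \<ge> N \<Longrightarrow> extremal n l m F \<Longrightarrow> \<exists>B \<tau>. grown n l m F C B \<tau>"
    "\<And>n. n \<ge> N \<Longrightarrow> real sg / real n - K / real n ^ 2 \<le> gr n"
    "\<And>n. n \<ge> N \<Longrightarrow> large2 C n" "\<And>n. n \<ge> N \<Longrightarrow> \<theta> / real n \<le> 1 / 2"
    unfolding eventually_sequentially by blast
  show ?thesis
  proof (intro exI [of _ Cf] exI [of _ N] conjI allI impI)
    fix n assume n: "N \<le> n"
    obtain F where "extremal n l m F" using ex_extremal by blast
    then obtain B \<tau> where "grown n l m F C B \<tau>" using N(1) n by blast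
    then interpret grown n l m F C B \<tau> .
    have "\<bar>real (s_star n l m) - main_term n l m\<bar> \<le> 2 * (\<theta> / real n) * main_term n l m"
      by (rule s_star_approx [OF \<delta>0 card_A_approx [OF K(1) N(2) [OF n], folded \<delta>_def]])
         (use N(4) [OF n] in \<open>auto simp: \<theta>_def\<close>)
    also have "\<dots> \<le> Cf / real n * main_term n l m"
    proof (rule mult_right_mono)
      show "2 * (\<theta> / real n) \<le> Cf / real n"
        using \<delta>0 by (simp add: Cf_def divide_right_mono)
      show "0 \<le> main_term n l m"
        unfolding main_term_eq using gain_pos [THEN less_imp_le] by (intro mult_nonneg_nonneg prod_nonneg) auto
    qed
    finally show "\<bar>real (s_star n l m) - main_term n l m\<bar> \<le> Cf / real n * main_term n l m" .
  next
    fix n F assume n: "N \<le> n" and "extremal n l m F"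
    then obtain B \<tau> where "grown n l m F C B \<tau>" using N(1) by blast
    then interpret grown n l m F C B \<tau> .
    show "\<exists>(E :: (nat \<times> nat) set) (A :: nat \<times> nat \<Rightarrow> nat set).
         E \<subseteq> {1..l} \<times> {1..l} \<and>
         (\<forall>k1\<in>{1..l}. \<forall>k2\<in>{1..l}. k1 \<noteq> k2 \<longrightarrow>
            (((k1, k2) \<in> E \<or> (k2, k1) \<in> E) \<longleftrightarrow> m {k1, k2} > 0) \<and>
            \<not> ((k1, k2) \<in> E \<and> (k2, k1) \<in> E)) \<and>
         (\<forall>k. (k, k) \<notin> E) \<and>
         (\<Union>e\<in>E. A e) = {1..n} \<and>
         (\<forall>e\<in>E. \<forall>e'\<in>E. e \<noteq> e' \<longrightarrow> A e \<inter> A e' = {}) \<and>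
         (\<forall>(k, k')\<in>E.
            \<bar>real (card (A (k, k'))) - real (m {k, k'}) * real n / real (\<Sum>S\<in>pairs l. m S)\<bar>
              \<le> Cf / real n * (real (m {k, k'}) * real n / real (\<Sum>S\<in>pairs l. m S))) \<and>
         (\<forall>k\<in>{1..l}.
            join (Pow (\<Union>k'\<in>{k'. (k', k) \<in> E}. A (k', k)))
                 (Join {k'. (k, k') \<in> E} (\<lambda>k'. subsets_le (A (k, k')) (m {k, k'})))
              \<subseteq> F k)"
      by (rule extremal_structure [OF N(3) [OF n] K(1) N(2) [OF n]]) (use \<theta>0 in \<open>simp add: Cf_def \<delta>_def\<close>)
  qed
qed

end
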